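(* Let $T=(T(s),s>0)$ be a non-decreasing self-similar additive (SSA) process with no drift component and with key function $k$, and suppose that $k(0+):=\lim_{x\to 0+}k(x)=\theta$ is finite. Then: (I) $\mathrm{range}(T):=\{T(s):s>0\}$ (regarded as a random subset of $(0,\infty)$) is a scale invariant point process on $(0,\infty)$ with rate $\theta$; (II) the set of jump times of $T$, $\{s>0: T(s)>T(s-)\}$, is a scale invariant Poisson point process on $(0,\infty)$ with rate $\theta$; (III) the set of jump sizes of $T$, $\{T(s)-T(s-): s>0,\ T(s)>T(s-)\}$, is a scale invariant Poisson point process on $(0,\infty)$ with rate $\theta$.
   Context: A stochastic process $T=(T(s),s>0)$ is self-similar additive (SSA) if (i) for all $c>0$, $(T(cs),s>0)$ and $(cT(s),s>0)$ have the same finite-dimensional distributions; and (ii) $T$ has independent increments, is stochastically continuous, has càdlàg paths, and $\lim_{s\to0+}T(s)=0$. For a non-decreasing SSA process, "no drift component" means that $T(s)$ is the sum of its jumps up to time $s$; in that case there is a unique right-continuous non-increasing function $k:(0,\infty)\to[0,\infty)$, called the key function of $T$, with $\int_0^\infty (x\wedge 1)\frac{k(x)}{x}\,dx<\infty$ and $\log \mathbb{E}e^{-uT(1)}=\int_0^\infty (e^{-ux}-1)\frac{k(x)}{x}\,dx$ for $u\ge 0$. A simple point process on $(0,\infty)$ is identified with the random countable set $X$ of its points (so that its value on a Borel set $B$ is the number of points of $X$ in $B$). It is scale invariant if $cX$ has the same distribution as $X$ for every $c>0$; it has rate $\theta$ if its mean (intensity) measure is $\theta x^{-1}dx$. A scale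 invariant Poisson point process with rate $\theta$ is a Poisson point process on $(0,\infty)$ with intensity measure $\theta x^{-1}dx$. *)

theory Defs
  imports "HOL-Probability.Probability"
begin

section \<open>Self-similar additive processes\<close>

text \<open>
  A process \<open>(T(s), s > 0)\<close> is a function \<open>T :: real \<Rightarrow> 'w \<Rightarrow> real\<close>; only its values at positive
  times are ever used. Path properties are required almost surely.
\<close>

definition cadlag_path :: "(real \<Rightarrow> real) \<Rightarrow> bool" where
  "cadlag_path f \<longleftrightarrow>
     (\<forall>s>0. (f \<longlongrightarrow> f s) (at_right s) \<and> (\<exists>l. (f \<longlongrightarrow> l) (at_left s)))"

definition left_lim :: "(real \<Rightarrow> real) \<Rightarrow> real \<Rightarrow> real" where
  "left_lim f s = Lim (at_left s) f"

definition self_similar :: "'w measure \<Rightarrow> (real \<Rightarrow> 'w \<Rightarrow> real) \<Rightarrow> bool" where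
  "self_similar M T \<longleftrightarrow>
     (\<forall>c>0. \<forall>J. finite J \<and> J \<subseteq> {0<..} \<longrightarrow>
        distr M (PiM J (\<lambda>_. borel)) (\<lambda>\<omega>. \<lambda>s\<in>J. T (c * s) \<omega>) =
        distr M (PiM J (\<lambda>_. borel)) (\<lambda>\<omega>. \<lambda>s\<in>J. c * T s \<omega>))"

text \<open>Only increments between strictly positive times are constrained.\<close>

definition independent_increments :: "'w measure \<Rightarrow> (real \<Rightarrow> 'w \<Rightarrow> real) \<Rightarrow> bool" where
  "independent_increments M T \<longleftrightarrow>
     (\<forall>(n::nat) t. 0 < t 0 \<and> strict_mono_on {..n} t \<longrightarrow>
        prob_space.indep_vars M (\<lambda>_. borel) (\<lambda>i \<omega>. T (t (Suc i)) \<omega> - T (t i) \<omega>) {..<n})"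

definition stochastically_continuous :: "'w measure \<Rightarrow> (real \<Rightarrow> 'w \<Rightarrow> real) \<Rightarrow> bool" where
  "stochastically_continuous M T \<longleftrightarrow>
     (\<forall>s>0. \<forall>\<epsilon>>0. ((\<lambda>t. measure M {\<omega> \<in> space M. \<bar>T t \<omega> - T s \<omega>\<bar> > \<epsilon>}) \<longlongrightarrow> 0) (at s))"

definition SSA_process :: "'w measure \<Rightarrow> (real \<Rightarrow> 'w \<Rightarrow> real) \<Rightarrow> bool" where
  "SSA_process M T \<longleftrightarrow>
     (\<forall>s>0. T s \<in> borel_measurable M) \<and>
     self_similar M T \<and>
     independent_increments M T \<and>
     stochastically_continuous M T \<and>
     (AE \<omega> in M. cadlag_path (\<lambda>s. T s \<omega>)) \<and>
     (AE \<omega> in M. ((\<lambda>s. T s \<omega>) \<longlongrightarrow> 0) (at_right 0))"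

definition nondecreasing_process :: "'w measure \<Rightarrow> (real \<Rightarrow> 'w \<Rightarrow> real) \<Rightarrow> bool" where
  "nondecreasing_process M T \<longleftrightarrow> (AE \<omega> in M. mono_on {0<..} (\<lambda>s. T s \<omega>))"

definition jump_times :: "(real \<Rightarrow> real) \<Rightarrow> real set" where
  "jump_times f = {s. 0 < s \<and> f s > left_lim f s}"

definition jump_sizes :: "(real \<Rightarrow> real) \<Rightarrow> real set" where
  "jump_sizes f = {f s - left_lim f s | s. 0 < s \<and> f s > left_lim f s}"

text \<open>
  The range as a subset of \<open>(0,\<infinity>)\<close>: the intersection only matters on the event that the path takes
  the value 0, as it does for \<open>T = 0\<close>, the case of key function 0.
\<close>

definition path_range :: "(real \<Rightarrow> real) \<Rightarrow> real set" where
  "path_range f = {f s | s. 0 < s} \<inter> {0<..}"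

definition no_drift :: "'w measure \<Rightarrow> (real \<Rightarrow> 'w \<Rightarrow> real) \<Rightarrow> bool" where
  "no_drift M T \<longleftrightarrow>
     (AE \<omega> in M. \<forall>s>0.
        ((\<lambda>u. T u \<omega> - left_lim (\<lambda>v. T v \<omega>) u) has_sum T s \<omega>)
          {u \<in> jump_times (\<lambda>v. T v \<omega>). u \<le> s})"

definition key_function :: "'w measure \<Rightarrow> (real \<Rightarrow> 'w \<Rightarrow> real) \<Rightarrow> (real \<Rightarrow> real) \<Rightarrow> bool" where
  "key_function M T k \<longleftrightarrow>
     (\<forall>x>0. 0 \<le> k x) \<and>
     antimono_on {0<..} k \<and>
     (\<forall>x>0. (k \<longlongrightarrow> k x) (at_right x)) \<and>
     set_integrable lborel {0<..} (\<lambda>x. min x 1 * (k x / x)) \<and>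
     (\<forall>u\<ge>0. ln (\<integral>\<omega>. exp (- u * T 1 \<omega>) \<partial>M) =
              (LBINT x:{0<..}. (exp (- u * x) - 1) * (k x / x)))"


section \<open>Point processes on the positive half-line\<close>

definition npoints :: "real set \<Rightarrow> real set \<Rightarrow> ennreal" where
  "npoints A B = emeasure (count_space UNIV) (A \<inter> B)"

text \<open>The \<open>\<sigma>\<close>-algebra generated by the counting variables of Borel subsets of \<open>(0,\<infinity>)\<close>.\<close>

definition point_configs :: "real set measure" where
  "point_configs = sigma UNIV
     {{A. npoints A B \<in> C} | B C. B \<in> sets borel \<and> B \<subseteq> {0<..} \<and> C \<in> sets borel}"

text \<open>
  A simple point process is a random set that is almost surely a locally finite subset of \<open>(0,\<infinity>)\<close>.
  Measurability is with respect to the completion of the underlying probability space, since sets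
  such as the range of a process that has regular paths only almost surely are random sets only up
  to null events.
\<close>

definition simple_point_process :: "'w measure \<Rightarrow> ('w \<Rightarrow> real set) \<Rightarrow> bool" where
  "simple_point_process M X \<longleftrightarrow>
     X \<in> completion M \<rightarrow>\<^sub>M point_configs \<and>
     (AE \<omega> in M. X \<omega> \<subseteq> {0<..} \<and> (\<forall>a b. 0 < a \<longrightarrow> finite (X \<omega> \<inter> {a..b})))"

definition scale_invariant :: "'w measure \<Rightarrow> ('w \<Rightarrow> real set) \<Rightarrow> bool" where
  "scale_invariant M X \<longleftrightarrow>
     (\<forall>c>0. distr (completion M) point_configs (\<lambda>\<omega>. (*) c ` X \<omega>) =
            distr (completion M) point_configs X)"

definition has_intensity :: "'w measure \<Rightarrow> ('w \<Rightarrow> real set) \<Rightarrow> real measure \<Rightarrow> bool" where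
  "has_intensity M X \<mu> \<longleftrightarrow>
     (\<forall>B \<in> sets borel. B \<subseteq> {0<..} \<longrightarrow>
        (\<integral>\<^sup>+\<omega>. npoints (X \<omega>) B \<partial>completion M) = emeasure \<mu> B)"

definition scale_intensity :: "real \<Rightarrow> real measure" where
  "scale_intensity \<theta> = density lborel (\<lambda>x. ennreal (\<theta> / x) * indicator {0<..} x)"

definition scale_invariant_point_process :: "'w measure \<Rightarrow> ('w \<Rightarrow> real set) \<Rightarrow> real \<Rightarrow> bool" where
  "scale_invariant_point_process M X \<theta> \<longleftrightarrow>
     simple_point_process M X \<and> scale_invariant M X \<and> has_intensity M X (scale_intensity \<theta>)"

text \<open>
  The Poisson probabilities are written out because the library's \<open>poisson_pmf\<close> excludes mean 0,
  which null sets \<open>B\<close> produce.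
\<close>

definition poisson_point_process :: "'w measure \<Rightarrow> ('w \<Rightarrow> real set) \<Rightarrow> real measure \<Rightarrow> bool" where
  "poisson_point_process M X \<mu> \<longleftrightarrow>
     simple_point_process M X \<and>
     (\<forall>B \<in> sets borel. B \<subseteq> {0<..} \<and> emeasure \<mu> B < \<infinity> \<longrightarrow>
        (\<forall>n::nat. measure (completion M) {\<omega> \<in> space M. npoints (X \<omega>) B = of_nat n} =
           measure \<mu> B ^ n / fact n * exp (- measure \<mu> B))) \<and>
     (\<forall>B \<in> sets borel. B \<subseteq> {0<..} \<and> emeasure \<mu> B = \<infinity> \<longrightarrow>
        (AE \<omega> in M. npoints (X \<omega>) B = \<infinity>)) \<and>
     (\<forall>(n::nat) B. (\<forall>i<n. B i \<in> sets borel \<and> B i \<subseteq> {0<..}) \<and> disjoint_family_on B {..<n} \<longrightarrow>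
        prob_space.indep_vars (completion M) (\<lambda>_. borel) (\<lambda>i \<omega>. npoints (X \<omega>) (B i)) {..<n})"

definition scale_invariant_poisson_process :: "'w measure \<Rightarrow> ('w \<Rightarrow> real set) \<Rightarrow> real \<Rightarrow> bool" where
  "scale_invariant_poisson_process M X \<theta> \<longleftrightarrow> poisson_point_process M X (scale_intensity \<theta>)"

end

theory Submission
  imports Defs
begin

text \<open>
  No drift means that \<open>T a = T b\<close> exactly when there is no jump time in \<open>(a, b]\<close>. Letting the
  argument of the Laplace transform of \<open>T b - T a\<close> tend to infinity gives this event the
  probability \<open>(a / b)\<close> to the power \<open>\<theta>\<close>, by a Frullani integral of the key function. Hence the jump
  times are almost surely locally finite, and the increments over a fine grid of a window \<open>(a, b]\<close>
  are eventually exactly the jumps in that window. The Laplace transforms of the increments therefore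
  identify the intensity of the jump sizes in the window as \<open>(k (x / b) - k (x / a)) / x dx\<close>, which
  tends to \<open>\<theta> / x dx\<close> as the window exhausts the half-line.

  In both cases the probability of having no point in a Borel set is the exponential of minus the
  intensity, and by Renyi's theorem these void probabilities make a random set a Poisson process.

  Each jump time in \<open>(a, b]\<close> corresponds to one range point in \<open>(T a, T b]\<close>. The number of range
  points between \<open>s\<close> and \<open>T s\<close>, counted with sign, has a law that does not depend on \<open>s\<close>, so the
  mean number of range points in \<open>(a, b]\<close> equals the mean number of jump times in \<open>(a, b]\<close>.
\<close>

section \<open>Sums and products over null arrays\<close>

text \<open>Finiteness of \<open>\<theta>\<close> makes the mean number of jumps in a time window
  finite, and the chance of a jump in one of \<open>m\<close> grid cells is of order
  \<open>1 / m\<close> uniformly. Limits over grids are therefore of Poisson type: sums of squares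
  vanish, and the same row sums give means and exponents of void probabilities. The two Poisson
  claims reach Borel sets by different routes. Independent increments see jump times only through
  cells of time, so these void probabilities pass from cells to open sets and, by regularity, to
  Borel sets. For sizes, a Borel set is tested on the increments themselves, because the mean
  measure of the sizes is identified beforehand. For the range no void probabilities are available.
  Scale invariance is read off the path at rational times, and the counts compared in the
  computation of the mean may fail to be integrable. The case \<open>\<theta> = 0\<close> stands
  apart, since the path is then 0, neither positive nor unbounded. These sets depend on uncountably
  many times; their measurability in the completion comes from almost sure agreement with functions
  of countably many times.\<close>

lemma one_minus_exp_bounds:
  fixes x :: real
  assumes "0 \<le> x"
  shows "1 - exp (- x) \<le> x" "x - x\<^sup>2 \<le> 1 - exp (- x)"
proof -
  show "1 - exp (- x) \<le> x"
    using exp_ge_add_one_self[of "- x"] by simp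
  show "x - x\<^sup>2 \<le> 1 - exp (- x)"
  proof (cases "x \<le> 1")
    case True
    have "exp (- x) = inverse (exp x)" by (simp add: exp_minus)
    also have "\<dots> \<le> inverse (1 + x)"
      using exp_ge_add_one_self[of x] assms by (intro le_imp_inverse_le) auto
    also have "\<dots> \<le> 1 - x + x\<^sup>2"
    proof -
      have "1 \<le> (1 - x + x\<^sup>2) * (1 + x)"
        using assms by (simp add: algebra_simps power2_eq_square)
      then show ?thesis
        using assms by (simp add: inverse_eq_divide divide_le_eq)
    qed
    finally show ?thesis by simp
  next
    case False
    then have "x \<le> x\<^sup>2" by (simp add: power2_eq_square)
    moreover have "0 \<le> 1 - exp (- x)" using assms by simp
    ultimately show ?thesis by linarith
  qed
qed

text \<open>Each square is at most \<open>\<delta> m\<close> times its term, and the row sums stay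
  bounded because they converge. This disposes of all second-order errors below.\<close>

lemma sum_squares_null_array:
  fixes \<phi> :: "nat \<Rightarrow> 'i \<Rightarrow> real"
  assumes "\<And>m i. i \<in> I m \<Longrightarrow> 0 \<le> \<phi> m i" "\<And>m i. i \<in> I m \<Longrightarrow> \<phi> m i \<le> \<delta> m"
    and "\<delta> \<longlonglongrightarrow> 0" "(\<lambda>m. \<Sum>i\<in>I m. \<phi> m i) \<longlonglongrightarrow> L"
  shows "(\<lambda>m. \<Sum>i\<in>I m. (\<phi> m i)\<^sup>2) \<longlonglongrightarrow> 0"
proof (rule tendsto_sandwich)
  show "(\<lambda>m. 0::real) \<longlonglongrightarrow> 0" by simp
  show "(\<lambda>m. \<delta> m * (\<Sum>i\<in>I m. \<phi> m i)) \<longlonglongrightarrow> 0"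
    using tendsto_mult[OF assms(3,4)] by simp
  show "\<forall>\<^sub>F m in sequentially. (\<Sum>i\<in>I m. (\<phi> m i)\<^sup>2) \<le> \<delta> m * (\<Sum>i\<in>I m. \<phi> m i)"
    unfolding sum_distrib_left power2_eq_square
    by (intro always_eventually allI sum_mono mult_right_mono assms)
  show "\<forall>\<^sub>F m in sequentially. 0 \<le> (\<Sum>i\<in>I m. (\<phi> m i)\<^sup>2)"
    by (simp add: sum_nonneg)
qed

text \<open>With \<open>\<phi> m i\<close> the intensity of a cell, the row sum is the mean number
  of occupied cells. First- and second-order bounds of \<open>1 - exp (- x)\<close> squeeze
  it.\<close>

lemma sum_one_minus_exp_tendsto:
  fixes \<phi> :: "nat \<Rightarrow> 'i \<Rightarrow> real"
  assumes "\<And>m i. i \<in> I m \<Longrightarrow> 0 \<le> \<phi> m i" "\<And>m i. i \<in> I m \<Longrightarrow> \<phi> m i \<le> \<delta> m"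
    and "\<delta> \<longlonglongrightarrow> 0" "(\<lambda>m. \<Sum>i\<in>I m. \<phi> m i) \<longlonglongrightarrow> L"
  shows "(\<lambda>m. \<Sum>i\<in>I m. 1 - exp (- \<phi> m i)) \<longlonglongrightarrow> L"
proof (rule tendsto_sandwich)
  show "(\<lambda>m. (\<Sum>i\<in>I m. \<phi> m i) - (\<Sum>i\<in>I m. (\<phi> m i)\<^sup>2)) \<longlonglongrightarrow> L"
    using tendsto_diff[OF assms(4) sum_squares_null_array[OF assms]] by simp
  show "\<forall>\<^sub>F m in sequentially.
      (\<Sum>i\<in>I m. \<phi> m i) - (\<Sum>i\<in>I m. (\<phi> m i)\<^sup>2) \<le> (\<Sum>i\<in>I m. 1 - exp (- \<phi> m i))"
    unfolding sum_subtractf[symmetric]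
    by (intro always_eventually allI sum_mono one_minus_exp_bounds assms)
  show "\<forall>\<^sub>F m in sequentially. (\<Sum>i\<in>I m. 1 - exp (- \<phi> m i)) \<le> (\<Sum>i\<in>I m. \<phi> m i)"
    by (intro always_eventually allI sum_mono one_minus_exp_bounds assms)
qed fact

lemma prod_one_minus_tendsto_exp:
  fixes \<phi> :: "nat \<Rightarrow> 'i \<Rightarrow> real"
  assumes "\<And>m i. i \<in> I m \<Longrightarrow> 0 \<le> \<phi> m i" "\<And>m i. i \<in> I m \<Longrightarrow> \<phi> m i \<le> \<delta> m"
    and "\<delta> \<longlonglongrightarrow> 0" "(\<lambda>m. \<Sum>i\<in>I m. \<phi> m i) \<longlonglongrightarrow> L" and fin: "\<And>m. finite (I m)"
  shows "(\<lambda>m. \<Prod>i\<in>I m. 1 - \<phi> m i) \<longlonglongrightarrow> exp (- L)"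
proof (rule tendsto_sandwich)
  \<comment> \<open>Up to 1/2 one has \<open>ln (1 - x) \<ge> - x - 2 * x\<^sup>2\<close>, which is
    also the source of the factor 2 in the lower bound.\<close>
  have small: "\<forall>\<^sub>F m in sequentially. \<delta> m < 1 / 2"
    using order_tendstoD(2)[OF assms(3), of "1 / 2"] by simp
  show "(\<lambda>m. exp (- (\<Sum>i\<in>I m. \<phi> m i) - 2 * (\<Sum>i\<in>I m. (\<phi> m i)\<^sup>2))) \<longlonglongrightarrow> exp (- L)"
    using tendsto_exp[OF tendsto_diff[OF tendsto_minus[OF assms(4)]
          tendsto_mult_left[OF sum_squares_null_array[OF assms(1-4)], of 2]]]
    by simp
  show "(\<lambda>m. exp (- (\<Sum>i\<in>I m. \<phi> m i))) \<longlonglongrightarrow> exp (- L)"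
    by (intro tendsto_exp tendsto_minus assms)
  show "\<forall>\<^sub>F m in sequentially. (\<Prod>i\<in>I m. 1 - \<phi> m i) \<le> exp (- (\<Sum>i\<in>I m. \<phi> m i))"
    using small
  proof eventually_elim
    case (elim m)
    have "(\<Prod>i\<in>I m. 1 - \<phi> m i) \<le> (\<Prod>i\<in>I m. exp (- \<phi> m i))"
    proof (rule prod_mono)
      fix i assume i: "i \<in> I m"
      show "0 \<le> 1 - \<phi> m i \<and> 1 - \<phi> m i \<le> exp (- \<phi> m i)"
        using assms(1,2)[OF i] elim exp_ge_add_one_self[of "- \<phi> m i"] by auto
    qed
    then show ?case by (simp only: exp_sum[OF fin] sum_negf[symmetric])
  qed
  show "\<forall>\<^sub>F m in sequentially.
      exp (- (\<Sum>i\<in>I m. \<phi> m i) - 2 * (\<Sum>i\<in>I m. (\<phi> m i)\<^sup>2)) \<le> (\<Prod>i\<in>I m. 1 - \<phi> m i)"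
    using small
  proof eventually_elim
    case (elim m)
    have "(\<Prod>i\<in>I m. exp (- \<phi> m i - 2 * (\<phi> m i)\<^sup>2)) \<le> (\<Prod>i\<in>I m. 1 - \<phi> m i)"
    proof (rule prod_mono, safe)
      fix i assume i: "i \<in> I m"
      have "- \<phi> m i - 2 * (\<phi> m i)\<^sup>2 \<le> ln (1 - \<phi> m i)"
        using assms(1,2)[OF i] elim by (intro ln_one_minus_pos_lower_bound) auto
      then have "exp (- \<phi> m i - 2 * (\<phi> m i)\<^sup>2) \<le> exp (ln (1 - \<phi> m i))" by simp
      also have "\<dots> = 1 - \<phi> m i" using assms(2)[OF i] elim by (intro exp_ln) auto
      finally show "exp (- \<phi> m i - 2 * (\<phi> m i)\<^sup>2) \<le> 1 - \<phi> m i" .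
    qed simp
    moreover have "(\<Prod>i\<in>I m. exp (- \<phi> m i - 2 * (\<phi> m i)\<^sup>2)) =
        exp (- (\<Sum>i\<in>I m. \<phi> m i) - 2 * (\<Sum>i\<in>I m. (\<phi> m i)\<^sup>2))"
      by (simp only: exp_sum[OF fin, symmetric] sum_subtractf sum_negf sum_distrib_left)
    ultimately show ?case by simp
  qed
qed

section \<open>Grids on an interval\<close>

definition grid :: "real \<Rightarrow> real \<Rightarrow> nat \<Rightarrow> nat \<Rightarrow> real" where
  "grid a b m i = a + (b - a) * real i / real m"

text \<open>Left-open and right-closed, because the increment of a right-continuous path from
  \<open>s\<close> to \<open>t\<close> collects the jumps in \<open>{s<..t}\<close>. For
  \<open>m = 0\<close> division by zero puts all grid points at \<open>a\<close> and the cells are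
  empty.\<close>

definition cell :: "real \<Rightarrow> real \<Rightarrow> nat \<Rightarrow> nat \<Rightarrow> real set" where
  "cell a b m i = {grid a b m i <.. grid a b m (Suc i)}"

lemma grid_less: "a < b \<Longrightarrow> 0 < m \<Longrightarrow> i < j \<Longrightarrow> grid a b m i < grid a b m j"
  by (simp add: grid_def divide_strict_right_mono)

lemma grid_le: "a < b \<Longrightarrow> i \<le> j \<Longrightarrow> grid a b m i \<le> grid a b m j"
  by (simp add: grid_def divide_right_mono)

lemma grid_0: "grid a b m 0 = a"
  by (simp add: grid_def)

lemma grid_end: "0 < m \<Longrightarrow> grid a b m m = b"
  by (simp add: grid_def)

lemma grid_Suc_diff: "grid a b m (Suc i) - grid a b m i = (b - a) / real m"
  by (simp add: grid_def ring_distribs add_divide_distrib diff_divide_distrib)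

lemma cell_subset: "a < b \<Longrightarrow> i < m \<Longrightarrow> cell a b m i \<subseteq> {a<..b}"
  using grid_le[of a b 0 i m] grid_le[of a b "Suc i" m m]
  by (auto simp: cell_def grid_0 grid_end)

lemma cell_measurable [measurable, simp]: "cell a b m i \<in> sets borel"
  by (simp add: cell_def)

lemma disjoint_cell: "a < b \<Longrightarrow> i \<noteq> j \<Longrightarrow> cell a b m i \<inter> cell a b m j = {}"
proof (induction i j rule: linorder_wlog)
  case (le i j)
  then show ?case using grid_le[of a b "Suc i" j m] by (auto simp: cell_def)
qed auto

lemma UN_cell: "a < b \<Longrightarrow> 0 < m \<Longrightarrow> (\<Union>i<m. cell a b m i) = {a<..b}"
proof -
  assume ab: "a < b" and m: "0 < m"
  have "(\<Union>i<n. cell a b m i) = {a<..grid a b m n}" for n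
  proof (induction n)
    case (Suc n)
    then show ?case using grid_le[OF ab, of 0 n m] grid_le[OF ab, of n "Suc n" m]
      by (auto simp: lessThan_Suc cell_def grid_0)
  qed (simp add: grid_0)
  from this[of m] show ?thesis using m by (simp add: grid_end)
qed

lemma cell_eventually_small:
  assumes "0 < \<epsilon>"
  shows "\<forall>\<^sub>F m in sequentially. \<forall>i. \<forall>x\<in>cell a b m i. \<forall>y\<in>cell a b m i. \<bar>x - y\<bar> < \<epsilon>"
proof -
  have "(\<lambda>m. (b - a) / real m) \<longlonglongrightarrow> 0"
    by (rule lim_const_over_n)
  from order_tendstoD(2)[OF this assms] show ?thesis
  proof eventually_elim
    case (elim m)
    then show ?case using grid_Suc_diff[of a b m]
      by (auto simp: cell_def abs_less_iff) (smt (verit))+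
  qed
qed

lemma cell_eventually_separates:
  assumes "finite F"
  shows "\<forall>\<^sub>F m in sequentially. \<forall>i. \<forall>x\<in>F \<inter> cell a b m i. \<forall>y\<in>F \<inter> cell a b m i. x = y"
proof -
  \<comment> \<open>The element 1 keeps \<open>Min D\<close> meaningful when \<open>F\<close> has
    fewer than two points.\<close>
  define D where "D = insert 1 ((\<lambda>(x, y). \<bar>x - y\<bar>) ` {p \<in> F \<times> F. fst p \<noteq> snd p})"
  have D: "finite D" "D \<noteq> {}" using assms by (auto simp: D_def)
  have "0 < Min D" using D by (auto simp: Min_gr_iff D_def)
  from cell_eventually_small[OF this, of a b] show ?thesis
  proof eventually_elim
    case (elim m)
    show ?case
    proof (intro allI ballI, rule ccontr)
      fix i x y assume xy: "x \<in> F \<inter> cell a b m i" "y \<in> F \<inter> cell a b m i" "x \<noteq> y"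
      then have "\<bar>x - y\<bar> \<in> D" by (force simp: D_def)
      then have "Min D \<le> \<bar>x - y\<bar>" using D by simp
      with elim xy show False by fastforce
    qed
  qed
qed

text \<open>A substitute for the cardinality that depends only on which cells are void, so that it
  is accessible to void events.\<close>

definition ncells :: "real \<Rightarrow> real \<Rightarrow> nat \<Rightarrow> real set \<Rightarrow> nat" where
  "ncells a b m A = card {i. i < m \<and> A \<inter> cell a b m i \<noteq> {}}"

lemma ncells_eq_sum: "ncells a b m A = (\<Sum>i<m. if A \<inter> cell a b m i = {} then 0 else 1)"
proof -
  have "ncells a b m A = card {i \<in> {..<m}. A \<inter> cell a b m i \<noteq> {}}"
    by (simp add: ncells_def)
  also have "\<dots> = (\<Sum>i<m. if A \<inter> cell a b m i \<noteq> {} then 1 else 0)"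
    unfolding card_eq_sum by (rule sum.inter_filter) simp
  also have "\<dots> = (\<Sum>i<m. if A \<inter> cell a b m i = {} then 0 else 1)"
    by (intro sum.cong) auto
  finally show ?thesis .
qed

lemma ncells_mono: "A \<subseteq> B \<Longrightarrow> ncells a b m A \<le> ncells a b m B"
  unfolding ncells_def by (intro card_mono) auto

lemma ncells_le_card:
  assumes "a < b" "finite A"
  shows "ncells a b m A \<le> card A"
proof -
  define f where "f i = (SOME x. x \<in> A \<inter> cell a b m i)" for i
  have f: "f i \<in> A \<inter> cell a b m i" if "A \<inter> cell a b m i \<noteq> {}" for i
    using that unfolding f_def by (meson ex_in_conv someI_ex)
  show ?thesis unfolding ncells_def
  proof (rule card_inj_on_le[of f])
    show "inj_on f {i. i < m \<and> A \<inter> cell a b m i \<noteq> {}}"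
    proof (rule inj_onI)
      fix i j assume "i \<in> {i. i < m \<and> A \<inter> cell a b m i \<noteq> {}}"
        "j \<in> {i. i < m \<and> A \<inter> cell a b m i \<noteq> {}}" "f i = f j"
      then have "f i \<in> cell a b m i \<inter> cell a b m j" using f[of i] f[of j] by auto
      then show "i = j" using disjoint_cell[OF assms(1), of i j m] by auto
    qed
  qed (use f assms in auto)
qed

lemma ncells_eventually_eq_card:
  assumes "a < b" "finite F" "F \<subseteq> {a<..b}"
  shows "\<forall>\<^sub>F m in sequentially. ncells a b m F = card F"
  using cell_eventually_separates[OF assms(2), of a b] eventually_gt_at_top[of 0]
proof eventually_elim
  case (elim m)
  have "\<forall>x\<in>F. \<exists>i<m. x \<in> cell a b m i"
    using UN_cell[OF assms(1) \<open>0 < m\<close>] assms(3) by auto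
  then obtain g where g: "\<And>x. x \<in> F \<Longrightarrow> g x < m \<and> x \<in> cell a b m (g x)" by metis
  have "card F \<le> ncells a b m F"
    unfolding ncells_def
  proof (rule card_inj_on_le[of g])
    show "inj_on g F"
      using g elim(1) by (intro inj_onI) (metis IntI)
  qed (use g in auto)
  with ncells_le_card[OF assms(1,2), of m] show ?case by simp
qed

lemma ncells_tendsto:
  assumes "a < b" "A \<subseteq> {a<..b}"
  shows "(\<lambda>m. of_nat (ncells a b m A) :: ennreal) \<longlonglongrightarrow> emeasure (count_space UNIV) A"
proof (cases "finite A")
  case True
  from ncells_eventually_eq_card[OF assms(1) True assms(2)]
  have "\<forall>\<^sub>F m in sequentially. (of_nat (ncells a b m A) :: ennreal) = emeasure (count_space UNIV) A"
    by eventually_elim (simp add: True)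
  then show ?thesis by (rule tendsto_eventually)
next
  case False
  show ?thesis
  proof (simp add: False tendsto_top_iff_ennreal, intro allI impI)
    fix l :: real assume "0 \<le> l"
    obtain n :: nat where n: "l < real n" using reals_Archimedean2 by blast
    \<comment> \<open>An infinite set has finite subsets of every size, and fine grids separate the
      points of each of them.\<close>
    obtain F where F: "F \<subseteq> A" "finite F" "card F = n"
      using infinite_arbitrarily_large[OF False] by metis
    have "\<forall>\<^sub>F m in sequentially. ncells a b m F = card F"
      by (rule ncells_eventually_eq_card) (use F assms in auto)
    then show "\<forall>\<^sub>F m in sequentially. ennreal l < of_nat (ncells a b m A)"
    proof eventually_elim
      case (elim m)
      have "l < real (ncells a b m A)" using ncells_mono[OF F(1), of a b m] elim F n by linarith
      then show ?case using \<open>0 \<le> l\<close> by (metis ennreal_lessI ennreal_of_nat_eq_real_of_nat of_nat_0_le_iff order_le_less_trans)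
    qed
  qed
qed

lemma ncells_le_count:
  assumes "a < b"
  shows "(of_nat (ncells a b m A) :: ennreal) \<le> emeasure (count_space UNIV) A"
proof (cases "finite A")
  case True
  then show ?thesis using ncells_le_card[OF assms True, of m] by simp
qed simp

section \<open>Uniqueness of Laplace transforms\<close>

text \<open>The transform at natural numbers gives the moments of \<open>exp (- x)\<close>, a
  variable with values in the unit interval. By Weierstrass approximation the moments fix the
  integrals of all continuous functions of it, and these fix its distribution function.\<close>

lemma laplace_transform_unique:
  fixes \<mu> \<nu> :: "real measure"
  assumes fin: "finite_measure \<mu>" "finite_measure \<nu>"
    and S: "sets \<mu> = sets borel" "sets \<nu> = sets borel"
    and nn: "AE x in \<mu>. 0 \<le> x" "AE x in \<nu>. 0 \<le> x"
    and eq: "\<And>n::nat. (\<integral>x. exp (- real n * x) \<partial>\<mu>) = (\<integral>x. exp (- real n * x) \<partial>\<nu>)"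
  shows "\<mu> = \<nu>"
proof -
  interpret mu: finite_measure \<mu> by fact
  interpret nu: finite_measure \<nu> by fact
  note S[measurable_cong]
  have space: "space \<mu> = UNIV" "space \<nu> = UNIV"
    using S[THEN sets_eq_imp_space_eq] by auto
  \<comment> \<open>The measures sit on the nonnegative reals only almost everywhere; the maximum
    bounds \<open>E\<close> by 1 at every point.\<close>
  define E where "E x = exp (- max 0 x)" for x :: real
  have E01: "E x \<in> {0..1}" for x by (auto simp: E_def)
  have Em: "E \<in> borel_measurable borel" unfolding E_def by measurable
  note Em[measurable]
  have E_pow: "(\<integral>x. E x ^ n \<partial>\<mu>) = (\<integral>x. E x ^ n \<partial>\<nu>)" for n :: nat
  proof -
    have "(\<integral>x. E x ^ n \<partial>\<mu>) = (\<integral>x. exp (- real n * x) \<partial>\<mu>)"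
      using nn(1) by (intro integral_cong_AE) (auto simp: E_def max_def exp_of_nat_mult[symmetric])
    also have "\<dots> = (\<integral>x. exp (- real n * x) \<partial>\<nu>)" by (rule eq)
    also have "\<dots> = (\<integral>x. E x ^ n \<partial>\<nu>)"
      using nn(2) by (intro integral_cong_AE) (auto simp: E_def max_def exp_of_nat_mult[symmetric])
    finally show ?thesis .
  qed
  have int_pow: "integrable \<mu> (\<lambda>x. E x ^ n)" "integrable \<nu> (\<lambda>x. E x ^ n)" for n :: nat
    using E01 by (auto intro!: mu.integrable_const_bound[where B = 1] nu.integrable_const_bound[where B = 1]
        simp: power_le_one)
  have cont: "(\<integral>x. g (E x) \<partial>\<mu>) = (\<integral>x. g (E x) \<partial>\<nu>)"
    if g: "continuous_on UNIV g" for g :: "real \<Rightarrow> real"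
  proof -
    have gm[measurable]: "g \<in> borel_measurable borel"
      using g by (rule borel_measurable_continuous_onI)
    have "compact (g ` {0..1})"
      by (intro compact_continuous_image continuous_on_subset[OF g]) auto
    then obtain C where C: "\<And>t. t \<in> {0..1} \<Longrightarrow> \<bar>g t\<bar> \<le> C"
      by (force dest!: compact_imp_bounded simp: bounded_iff)
    have int_g: "integrable \<mu> (\<lambda>x. g (E x))" "integrable \<nu> (\<lambda>x. g (E x))"
      using C E01 by (auto intro!: mu.integrable_const_bound[where B = C] nu.integrable_const_bound[where B = C])
    define K where "K = measure \<mu> UNIV + measure \<nu> UNIV"
    have "\<bar>(\<integral>x. g (E x) \<partial>\<mu>) - (\<integral>x. g (E x) \<partial>\<nu>)\<bar> \<le> e * K" if "0 < e" for e
    proof -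
      obtain p where p: "real_polynomial_function p" "\<And>t. t \<in> {0..1} \<Longrightarrow> \<bar>g t - p t\<bar> < e"
        by (rule Stone_Weierstrass_real_polynomial_function[OF _ continuous_on_subset[OF g] \<open>0 < e\<close>, of "{0..1}"]) auto
      obtain c n where pc: "p = (\<lambda>t. \<Sum>i\<le>n. c i * t ^ i)"
        using p(1) by (auto simp: real_polynomial_function_iff_sum)
      have int_p: "integrable \<mu> (\<lambda>x. p (E x))" "integrable \<nu> (\<lambda>x. p (E x))"
        unfolding pc using int_pow by auto
      have pe: "(\<integral>x. p (E x) \<partial>\<mu>) = (\<integral>x. p (E x) \<partial>\<nu>)"
        unfolding pc using int_pow by (simp add: E_pow)
      have bound: "\<bar>(\<integral>x. g (E x) \<partial>\<rho>) - (\<integral>x. p (E x) \<partial>\<rho>)\<bar> \<le> e * measure \<rho> UNIV"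
        if "finite_measure \<rho>" "integrable \<rho> (\<lambda>x. g (E x))" "integrable \<rho> (\<lambda>x. p (E x))" "space \<rho> = UNIV" for \<rho>
      proof -
        interpret finite_measure \<rho> by fact
        have "\<bar>(\<integral>x. g (E x) \<partial>\<rho>) - (\<integral>x. p (E x) \<partial>\<rho>)\<bar> = \<bar>\<integral>x. g (E x) - p (E x) \<partial>\<rho>\<bar>"
          using that by simp
        also have "\<dots> \<le> (\<integral>x. \<bar>g (E x) - p (E x)\<bar> \<partial>\<rho>)" by (rule integral_abs_bound)
        also have "\<dots> \<le> (\<integral>x. e \<partial>\<rho>)"
          using that p(2) E01 by (intro integral_mono) (auto intro: less_imp_le)
        finally show ?thesis using that(4) by (simp add: mult.commute)
      qed
      show ?thesis
        using bound[OF fin(1) int_g(1) int_p(1) space(1)] bound[OF fin(2) int_g(2) int_p(2) space(2)] pe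
        by (simp add: K_def ring_distribs)
    qed
    note * = this
    have "0 \<le> K" by (simp add: K_def)
    have "\<bar>(\<integral>x. g (E x) \<partial>\<mu>) - (\<integral>x. g (E x) \<partial>\<nu>)\<bar> \<le> 0"
    proof (rule field_le_epsilon)
      fix e :: real assume "0 < e"
      then have "e / (K + 1) * K \<le> e"
        using \<open>0 \<le> K\<close> by (simp add: field_simps)
      with *[of "e / (K + 1)"] \<open>0 < e\<close> \<open>0 \<le> K\<close>
      show "\<bar>(\<integral>x. g (E x) \<partial>\<mu>) - (\<integral>x. g (E x) \<partial>\<nu>)\<bar> \<le> 0 + e" by simp
    qed
    then show ?thesis by simp
  qed
  have meas_E: "measure \<mu> {x. E x < y} = measure \<nu> {x. E x < y}" for y
  proof -
    \<comment> \<open>Continuous ramps of slope \<open>j\<close> that increase to the indicator of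
      \<open>{t. t < y}\<close>.\<close>
    define g where "g j t = min 1 (max 0 (real j * (y - t)))" for j :: nat and t
    have lim: "(\<lambda>j. g j t) \<longlonglongrightarrow> indicator {t. t < y} t" for t
    proof (cases "t < y")
      case True
      obtain N :: nat where N: "1 / (y - t) < real N" using reals_Archimedean2 by blast
      have "g j t = 1" if "N \<le> j" for j
      proof -
        have "1 / (y - t) \<le> real j" using N that by linarith
        then have "1 \<le> real j * (y - t)" using True by (simp add: field_simps)
        then show ?thesis by (simp add: g_def)
      qed
      then have "\<forall>\<^sub>F j in sequentially. g j t = 1" by (auto simp: eventually_sequentially)
      then show ?thesis using True by (simp add: tendsto_eventually)
    next
      case False
      then have "real j * (y - t) \<le> 0" for j by (simp add: mult_nonneg_nonpos)
      then have "g j t = 0" for j unfolding g_def by (simp add: max_absorb1)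
      then show ?thesis using False by simp
    qed
    have g_cont: "continuous_on UNIV (g j)" for j
      unfolding g_def by (intro continuous_intros)
    have gm[measurable]: "g j \<in> borel_measurable borel" for j
      using g_cont by (rule borel_measurable_continuous_onI)
    have L: "(\<lambda>j. \<integral>x. g j (E x) \<partial>\<rho>) \<longlonglongrightarrow> measure \<rho> {x. E x < y}"
      if "finite_measure \<rho>" and S'[measurable_cong]: "sets \<rho> = sets borel" for \<rho>
    proof -
      interpret finite_measure \<rho> by fact
      have sp: "space \<rho> = UNIV" using S'[THEN sets_eq_imp_space_eq] by simp
      have "(\<lambda>j. \<integral>x. g j (E x) \<partial>\<rho>) \<longlonglongrightarrow> (\<integral>x. indicator {t. t < y} (E x) \<partial>\<rho>)"
      proof (rule integral_dominated_convergence[where w = "\<lambda>_. 1"])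
        show "AE x in \<rho>. norm (g j (E x)) \<le> 1" for j by (simp add: g_def)
      qed (auto simp: lim)
      also have "(\<integral>x. indicator {t. t < y} (E x) \<partial>\<rho>) = (\<integral>x. indicator {x. E x < y} x \<partial>\<rho>)"
        by (intro Bochner_Integration.integral_cong) (auto simp: indicator_def)
      also have "\<dots> = measure \<rho> {x. E x < y}"
        by (simp add: sp)
      finally show ?thesis .
    qed
    show ?thesis
      using L[OF fin(1) S(1)] L[OF fin(2) S(2)] cont[OF g_cont] by (auto intro: LIMSEQ_unique)
  qed
  have total: "measure \<mu> UNIV = measure \<nu> UNIV"
    using eq[of 0] by (simp add: space)
  show ?thesis
  proof (rule measure_eqI_lessThan)
    fix c :: real
    show "emeasure \<mu> {c<..} < \<infinity>"
      by (simp add: mu.emeasure_eq_measure)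
    have "measure \<mu> {c<..} = measure \<nu> {c<..}"
    proof (cases "0 \<le> c")
      case True
      then have "{c<..} = {x. E x < exp (- c)}" by (auto simp: E_def max_def)
      then show ?thesis using meas_E by simp
    next
      case False
      have "measure \<mu> {c<..} = measure \<mu> UNIV"
        using nn(1) False S by (intro measure_eq_AE) auto
      moreover have "measure \<nu> {c<..} = measure \<nu> UNIV"
        using nn(2) False S by (intro measure_eq_AE) auto
      ultimately show ?thesis using total by simp
    qed
    then show "emeasure \<mu> {c<..} = emeasure \<nu> {c<..}"
      by (simp add: mu.emeasure_eq_measure nu.emeasure_eq_measure)
  qed (use S in auto)
qed

section \<open>Mean measures\<close>

text \<open>The intensity measure of a random measure \<open>K\<close>. The values of
  \<open>K\<close> will be counting measures, so this is not a mixture of probability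
  measures.\<close>

definition mean_measure :: "'w measure \<Rightarrow> 'a measure \<Rightarrow> ('w \<Rightarrow> 'a measure) \<Rightarrow> 'a measure" where
  "mean_measure M N K = measure_of (space N) (sets N) (\<lambda>A. \<integral>\<^sup>+\<omega>. emeasure (K \<omega>) A \<partial>M)"

lemma sets_mean_measure [simp, measurable_cong]: "sets (mean_measure M N K) = sets N"
  by (simp add: mean_measure_def)

lemma space_mean_measure [simp]: "space (mean_measure M N K) = space N"
  by (simp add: mean_measure_def)

lemma emeasure_mean_measure:
  assumes K: "\<And>\<omega>. sets (K \<omega>) = sets N"
    and m: "\<And>A. A \<in> sets N \<Longrightarrow> (\<lambda>\<omega>. emeasure (K \<omega>) A) \<in> borel_measurable M"
    and A: "A \<in> sets N"
  shows "emeasure (mean_measure M N K) A = (\<integral>\<^sup>+\<omega>. emeasure (K \<omega>) A \<partial>M)"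
  unfolding mean_measure_def
proof (rule emeasure_measure_of_sigma)
  show "sigma_algebra (space N) (sets N)" by (rule sets.sigma_algebra_axioms)
  show "positive (sets N) (\<lambda>A. \<integral>\<^sup>+\<omega>. emeasure (K \<omega>) A \<partial>M)" by (simp add: positive_def)
  show "countably_additive (sets N) (\<lambda>A. \<integral>\<^sup>+\<omega>. emeasure (K \<omega>) A \<partial>M)"
  proof (rule countably_additiveI)
    fix F :: "nat \<Rightarrow> _" assume F: "range F \<subseteq> sets N" "disjoint_family F"
    have "(\<Sum>i. \<integral>\<^sup>+\<omega>. emeasure (K \<omega>) (F i) \<partial>M) = (\<integral>\<^sup>+\<omega>. (\<Sum>i. emeasure (K \<omega>) (F i)) \<partial>M)"
      using F m by (intro nn_integral_suminf[symmetric]) auto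
    also have "\<dots> = (\<integral>\<^sup>+\<omega>. emeasure (K \<omega>) (\<Union> (range F)) \<partial>M)"
      using F K by (intro nn_integral_cong suminf_emeasure) auto
    finally show "(\<Sum>i. \<integral>\<^sup>+\<omega>. emeasure (K \<omega>) (F i) \<partial>M) = (\<integral>\<^sup>+\<omega>. emeasure (K \<omega>) (\<Union> (range F)) \<partial>M)" .
  qed
qed fact

text \<open>Campbell's formula, by induction over the integrand. Measurability of the inner integral
  is part of the claim because the sum, multiple and limit cases need it as induction
  hypothesis.\<close>

lemma nn_integral_mean_measure:
  assumes K: "\<And>\<omega>. sets (K \<omega>) = sets N"
    and m: "\<And>A. A \<in> sets N \<Longrightarrow> (\<lambda>\<omega>. emeasure (K \<omega>) A) \<in> borel_measurable M"
    and f: "f \<in> borel_measurable N"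
  shows "(\<lambda>\<omega>. \<integral>\<^sup>+x. f x \<partial>K \<omega>) \<in> borel_measurable M \<and>
    (\<integral>\<^sup>+x. f x \<partial>mean_measure M N K) = (\<integral>\<^sup>+\<omega>. (\<integral>\<^sup>+x. f x \<partial>K \<omega>) \<partial>M)"
  using f
proof induction
  have sp: "space (K \<omega>) = space N" for \<omega> using K by (rule sets_eq_imp_space_eq)
  note K[measurable_cong]
  {
    case (cong f g)
    have "(\<integral>\<^sup>+x. f x \<partial>K \<omega>) = (\<integral>\<^sup>+x. g x \<partial>K \<omega>)" for \<omega>
      using cong(3) by (intro nn_integral_cong) (auto simp: sp)
    moreover have "(\<integral>\<^sup>+x. f x \<partial>mean_measure M N K) = (\<integral>\<^sup>+x. g x \<partial>mean_measure M N K)"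
      using cong(3) by (intro nn_integral_cong) auto
    ultimately show ?case using cong(4) by simp
  next
    case (set A)
    then show ?case using K m by (simp add: emeasure_mean_measure[OF K m])
  next
    case (mult u c)
    note [measurable] = mult(2) conjunct1[OF mult(4)]
    show ?case using mult(4) by (auto simp: nn_integral_cmult)
  next
    case (add u v)
    have [measurable]: "u \<in> borel_measurable N" "v \<in> borel_measurable N"
      "(\<lambda>\<omega>. \<integral>\<^sup>+x. u x \<partial>K \<omega>) \<in> borel_measurable M"
      "(\<lambda>\<omega>. \<integral>\<^sup>+x. v x \<partial>K \<omega>) \<in> borel_measurable M"
      using add by auto
    show ?case using add by (auto simp: nn_integral_add)
  next
    case (seq U)
    note [measurable] = seq(1)
    have inc: "incseq U" using seq by auto
    have mono: "incseq (\<lambda>i \<omega>. \<integral>\<^sup>+x. U i x \<partial>K \<omega>)"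
      using inc by (auto simp: incseq_def le_fun_def intro!: nn_integral_mono)
    have m': "(\<lambda>\<omega>. \<integral>\<^sup>+x. U i x \<partial>K \<omega>) \<in> borel_measurable M" for i using seq by auto
    have SUP: "(\<integral>\<^sup>+x. (SUP i. U i) x \<partial>K \<omega>) = (SUP i. \<integral>\<^sup>+x. U i x \<partial>K \<omega>)" for \<omega>
      unfolding SUP_apply using inc by (intro nn_integral_monotone_convergence_SUP) auto
    show ?case
    proof
      show "(\<lambda>\<omega>. \<integral>\<^sup>+x. (SUP i. U i) x \<partial>K \<omega>) \<in> borel_measurable M"
        unfolding SUP using m' by measurable
      have "(\<integral>\<^sup>+x. (SUP i. U i) x \<partial>mean_measure M N K) = (SUP i. \<integral>\<^sup>+x. U i x \<partial>mean_measure M N K)"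
        unfolding SUP_apply using inc by (intro nn_integral_monotone_convergence_SUP) auto
      also have "\<dots> = (SUP i. \<integral>\<^sup>+\<omega>. (\<integral>\<^sup>+x. U i x \<partial>K \<omega>) \<partial>M)" using seq by simp
      also have "\<dots> = (\<integral>\<^sup>+\<omega>. (SUP i. \<integral>\<^sup>+x. U i x \<partial>K \<omega>) \<partial>M)"
        using mono m' by (intro nn_integral_monotone_convergence_SUP[symmetric]) auto
      finally show "(\<integral>\<^sup>+x. (SUP i. U i) x \<partial>mean_measure M N K) = (\<integral>\<^sup>+\<omega>. (\<integral>\<^sup>+x. (SUP i. U i) x \<partial>K \<omega>) \<partial>M)"
        by (simp only: SUP)
    qed
  }
qed

section \<open>The scale invariant intensity\<close>

lemma sets_scale_intensity [simp, measurable_cong]: "sets (scale_intensity \<theta>) = sets borel"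
  by (simp add: scale_intensity_def)

lemma space_scale_intensity [simp]: "space (scale_intensity \<theta>) = UNIV"
  by (simp add: scale_intensity_def)

lemma emeasure_scale_intensity:
  "B \<in> sets borel \<Longrightarrow> emeasure (scale_intensity \<theta>) B = (\<integral>\<^sup>+x. ennreal (\<theta> / x) * indicator (B \<inter> {0<..}) x \<partial>lborel)"
  unfolding scale_intensity_def
  by (subst emeasure_density) (auto simp: indicator_inter_arith mult_ac intro!: nn_integral_cong)

lemma scale_intensity_Ioc:
  assumes "0 < a" "a \<le> b" "0 \<le> \<theta>"
  shows "emeasure (scale_intensity \<theta>) {a<..b} = ennreal (\<theta> * ln (b / a))"
proof -
  have "emeasure (scale_intensity \<theta>) {a<..b} = (\<integral>\<^sup>+x. ennreal (\<theta> / x) * indicator {a..b} x \<partial>lborel)"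
    unfolding emeasure_scale_intensity[of "{a<..b}" \<theta>, simplified]
    using AE_lborel_singleton[of a] assms
    by (intro nn_integral_cong_AE) (auto elim!: eventually_mono simp: indicator_def)
  also have "\<dots> = ennreal (\<theta> * ln b - \<theta> * ln a)"
    using assms
    by (intro nn_integral_FTC_Icc) (auto intro!: derivative_eq_intros simp: divide_nonneg_pos)
  finally show ?thesis using assms by (simp add: ln_div algebra_simps)
qed

lemma scale_intensity_bounded:
  assumes "B \<in> sets borel" "B \<subseteq> {c<..d}" "0 < c" "0 \<le> \<theta>"
  shows "emeasure (scale_intensity \<theta>) B < \<infinity>"
proof (cases "c \<le> d")
  case True
  have "emeasure (scale_intensity \<theta>) B \<le> emeasure (scale_intensity \<theta>) {c<..d}"
    using assms by (intro emeasure_mono) auto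
  also have "\<dots> < \<infinity>" using assms True by (simp add: scale_intensity_Ioc)
  finally show ?thesis .
next
  case False
  then have "B = {}" using assms(2) by auto
  then show ?thesis by simp
qed

text \<open>On \<open>{c<..}\<close> the density is at most \<open>\<theta> / c\<close>. This is the
  uniform \<open>1 / m\<close> bound on the intensity of grid cells that makes them a null
  array.\<close>

lemma scale_intensity_le_length:
  assumes "B \<in> sets borel" "B \<subseteq> {c<..}" "B \<subseteq> {x<..y}" "0 < c" "0 \<le> \<theta>" "x \<le> y"
  shows "emeasure (scale_intensity \<theta>) B \<le> ennreal (\<theta> / c * (y - x))"
proof -
  have "emeasure (scale_intensity \<theta>) B \<le> (\<integral>\<^sup>+z. ennreal (\<theta> / c) * indicator {x<..y} z \<partial>lborel)"
    unfolding emeasure_scale_intensity[OF assms(1)]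
  proof (rule nn_integral_mono)
    fix z
    show "ennreal (\<theta> / z) * indicator (B \<inter> {0<..}) z \<le> ennreal (\<theta> / c) * indicator {x<..y} z"
    proof (cases "z \<in> B")
      case True
      then have "\<theta> / z \<le> \<theta> / c" using assms by (intro divide_left_mono) auto
      then show ?thesis using True assms by (auto simp: indicator_def intro!: ennreal_leI)
    qed simp
  qed
  also have "\<dots> = ennreal (\<theta> / c * (y - x))"
    using assms ennreal_mult[of "\<theta> / c" "y - x"] by (simp add: nn_integral_cmult)
  finally show ?thesis .
qed

section \<open>Exhaustion of the half-line by bounded windows\<close>

definition window :: "nat \<Rightarrow> real set" where
  "window n = {1 / real (Suc n) <.. real (Suc n)}"

lemma window_measurable [measurable, simp]: "window n \<in> sets borel"
  by (simp add: window_def)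

lemma window_subset: "window n \<subseteq> {0<..}"
  by (auto simp: window_def intro: less_trans[of 0 "1 / (1 + real n)"])

lemma incseq_window: "incseq window"
proof (rule incseq_SucI)
  fix n
  have "1 / real (Suc (Suc n)) \<le> 1 / real (Suc n)" by (intro divide_left_mono) auto
  then show "window n \<le> window (Suc n)" by (auto simp: window_def simp del: of_nat_Suc)
qed

lemma incseq_Int_window: "incseq (\<lambda>n. B \<inter> window n)"
  using incseq_window by (auto simp: incseq_def)

lemma UN_window: "(\<Union>n. window n) = {0<..}"
proof -
  have "\<exists>n. x \<in> window n" if x: "0 < x" for x
  proof -
    obtain n :: nat where n: "max x (1 / x) < real n" using reals_Archimedean2 by blast
    then have "x \<le> real (Suc n)" "1 / x < real (Suc n)" by auto
    moreover from this(2) have "1 / real (Suc n) < x" using x by (simp add: field_simps)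
    ultimately show ?thesis unfolding window_def by auto
  qed
  then show ?thesis using window_subset by blast
qed

lemma UN_Int_window: "B \<subseteq> {0<..} \<Longrightarrow> (\<Union>n. B \<inter> window n) = B"
  using UN_window by blast

lemma scale_intensity_unique:
  assumes S: "sets \<nu> = sets borel" and "0 \<le> \<theta>"
    and eq: "\<And>a b. 0 < a \<Longrightarrow> a < b \<Longrightarrow> emeasure \<nu> {a<..b} = emeasure (scale_intensity \<theta>) {a<..b}"
    and B: "B \<in> sets borel" "B \<subseteq> {0<..}"
  shows "emeasure \<nu> B = emeasure (scale_intensity \<theta>) B"
proof -
  \<comment> \<open>The scale invariant intensity may be infinite, so uniqueness is applied to the
    restrictions to windows. A half-line \<open>{c<..}\<close> meets a window in an interval, to
    which the hypothesis applies.\<close>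
  define D where "D \<rho> n = density \<rho> (indicator (window n))" for \<rho> :: "real measure" and n
  note S[measurable_cong]
  have D: "emeasure (D \<rho> n) A = emeasure \<rho> (A \<inter> window n)"
    if "sets \<rho> = sets borel" "A \<in> sets borel" for \<rho> n A
    using that unfolding D_def
    by (subst emeasure_density) (auto simp: indicator_inter_arith[symmetric] mult.commute Int_commute)
  have "D \<nu> n = D (scale_intensity \<theta>) n" for n
  proof (rule measure_eqI_lessThan)
    have eqc: "emeasure \<nu> ({c<..} \<inter> window n) = emeasure (scale_intensity \<theta>) ({c<..} \<inter> window n)" for c
    proof -
      have Ioc: "{c<..} \<inter> window n = {max c (1 / real (Suc n)) <.. real (Suc n)}" by (auto simp: window_def)
      show ?thesis
      proof (cases "max c (1 / real (Suc n)) < real (Suc n)")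
        case True
        then show ?thesis unfolding Ioc by (intro eq) (auto simp: less_max_iff_disj)
      next
        case False
        then have empty: "{max c (1 / real (Suc n)) <.. real (Suc n)} = {}" by auto
        show ?thesis unfolding Ioc empty by simp
      qed
    qed
    show "emeasure (D \<nu> n) {c<..} = emeasure (D (scale_intensity \<theta>) n) {c<..}" for c
      by (simp add: D S eqc)
    show "emeasure (D \<nu> n) {c<..} < \<infinity>" for c
      unfolding D[OF S, of "{c<..}", simplified] eqc
      by (rule scale_intensity_bounded[of _ "1 / real (Suc n)" "real (Suc n)"]) (auto simp: window_def assms(2))
  qed (simp_all add: D_def S)
  then have eqW: "emeasure \<nu> (B \<inter> window n) = emeasure (scale_intensity \<theta>) (B \<inter> window n)" for n
    using D[OF S B(1), of n] D[OF sets_scale_intensity B(1), of \<theta> n] by metis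
  have SUP: "emeasure \<rho> B = (SUP n. emeasure \<rho> (B \<inter> window n))" if S': "sets \<rho> = sets borel" for \<rho>
  proof -
    have "range (\<lambda>n. B \<inter> window n) \<subseteq> sets \<rho>" using B S' by auto
    from SUP_emeasure_incseq[OF this incseq_Int_window] show ?thesis by (simp only: UN_Int_window[OF B(2)])
  qed
  show ?thesis
    unfolding SUP[OF S] SUP[OF sets_scale_intensity] eqW ..
qed

section \<open>Counting points through grid cells\<close>

lemma npoints_empty_iff: "npoints A B = 0 \<longleftrightarrow> A \<inter> B = {}"
  unfolding npoints_def by (subst emeasure_count_space_eq_0) auto

lemma ncells_tendsto_npoints:
  "a < b \<Longrightarrow> B \<subseteq> {a<..b} \<Longrightarrow> (\<lambda>m. of_nat (ncells a b m (A \<inter> B)) :: ennreal) \<longlonglongrightarrow> npoints A B"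
  unfolding npoints_def by (rule ncells_tendsto) auto

lemma nn_integral_npoints_eq_limit:
  assumes B: "a < b" "B \<subseteq> {a<..b}"
    and meas: "\<And>m. (\<lambda>\<omega>. of_nat (ncells a b m (X \<omega> \<inter> B)) :: ennreal) \<in> borel_measurable M"
    and lim: "(\<lambda>m. \<integral>\<^sup>+\<omega>. of_nat (ncells a b m (X \<omega> \<inter> B)) \<partial>M) \<longlonglongrightarrow> L"
  shows "(\<integral>\<^sup>+\<omega>. npoints (X \<omega>) B \<partial>M) = L"
proof (rule antisym)
  have "(\<integral>\<^sup>+\<omega>. npoints (X \<omega>) B \<partial>M) = (\<integral>\<^sup>+\<omega>. liminf (\<lambda>m. of_nat (ncells a b m (X \<omega> \<inter> B))) \<partial>M)"
    by (intro nn_integral_cong) (simp add: lim_imp_Liminf[OF _ ncells_tendsto_npoints[OF B]])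
  also have "\<dots> \<le> liminf (\<lambda>m. \<integral>\<^sup>+\<omega>. of_nat (ncells a b m (X \<omega> \<inter> B)) \<partial>M)"
    by (rule nn_integral_liminf[OF meas])
  also have "\<dots> = L" by (rule lim_imp_Liminf[OF _ lim]) simp
  finally show "(\<integral>\<^sup>+\<omega>. npoints (X \<omega>) B \<partial>M) \<le> L" .
  show "L \<le> (\<integral>\<^sup>+\<omega>. npoints (X \<omega>) B \<partial>M)"
    by (rule LIMSEQ_le_const2[OF lim])
      (auto simp: npoints_def intro!: nn_integral_mono ncells_le_count B(1))
qed

lemma npoints_mono: "B \<subseteq> C \<Longrightarrow> npoints A B \<le> npoints A C"
  unfolding npoints_def by (intro emeasure_mono) auto

lemma npoints_finite_iff: "npoints A B < \<top> \<longleftrightarrow> finite (A \<inter> B)"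
  by (cases "finite (A \<inter> B)") (auto simp: npoints_def ennreal_of_nat_eq_real_of_nat)

lemma npoints_incseq:
  assumes "incseq B"
  shows "(\<lambda>n. npoints A (B n)) \<longlonglongrightarrow> npoints A (\<Union>n. B n)"
proof -
  have "(\<lambda>n. emeasure (count_space UNIV) (A \<inter> B n)) \<longlonglongrightarrow> emeasure (count_space UNIV) (\<Union>n. A \<inter> B n)"
    using assms by (intro Lim_emeasure_incseq) (auto simp: incseq_def)
  then show ?thesis by (simp add: npoints_def)
qed

lemma npoints_cases: obtains (fin) n where "npoints A B = of_nat n" | (inf) "npoints A B = \<infinity>"
  by (cases "finite (A \<inter> B)") (auto simp: npoints_def)

lemma space_point_configs [simp]: "space point_configs = UNIV"
  by (simp add: point_configs_def)

lemma measurable_point_configs_iff: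
  "X \<in> N \<rightarrow>\<^sub>M point_configs \<longleftrightarrow>
    (\<forall>B\<in>sets borel. B \<subseteq> {0<..} \<longrightarrow> (\<lambda>\<omega>. npoints (X \<omega>) B) \<in> borel_measurable N)"
proof
  assume X: "X \<in> N \<rightarrow>\<^sub>M point_configs"
  show "\<forall>B\<in>sets borel. B \<subseteq> {0<..} \<longrightarrow> (\<lambda>\<omega>. npoints (X \<omega>) B) \<in> borel_measurable N"
  proof (intro ballI impI measurableI)
    fix B :: "real set" and C :: "ennreal set"
    assume B: "B \<in> sets borel" "B \<subseteq> {0<..}" and C: "C \<in> sets borel"
    have "{A. npoints A B \<in> C} \<in> sets point_configs"
      unfolding point_configs_def using B C by (subst sets_measure_of) (auto intro!: sigma_sets.Basic)
    from measurable_sets[OF X this]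
    show "(\<lambda>\<omega>. npoints (X \<omega>) B) -` C \<inter> space N \<in> sets N" by (simp add: vimage_def)
  qed simp
next
  assume *: "\<forall>B\<in>sets borel. B \<subseteq> {0<..} \<longrightarrow> (\<lambda>\<omega>. npoints (X \<omega>) B) \<in> borel_measurable N"
  show "X \<in> N \<rightarrow>\<^sub>M point_configs"
    unfolding point_configs_def
  proof (rule measurable_sigma_sets[OF sets_measure_of])
    fix y assume "y \<in> {{A. npoints A B \<in> C} |B C. B \<in> sets borel \<and> B \<subseteq> {0<..} \<and> C \<in> sets borel}"
    then obtain B C where y: "y = {A. npoints A B \<in> C}" "B \<in> sets borel" "B \<subseteq> {0<..}" "C \<in> sets borel"
      by auto
    then have "(\<lambda>\<omega>. npoints (X \<omega>) B) \<in> borel_measurable N" using * by blast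
    from measurable_sets[OF this y(4)] show "X -` y \<inter> space N \<in> sets N"
      by (simp add: y(1) vimage_def)
  qed auto
qed

section \<open>Void probabilities determine Poisson processes\<close>

text \<open>Only sets bounded away from 0 and from infinity are constrained, where the intensity is
  finite. The void events are also the only measurability assumed of \<open>X\<close>; that of the
  counts is derived.\<close>

locale void_process = prob_space +
  fixes X :: "'a \<Rightarrow> real set" and \<theta> :: real
  assumes theta_nonneg: "0 \<le> \<theta>"
    and void_sets: "\<And>B c d. B \<in> sets borel \<Longrightarrow> B \<subseteq> {c<..d} \<Longrightarrow> 0 < c \<Longrightarrow> {\<omega> \<in> space M. X \<omega> \<inter> B = {}} \<in> events"
    and void_prob: "\<And>B c d. B \<in> sets borel \<Longrightarrow> B \<subseteq> {c<..d} \<Longrightarrow> 0 < c \<Longrightarrow>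
      prob {\<omega> \<in> space M. X \<omega> \<inter> B = {}} = exp (- measure (scale_intensity \<theta>) B)"
begin

abbreviation "\<mu> \<equiv> scale_intensity \<theta>"

definition void :: "real set \<Rightarrow> 'a set" where
  "void B = {\<omega> \<in> space M. X \<omega> \<inter> B = {}}"

definition bounded_sets :: "real set set" where
  "bounded_sets = {B \<in> sets borel. \<exists>c d. 0 < c \<and> B \<subseteq> {c<..d}}"

lemma bounded_setsI: "B \<in> sets borel \<Longrightarrow> B \<subseteq> {c<..d} \<Longrightarrow> 0 < c \<Longrightarrow> B \<in> bounded_sets"
  unfolding bounded_sets_def by blast

lemma window_bounded: "B \<in> sets borel \<Longrightarrow> B \<inter> window n \<in> bounded_sets"
  by (rule bounded_setsI[of _ "1 / real (Suc n)" "real (Suc n)"]) (auto simp: window_def)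

lemma void_events: "B \<in> bounded_sets \<Longrightarrow> void B \<in> events"
  using void_sets by (auto simp: bounded_sets_def void_def)

lemma prob_void: "B \<in> bounded_sets \<Longrightarrow> prob (void B) = exp (- measure \<mu> B)"
  using void_prob by (auto simp: bounded_sets_def void_def)

lemma void_Un: "void (A \<union> B) = void A \<inter> void B"
  by (auto simp: void_def)

lemma bounded_sets_Un:
  assumes "A \<in> bounded_sets" "B \<in> bounded_sets"
  shows "A \<union> B \<in> bounded_sets"
proof -
  obtain a b c d where "0 < a" "A \<subseteq> {a<..b}" "0 < c" "B \<subseteq> {c<..d}"
    using assms by (auto simp: bounded_sets_def)
  then have "0 < min a c" "A \<union> B \<subseteq> {min a c<..max b d}" by (auto simp: subset_iff)
  then show ?thesis using assms unfolding bounded_sets_def by blast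
qed

lemma bounded_sets_empty: "{} \<in> bounded_sets"
  unfolding bounded_sets_def by (auto intro!: exI[of _ 1])

lemma bounded_sets_borel: "B \<in> bounded_sets \<Longrightarrow> B \<in> sets borel"
  by (simp add: bounded_sets_def)

lemma emeasure_bounded: "B \<in> bounded_sets \<Longrightarrow> emeasure \<mu> B < \<infinity>"
  using scale_intensity_bounded[OF _ _ _ theta_nonneg] by (auto simp: bounded_sets_def)

lemma measure_bounded_Un:
  "A \<in> bounded_sets \<Longrightarrow> B \<in> bounded_sets \<Longrightarrow> A \<inter> B = {} \<Longrightarrow> measure \<mu> (A \<union> B) = measure \<mu> A + measure \<mu> B"
  using emeasure_bounded[of A] emeasure_bounded[of B]
  by (intro measure_Union) (auto dest: bounded_sets_borel)

lemma measure_bounded_UN: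
  assumes "finite I" "\<And>i. i \<in> I \<Longrightarrow> A i \<in> bounded_sets" "disjoint_family_on A I"
  shows "(\<Union>i\<in>I. A i) \<in> bounded_sets \<and> measure \<mu> (\<Union>i\<in>I. A i) = (\<Sum>i\<in>I. measure \<mu> (A i))"
  using assms
proof (induction I)
  case empty
  then show ?case by (simp add: bounded_sets_empty)
next
  case (insert i I)
  then have *: "(\<Union>i\<in>I. A i) \<in> bounded_sets" "measure \<mu> (\<Union>i\<in>I. A i) = (\<Sum>i\<in>I. measure \<mu> (A i))" "A i \<in> bounded_sets"
    "A i \<inter> (\<Union>i\<in>I. A i) = {}"
    by (auto simp: disjoint_family_on_def)
  then show ?case using insert(1,2) by (simp add: measure_bounded_Un bounded_sets_Un)
qed

definition cnt :: "real set \<Rightarrow> 'a \<Rightarrow> ennreal" where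
  "cnt B \<omega> = npoints (X \<omega>) B"

text \<open>The information on \<open>X\<close> inside \<open>B\<close>. Void events are closed
  under intersection, hence independence of these algebras can be checked on them alone.\<close>

definition void_alg :: "real set \<Rightarrow> 'a set set" where
  "void_alg B = sigma_sets (space M) {void A | A. A \<in> bounded_sets \<and> A \<subseteq> B}"

lemma void_alg_into: "{void A | A. A \<in> bounded_sets \<and> A \<subseteq> B} \<subseteq> Pow (space M)"
  by (auto simp: void_def)

lemma sigma_algebra_void_alg: "sigma_algebra (space M) (void_alg B)"
  unfolding void_alg_def by (rule sigma_algebra_sigma_sets[OF void_alg_into])

lemma space_restrict_alg [simp]: "space (sigma (space M) (void_alg B)) = space M"
  by (rule sigma_algebra.space_measure_of_eq[OF sigma_algebra_void_alg])

lemma sets_restrict_alg: "sets (sigma (space M) (void_alg B)) = void_alg B"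
  by (rule sigma_algebra.sets_measure_of_eq[OF sigma_algebra_void_alg])

text \<open>Within a window the count is the limit of numbers of occupied cells, which are functions
  of void events inside \<open>B\<close>; then the windows increase.\<close>

lemma cnt_measurable_void_alg:
  assumes B: "B \<in> sets borel" "B \<subseteq> {0<..}"
  shows "cnt B \<in> borel_measurable (sigma (space M) (void_alg B))"
proof -
  define S where "S = sigma (space M) (void_alg B)"
  define W where "W n = B \<inter> window n" for n
  have inc: "incseq W" unfolding W_def by (rule incseq_Int_window)
  have UN: "(\<Union>n. W n) = B" unfolding W_def by (rule UN_Int_window) fact
  have W_cnt: "cnt (W n) \<in> borel_measurable S" for n
  proof (rule borel_measurable_LIMSEQ_order)
    show "(\<lambda>m. of_nat (ncells 0 (real (Suc n)) m (X \<omega> \<inter> W n))) \<longlonglongrightarrow> cnt (W n) \<omega>" for \<omega>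
      unfolding cnt_def
      by (rule ncells_tendsto_npoints) (use B in \<open>auto simp: W_def window_def\<close>)
    fix m
    have "{\<omega> \<in> space S. X \<omega> \<inter> W n \<inter> cell 0 (real (Suc n)) m i = {}} \<in> sets S" for i
    proof -
      have "W n \<inter> cell 0 (real (Suc n)) m i \<in> bounded_sets"
        using B by (intro bounded_setsI[of _ "1 / real (Suc n)" "real (Suc n)"]) (auto simp: W_def window_def)
      then have "void (W n \<inter> cell 0 (real (Suc n)) m i) \<in> void_alg B"
        unfolding void_alg_def by (intro sigma_sets.Basic) (auto simp: W_def)
      then show ?thesis by (simp add: S_def sets_restrict_alg void_def Int_assoc)
    qed
    then show "(\<lambda>\<omega>. of_nat (ncells 0 (real (Suc n)) m (X \<omega> \<inter> W n)) :: ennreal) \<in> borel_measurable S"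
      unfolding ncells_eq_sum of_nat_sum by (intro borel_measurable_sum) (simp add: if_distrib[of of_nat] measurable_If_set)
  qed
  have "(\<lambda>n. cnt (W n) \<omega>) \<longlonglongrightarrow> cnt B \<omega>" for \<omega>
    unfolding cnt_def UN[symmetric] by (rule npoints_incseq[OF inc])
  then show ?thesis using W_cnt unfolding S_def by (rule borel_measurable_LIMSEQ_order)
qed

lemma void_alg_events: "void_alg B \<subseteq> events"
  unfolding void_alg_def
  by (rule sets.sigma_sets_subset) (auto intro: void_events)

lemma cnt_measurable [measurable]:
  assumes "B \<in> sets borel" "B \<subseteq> {0<..}"
  shows "cnt B \<in> borel_measurable M"
  using cnt_measurable_void_alg[OF assms]
  by (rule measurable_from_subalg[rotated]) (auto simp: subalgebra_def sets_restrict_alg intro: subsetD[OF void_alg_events])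

text \<open>An intersection of void events is the void event of the union. For disjoint sets the
  intensity is additive, so its exponential factorizes.\<close>

lemma indep_void_alg:
  assumes disj: "disjoint_family_on B I"
  shows "indep_sets (\<lambda>i. void_alg (B i)) I"
  unfolding void_alg_def
proof (rule indep_sets_sigma)
  show "indep_sets (\<lambda>i. {void A |A. A \<in> bounded_sets \<and> A \<subseteq> B i}) I"
  proof (rule indep_setsI)
    fix E J assume J: "J \<noteq> {}" "J \<subseteq> I" "finite J"
      and E: "\<forall>j\<in>J. E j \<in> {void A |A. A \<in> bounded_sets \<and> A \<subseteq> B j}"
    from E have "\<forall>j\<in>J. \<exists>A. E j = void A \<and> A \<in> bounded_sets \<and> A \<subseteq> B j" by blast
    then obtain A where A: "\<And>j. j \<in> J \<Longrightarrow> E j = void (A j)" "\<And>j. j \<in> J \<Longrightarrow> A j \<in> bounded_sets"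
      "\<And>j. j \<in> J \<Longrightarrow> A j \<subseteq> B j" by metis
    have disjA: "disjoint_family_on A J"
      using disj J(2) A(3) unfolding disjoint_family_on_def by blast
    have "(\<Inter>j\<in>J. E j) = void (\<Union>j\<in>J. A j)"
      using J(1) A(1) by (auto simp: void_def)
    then show "prob (\<Inter>j\<in>J. E j) = (\<Prod>j\<in>J. prob (E j))"
      using measure_bounded_UN[OF J(3) A(2) disjA] A J(3)
      by (simp add: prob_void exp_sum flip: sum_negf)
  qed (auto intro: void_events)
  show "Int_stable {void A |A. A \<in> bounded_sets \<and> A \<subseteq> B i}" for i
  proof (rule Int_stableI)
    fix a b assume "a \<in> {void A |A. A \<in> bounded_sets \<and> A \<subseteq> B i}" "b \<in> {void A |A. A \<in> bounded_sets \<and> A \<subseteq> B i}"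
    then obtain A A' where "a = void A" "b = void A'" "A \<in> bounded_sets" "A' \<in> bounded_sets" "A \<union> A' \<subseteq> B i"
      by auto
    then show "a \<inter> b \<in> {void A |A. A \<in> bounded_sets \<and> A \<subseteq> B i}"
      using bounded_sets_Un by (auto intro!: exI[of _ "A \<union> A'"] simp: void_Un)
  qed
qed

lemma indep_cnt:
  assumes B: "\<And>i. i \<in> I \<Longrightarrow> B i \<in> sets borel" "\<And>i. i \<in> I \<Longrightarrow> B i \<subseteq> {0<..}" and "disjoint_family_on B I"
  shows "indep_vars (\<lambda>_. borel) (\<lambda>i. cnt (B i)) I"
  unfolding indep_vars_def2
proof
  show "\<forall>i\<in>I. random_variable borel (cnt (B i))"
    using B by auto
  show "indep_sets (\<lambda>i. {cnt (B i) -` A \<inter> space M |A. A \<in> sets borel}) I"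
  proof (rule indep_sets_mono_sets[OF indep_void_alg[OF assms(3)]])
    fix i assume "i \<in> I"
    then show "{cnt (B i) -` A \<inter> space M |A. A \<in> sets borel} \<subseteq> void_alg (B i)"
      using measurable_sets[OF cnt_measurable_void_alg[OF B]] by (auto simp: sets_restrict_alg)
  qed
qed

text \<open>A factor is 1 if its set is void and \<open>z\<close> if it is hit, so the product is
  \<open>z\<close> to the power of the number of sets hit. The extra set \<open>D\<close> carries
  the induction: expanding one factor replaces \<open>D\<close> by
  \<open>D \<union> A j\<close>.\<close>

lemma prod_void_expectation:
  assumes "finite I" "\<And>i. i \<in> I \<Longrightarrow> A i \<in> bounded_sets" "disjoint_family_on A I"
    and "D \<in> bounded_sets" "\<And>i. i \<in> I \<Longrightarrow> A i \<inter> D = {}"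
  shows "expectation (\<lambda>\<omega>. indicator (void D) \<omega> * (\<Prod>i\<in>I. z + (1 - z) * indicator (void (A i)) \<omega>))
    = exp (- measure \<mu> D) * (\<Prod>i\<in>I. z + (1 - z) * exp (- measure \<mu> (A i)))"
  using assms
proof (induction I arbitrary: D rule: finite_induct)
  case empty
  then show ?case by (simp add: prob_void void_events)
next
  case (insert j I)
  let ?P = "\<lambda>\<omega>. \<Prod>i\<in>I. z + (1 - z) * indicator (void (A i)) \<omega> :: real"
  have Aj: "A j \<in> bounded_sets" "A j \<inter> D = {}" and AI: "\<And>i. i \<in> I \<Longrightarrow> A i \<in> bounded_sets"
    "disjoint_family_on A I" "\<And>i. i \<in> I \<Longrightarrow> A i \<inter> A j = {}" "\<And>i. i \<in> I \<Longrightarrow> A i \<inter> D = {}"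
    using insert by (auto simp: disjoint_family_on_def)
  have bnd: "\<exists>C. \<forall>\<omega>. \<bar>?P \<omega>\<bar> \<le> C"
  proof (intro exI allI)
    fix \<omega>
    have "\<bar>?P \<omega>\<bar> = (\<Prod>i\<in>I. \<bar>z + (1 - z) * indicator (void (A i)) \<omega>\<bar>)" by (rule abs_prod)
    also have "\<dots> \<le> (\<Prod>i\<in>I. \<bar>z\<bar> + 1)"
      by (intro prod_mono) (auto simp: indicator_def)
    finally show "\<bar>?P \<omega>\<bar> \<le> (\<Prod>i\<in>I. \<bar>z\<bar> + 1)" .
  qed
  then obtain C where C: "\<And>\<omega>. \<bar>?P \<omega>\<bar> \<le> C" by blast
  have Pm: "?P \<in> borel_measurable M"
    using AI void_events by (intro borel_measurable_prod) auto
  have int: "integrable M (\<lambda>\<omega>. indicator (void E) \<omega> * ?P \<omega>)" if "E \<in> bounded_sets" for E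
    using C Pm void_events[OF that] order_trans[OF abs_ge_zero C]
    by (intro integrable_const_bound[where B = C]) (auto simp: indicator_def abs_mult)
  have eq: "indicator (void D) \<omega> * (\<Prod>i\<in>insert j I. z + (1 - z) * indicator (void (A i)) \<omega>)
    = z * (indicator (void D) \<omega> * ?P \<omega>) + (1 - z) * (indicator (void (D \<union> A j)) \<omega> * ?P \<omega>)" for \<omega>
    using insert(1,2) by (simp add: void_Un indicator_inter_arith algebra_simps)
  have "expectation (\<lambda>\<omega>. indicator (void D) \<omega> * (\<Prod>i\<in>insert j I. z + (1 - z) * indicator (void (A i)) \<omega>))
    = z * expectation (\<lambda>\<omega>. indicator (void D) \<omega> * ?P \<omega>)
      + (1 - z) * expectation (\<lambda>\<omega>. indicator (void (D \<union> A j)) \<omega> * ?P \<omega>)"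
    unfolding eq using int[OF insert.prems(3)] int[OF bounded_sets_Un[OF insert.prems(3) Aj(1)]] by simp
  also have "expectation (\<lambda>\<omega>. indicator (void D) \<omega> * ?P \<omega>)
      = exp (- measure \<mu> D) * (\<Prod>i\<in>I. z + (1 - z) * exp (- measure \<mu> (A i)))"
    by (rule insert.IH) (use insert.prems AI in auto)
  also have "expectation (\<lambda>\<omega>. indicator (void (D \<union> A j)) \<omega> * ?P \<omega>)
      = exp (- measure \<mu> (D \<union> A j)) * (\<Prod>i\<in>I. z + (1 - z) * exp (- measure \<mu> (A i)))"
    using AI Aj insert.prems(3) bounded_sets_Un by (intro insert.IH) blast+
  also have "measure \<mu> (D \<union> A j) = measure \<mu> D + measure \<mu> (A j)"
    using insert.prems(3) Aj by (intro measure_bounded_Un) auto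
  finally have "expectation (\<lambda>\<omega>. indicator (void D) \<omega> * (\<Prod>i\<in>insert j I. z + (1 - z) * indicator (void (A i)) \<omega>))
    = z * (exp (- measure \<mu> D) * (\<Prod>i\<in>I. z + (1 - z) * exp (- measure \<mu> (A i))))
      + (1 - z) * (exp (- (measure \<mu> D + measure \<mu> (A j))) * (\<Prod>i\<in>I. z + (1 - z) * exp (- measure \<mu> (A i))))" .
  moreover have "exp (- (measure \<mu> D + measure \<mu> (A j))) = exp (- measure \<mu> D) * exp (- measure \<mu> (A j))"
    by (simp add: mult_exp_exp)
  ultimately show ?case
    unfolding prod.insert[OF insert(1,2)] by (simp only: ring_distribs mult_ac)
qed

lemma prod_void_expectation':
  assumes "finite I" "\<And>i. i \<in> I \<Longrightarrow> A i \<in> bounded_sets" "disjoint_family_on A I"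
  shows "expectation (\<lambda>\<omega>. \<Prod>i\<in>I. z + (1 - z) * indicator (void (A i)) \<omega>)
    = (\<Prod>i\<in>I. z + (1 - z) * exp (- measure \<mu> (A i)))"
proof -
  have "expectation (\<lambda>\<omega>. \<Prod>i\<in>I. z + (1 - z) * indicator (void (A i)) \<omega>) =
    expectation (\<lambda>\<omega>. indicator (void {}) \<omega> * (\<Prod>i\<in>I. z + (1 - z) * indicator (void (A i)) \<omega>))"
    by (intro Bochner_Integration.integral_cong) (auto simp: void_def)
  also have "\<dots> = (\<Prod>i\<in>I. z + (1 - z) * exp (- measure \<mu> (A i)))"
    using prod_void_expectation[OF assms bounded_sets_empty, of z] by simp
  finally show ?thesis .
qed

lemma cells_bounded:
  assumes B: "B \<in> sets borel" "B \<subseteq> {c<..d}" "0 < c" "c < d"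
  shows "B \<inter> cell 0 d m i \<in> bounded_sets"
    and "disjoint_family_on (\<lambda>i. B \<inter> cell 0 d m i) {..<m}"
    and "measure \<mu> (B \<inter> cell 0 d m i) \<le> \<theta> / c * (d / real m)"
    and "(\<lambda>m. \<Sum>i<m. measure \<mu> (B \<inter> cell 0 d m i)) \<longlonglongrightarrow> measure \<mu> B"
proof -
  show bd: "B \<inter> cell 0 d m i \<in> bounded_sets" for m i
    using B by (intro bounded_setsI[of _ c d]) auto
  show disj: "disjoint_family_on (\<lambda>i. B \<inter> cell 0 d m i) {..<m}" for m
    using B disjoint_cell[of 0 d] by (fastforce simp: disjoint_family_on_def)
  have "emeasure \<mu> (B \<inter> cell 0 d m i) \<le> ennreal (\<theta> / c * (grid 0 d m (Suc i) - grid 0 d m i))"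
    using B theta_nonneg grid_le[of 0 d i "Suc i" m] by (intro scale_intensity_le_length) (auto simp: cell_def)
  then show "measure \<mu> (B \<inter> cell 0 d m i) \<le> \<theta> / c * (d / real m)"
    using B theta_nonneg by (auto simp: grid_Suc_diff measure_def intro!: enn2real_leI)
  have "(\<Sum>i<m. measure \<mu> (B \<inter> cell 0 d m i)) = measure \<mu> B" if "0 < m" for m
  proof -
    have "(\<Union>i<m. B \<inter> cell 0 d m i) = B" using UN_cell[of 0 d m] B that by fastforce
    then show ?thesis using measure_bounded_UN[of "{..<m}" "\<lambda>i. B \<inter> cell 0 d m i"] bd disj by auto
  qed
  then show "(\<lambda>m. \<Sum>i<m. measure \<mu> (B \<inter> cell 0 d m i)) \<longlonglongrightarrow> measure \<mu> B"
    by (intro tendsto_eventually) (auto intro: eventually_mono[OF eventually_gt_at_top[of 0]])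
qed

lemma bounded_setsE:
  assumes "B \<in> bounded_sets"
  obtains c d where "B \<in> sets borel" "B \<subseteq> {c<..d}" "0 < c" "c < d"
proof -
  obtain c d where cd: "B \<in> sets borel" "B \<subseteq> {c<..d}" "0 < c" using assms by (auto simp: bounded_sets_def)
  show ?thesis by (rule that[of c "max d (c + 1)"]) (use cd in \<open>auto dest!: subsetD\<close>)
qed

lemma nn_integral_ncells:
  assumes B: "B \<in> sets borel" "B \<subseteq> {c<..d}" "0 < c" "c < d"
  shows "(\<integral>\<^sup>+\<omega>. of_nat (ncells 0 d m (X \<omega> \<inter> B)) \<partial>M)
    = ennreal (\<Sum>i<m. 1 - exp (- measure \<mu> (B \<inter> cell 0 d m i)))"
proof -
  note bd = cells_bounded(1)[OF B]
  have "(\<integral>\<^sup>+\<omega>. of_nat (ncells 0 d m (X \<omega> \<inter> B)) \<partial>M)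
    = (\<integral>\<^sup>+\<omega>. (\<Sum>i<m. indicator (space M - void (B \<inter> cell 0 d m i)) \<omega>) \<partial>M)"
    by (intro nn_integral_cong, simp only: ncells_eq_sum of_nat_sum, intro sum.cong)
      (auto simp: void_def indicator_def Int_assoc)
  also have "\<dots> = (\<Sum>i<m. emeasure M (space M - void (B \<inter> cell 0 d m i)))"
    using void_events[OF bd] by (subst nn_integral_sum) auto
  also have "\<dots> = (\<Sum>i<m. ennreal (1 - exp (- measure \<mu> (B \<inter> cell 0 d m i))))"
    by (simp add: emeasure_eq_measure prob_compl[OF void_events[OF bd]] prob_void[OF bd])
  finally show ?thesis by (simp add: sum_ennreal)
qed

text \<open>The mean number of occupied cells is a sum of terms \<open>1 - exp (- x)\<close> over
  cell intensities \<open>x\<close>. Finiteness of the limit is what makes \<open>X\<close> locally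
  finite almost surely.\<close>

lemma nn_integral_cnt:
  assumes "B \<in> bounded_sets"
  shows "(\<integral>\<^sup>+\<omega>. cnt B \<omega> \<partial>M) = ennreal (measure \<mu> B)"
proof -
  obtain c d where B: "B \<in> sets borel" "B \<subseteq> {c<..d}" "0 < c" "c < d"
    using assms by (rule bounded_setsE)
  have "(\<lambda>m. \<Sum>i<m. 1 - exp (- measure \<mu> (B \<inter> cell 0 d m i))) \<longlonglongrightarrow> measure \<mu> B"
    by (rule sum_one_minus_exp_tendsto[OF _ cells_bounded(3)[OF B] _ cells_bounded(4)[OF B]])
      (use lim_const_over_n[of "\<theta> / c * d"] in auto)
  then have lim: "(\<lambda>m. \<integral>\<^sup>+\<omega>. of_nat (ncells 0 d m (X \<omega> \<inter> B)) \<partial>M) \<longlonglongrightarrow> ennreal (measure \<mu> B)"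
    unfolding nn_integral_ncells[OF B] by (rule tendsto_ennrealI)
  have ncells_meas: "(\<lambda>\<omega>. of_nat (ncells 0 d m (X \<omega> \<inter> B)) :: ennreal) \<in> borel_measurable M" for m
  proof -
    have "{\<omega> \<in> space M. X \<omega> \<inter> B \<inter> cell 0 d m i = {}} \<in> events" for i
      using void_events[OF cells_bounded(1)[OF B]] by (simp add: void_def Int_assoc)
    then show ?thesis
      unfolding ncells_eq_sum of_nat_sum
      by (intro borel_measurable_sum) (simp add: if_distrib[of of_nat] measurable_If_set)
  qed
  show ?thesis
    unfolding cnt_def using B by (intro nn_integral_npoints_eq_limit[OF _ _ ncells_meas lim]) auto
qed

lemma AE_cnt_finite:
  assumes "B \<in> bounded_sets"
  shows "AE \<omega> in M. finite (X \<omega> \<inter> B)"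
proof -
  have "B \<subseteq> {0<..}" using assms by (force simp: bounded_sets_def)
  then have "AE \<omega> in M. cnt B \<omega> \<noteq> \<infinity>"
    using nn_integral_cnt[OF assms] bounded_sets_borel[OF assms]
    by (intro nn_integral_PInf_AE) auto
  then show ?thesis
    by eventually_elim (simp add: cnt_def less_top npoints_finite_iff[symmetric])
qed

lemma AE_locally_finite: "AE \<omega> in M. \<forall>a b. 0 < a \<longrightarrow> finite (X \<omega> \<inter> {a..b})"
proof -
  have "AE \<omega> in M. \<forall>n. finite (X \<omega> \<inter> window n)"
    unfolding AE_all_countable using window_bounded[of UNIV] by (intro allI AE_cnt_finite) simp
  then show ?thesis
  proof eventually_elim
    case (elim \<omega>)
    show ?case
    proof (intro allI impI)
      fix a b :: real assume "0 < a"
      obtain n :: nat where n: "max b (1 / a) < real n" using reals_Archimedean2 by blast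
      then have "1 / a < real (Suc n)" by simp
      then have "1 / real (Suc n) < a" using \<open>0 < a\<close> by (simp add: field_simps)
      then have "X \<omega> \<inter> {a..b} \<subseteq> X \<omega> \<inter> window n" using n by (auto simp: window_def)
      then show "finite (X \<omega> \<inter> {a..b})" using elim finite_subset by blast
    qed
  qed
qed

text \<open>This is the Laplace transform of a Poisson variable. Almost surely the number of
  occupied cells is eventually the count, and the expected products with
  \<open>z = exp (- u)\<close> converge as for a null array. \<open>enn2real\<close> sends an
  infinite count to 0, which happens only on a null event.\<close>

lemma laplace_cnt:
  assumes "B \<in> bounded_sets" and u: "0 \<le> u"
  shows "expectation (\<lambda>\<omega>. exp (- u * enn2real (cnt B \<omega>))) = exp (- measure \<mu> B * (1 - exp (- u)))"
proof -
  obtain c d where B: "B \<in> sets borel" "B \<subseteq> {c<..d}" "0 < c" "c < d"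
    using assms by (auto elim: bounded_setsE)
  define z where "z = exp (- u)"
  have z: "0 \<le> z" "z \<le> 1" using u by (auto simp: z_def)
  define \<phi> where "\<phi> m i = measure \<mu> (B \<inter> cell 0 d m i)" for m i
  define F where "F m \<omega> = (\<Prod>i<m. z + (1 - z) * indicator (void (B \<inter> cell 0 d m i)) \<omega>)" for m \<omega>
  have F_eq: "F m \<omega> = exp (- u * real (ncells 0 d m (X \<omega> \<inter> B)))" if "\<omega> \<in> space M" for m \<omega>
  proof -
    have "F m \<omega> = (\<Prod>i<m. exp (- u * (if X \<omega> \<inter> B \<inter> cell 0 d m i = {} then 0 else 1)))"
      unfolding F_def using that by (intro prod.cong) (auto simp: void_def indicator_def z_def Int_assoc)
    also have "\<dots> = exp (\<Sum>i<m. - u * (if X \<omega> \<inter> B \<inter> cell 0 d m i = {} then 0 else 1))"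
      by (simp add: exp_sum)
    also have "(\<Sum>i<m. - u * (if X \<omega> \<inter> B \<inter> cell 0 d m i = {} then 0 else 1)) = - u * real (ncells 0 d m (X \<omega> \<inter> B))"
      unfolding ncells_eq_sum of_nat_sum sum_distrib_left by (intro sum.cong) auto
    finally show ?thesis .
  qed
  have Fm: "F m \<in> borel_measurable M" for m
    unfolding F_def using void_events[OF cells_bounded(1)[OF B]] by (intro borel_measurable_prod) auto
  have fin: "AE \<omega> in M. finite (X \<omega> \<inter> B)" by (rule AE_cnt_finite) fact
  have card_eq: "enn2real (cnt B \<omega>) = real (card (X \<omega> \<inter> B))" if "finite (X \<omega> \<inter> B)" for \<omega>
    using that by (simp add: cnt_def npoints_def ennreal_of_nat_eq_real_of_nat)
  have B0: "B \<subseteq> {0<..}" using B by auto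
  note [measurable] = cnt_measurable[OF B(1) B0]
  have "(\<lambda>m. expectation (F m)) \<longlonglongrightarrow> expectation (\<lambda>\<omega>. exp (- u * enn2real (cnt B \<omega>)))"
  proof (rule integral_dominated_convergence[where w = "\<lambda>_. 1"])
    show "AE \<omega> in M. (\<lambda>m. F m \<omega>) \<longlonglongrightarrow> exp (- u * enn2real (cnt B \<omega>))"
      using fin AE_space
    proof eventually_elim
      case (elim \<omega>)
      have "\<forall>\<^sub>F m in sequentially. ncells 0 d m (X \<omega> \<inter> B) = card (X \<omega> \<inter> B)"
        using elim B by (intro ncells_eventually_eq_card) auto
      then have "\<forall>\<^sub>F m in sequentially. F m \<omega> = exp (- u * enn2real (cnt B \<omega>))"
        by eventually_elim (use elim in \<open>simp add: F_eq card_eq\<close>)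
      then show ?case by (rule tendsto_eventually)
    qed
    show "AE \<omega> in M. norm (F m \<omega>) \<le> 1" for m
      using AE_space by eventually_elim (use u in \<open>simp add: F_eq\<close>)
  qed (use Fm in auto)
  moreover have "expectation (F m) = (\<Prod>i<m. 1 - (1 - z) * (1 - exp (- \<phi> m i)))" for m
    unfolding F_def \<phi>_def prod_void_expectation'[OF finite_lessThan cells_bounded(1)[OF B] cells_bounded(2)[OF B]]
    by (intro prod.cong) (auto simp: algebra_simps)
  moreover have "(\<lambda>m. \<Prod>i<m. 1 - (1 - z) * (1 - exp (- \<phi> m i))) \<longlonglongrightarrow> exp (- (measure \<mu> B * (1 - z)))"
  proof (rule prod_one_minus_tendsto_exp)
    have \<delta>: "(\<lambda>m. \<theta> / c * (d / real m)) \<longlonglongrightarrow> 0" using lim_const_over_n[of "\<theta> / c * d"] by simp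
    then show "(\<lambda>m. \<theta> / c * (d / real m)) \<longlonglongrightarrow> 0" .
    have "(\<lambda>m. \<Sum>i<m. 1 - exp (- \<phi> m i)) \<longlonglongrightarrow> measure \<mu> B"
      unfolding \<phi>_def
      by (rule sum_one_minus_exp_tendsto[OF _ cells_bounded(3)[OF B] \<delta> cells_bounded(4)[OF B]]) simp
    from tendsto_mult_right[OF this, of "1 - z"]
    show "(\<lambda>m. \<Sum>i<m. (1 - z) * (1 - exp (- \<phi> m i))) \<longlonglongrightarrow> measure \<mu> B * (1 - z)"
      by (simp add: sum_distrib_left mult.commute)
    fix m i
    have "0 \<le> \<phi> m i" by (simp add: \<phi>_def)
    then show "0 \<le> (1 - z) * (1 - exp (- \<phi> m i))" using z by simp
    have "(1 - z) * (1 - exp (- \<phi> m i)) \<le> 1 * \<phi> m i"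
      using z one_minus_exp_bounds[OF \<open>0 \<le> \<phi> m i\<close>] \<open>0 \<le> \<phi> m i\<close> by (intro mult_mono) auto
    also have "\<dots> \<le> \<theta> / c * (d / real m)" using cells_bounded(3)[OF B] by (simp add: \<phi>_def)
    finally show "(1 - z) * (1 - exp (- \<phi> m i)) \<le> \<theta> / c * (d / real m)" .
  qed simp
  ultimately have "expectation (\<lambda>\<omega>. exp (- u * enn2real (cnt B \<omega>))) = exp (- (measure \<mu> B * (1 - z)))"
    by (auto intro: LIMSEQ_unique)
  then show ?thesis by (simp add: z_def)
qed

lemma prob_cnt_bounded:
  assumes "B \<in> bounded_sets"
  shows "prob {\<omega> \<in> space M. cnt B \<omega> = of_nat n} = measure \<mu> B ^ n / fact n * exp (- measure \<mu> B)"
proof -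
  have B: "B \<in> sets borel" "B \<subseteq> {0<..}" using assms by (force simp: bounded_sets_def)+
  note [measurable] = cnt_measurable[OF B]
  define l where "l = measure \<mu> B"
  have fin: "AE \<omega> in M. finite (X \<omega> \<inter> B)" by (rule AE_cnt_finite) fact
  have real_iff: "cnt B \<omega> = of_nat n \<longleftrightarrow> enn2real (cnt B \<omega>) = real n" if "finite (X \<omega> \<inter> B)" for \<omega>
    using that by (simp add: cnt_def npoints_def ennreal_of_nat_eq_real_of_nat)
  show ?thesis
  \<comment> \<open>With zero intensity the void event has probability 1, and
    \<open>0 ^ 0 = 1\<close> makes the formula correct at \<open>n = 0\<close>.\<close>
  proof (cases "l = 0")
    case True
    have "prob (void B) = 1" using prob_void[OF assms] True by (simp add: l_def)
    then have "AE \<omega> in M. \<omega> \<in> void B" by (simp add: AE_in_set_eq_1 void_events[OF assms])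
    then have AE0: "AE \<omega> in M. cnt B \<omega> = 0"
      by eventually_elim (simp add: void_def cnt_def npoints_empty_iff)
    then have "prob {\<omega> \<in> space M. cnt B \<omega> = of_nat n} = prob (if n = 0 then space M else {})"
      by (intro measure_eq_AE) auto
    then show ?thesis using True by (auto simp: l_def prob_space)
  next
    case False
    then have l: "0 < l" by (simp add: l_def less_le)
    interpret P: prob_space "measure_pmf (poisson_pmf l)" by (rule prob_space_measure_pmf)
    have poisson: "measure_pmf.expectation (poisson_pmf l) (\<lambda>k. exp (- u * real k)) = exp (- l * (1 - exp (- u)))" if "0 \<le> u" for u
    proof -
      have "(\<lambda>k. (l * exp (- u)) ^ k /\<^sub>R fact k * exp (- l)) sums (exp (l * exp (- u)) * exp (- l))"
        by (intro sums_mult2 exp_converges)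
      moreover have "(l * exp (- u)) ^ k /\<^sub>R fact k * exp (- l) = pmf (poisson_pmf l) k * exp (- u * real k)" for k
        using l by (simp add: power_mult_distrib exp_of_nat_mult[symmetric] field_simps)
      ultimately have S: "(\<lambda>k. pmf (poisson_pmf l) k * exp (- u * real k)) sums (exp (l * exp (- u)) * exp (- l))"
        by simp
      have "measure_pmf.expectation (poisson_pmf l) (\<lambda>k. exp (- u * real k)) = (\<integral>k. pmf (poisson_pmf l) k * exp (- u * real k) \<partial>count_space UNIV)"
        unfolding measure_pmf_eq_density by (subst integral_density) auto
      also have "\<dots> = exp (l * exp (- u)) * exp (- l)"
        using S by (intro sums_unique2[OF sums_integral_count_space_nat])
          (auto simp: integrable_count_space_nat_iff sums_iff)
      finally show ?thesis by (simp add: mult_exp_exp algebra_simps)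
    qed
    have "distr M borel (\<lambda>\<omega>. enn2real (cnt B \<omega>)) = distr (measure_pmf (poisson_pmf l)) borel real"
    proof (rule laplace_transform_unique)
      show "finite_measure (distr M borel (\<lambda>\<omega>. enn2real (cnt B \<omega>)))"
        by (rule finite_measure_distr) measurable
      show "finite_measure (distr (measure_pmf (poisson_pmf l)) borel real)"
        by (rule measure_pmf.finite_measure_distr) measurable
      show "(\<integral>x. exp (- real j * x) \<partial>distr M borel (\<lambda>\<omega>. enn2real (cnt B \<omega>)))
        = (\<integral>x. exp (- real j * x) \<partial>distr (measure_pmf (poisson_pmf l)) borel real)" for j
        using poisson[of "real j"] laplace_cnt[OF assms, of "real j"]
        by (simp add: integral_distr l_def)
    qed (auto simp: AE_distr_iff)
    then have "measure (distr M borel (\<lambda>\<omega>. enn2real (cnt B \<omega>))) {real n}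
      = measure (distr (measure_pmf (poisson_pmf l)) borel real) {real n}" by simp
    moreover have "real -` {real n} = {n}" by auto
    moreover have "prob {\<omega> \<in> space M. cnt B \<omega> = of_nat n} = prob ((\<lambda>\<omega>. enn2real (cnt B \<omega>)) -` {real n} \<inter> space M)"
      by (rule measure_eq_AE) (use fin in \<open>auto elim!: eventually_mono simp: real_iff\<close>)
    ultimately show ?thesis
      using l by (simp add: measure_distr measure_pmf_single l_def)
  qed
qed

text \<open>Counts are integers or infinite. Along increasing windows they are eventually constant
  if the limit is finite and eventually exceed \<open>n\<close> otherwise, so the indicators of the
  events converge pointwise.\<close>

lemma prob_cnt_tendsto:
  assumes B: "B \<in> sets borel" "B \<subseteq> {0<..}"
  shows "(\<lambda>j. prob {\<omega> \<in> space M. cnt (B \<inter> window j) \<omega> = of_nat n}) \<longlonglongrightarrow> prob {\<omega> \<in> space M. cnt B \<omega> = of_nat n}"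
proof -
  have Bj: "B \<inter> window j \<in> sets borel" "B \<inter> window j \<subseteq> {0<..}" for j using B by auto
  note [measurable] = cnt_measurable[OF B] cnt_measurable[OF Bj]
  have "(\<lambda>j. expectation (indicator {\<omega> \<in> space M. cnt (B \<inter> window j) \<omega> = of_nat n}))
    \<longlonglongrightarrow> (expectation (indicator {\<omega> \<in> space M. cnt B \<omega> = of_nat n}) :: real)"
  proof (rule integral_dominated_convergence[where w = "\<lambda>_. 1"])
    have "(\<lambda>j. indicator {\<omega> \<in> space M. cnt (B \<inter> window j) \<omega> = of_nat n} \<omega> :: real)
      \<longlonglongrightarrow> indicator {\<omega> \<in> space M. cnt B \<omega> = of_nat n} \<omega>" for \<omega>
    proof -
      have lim: "(\<lambda>j. cnt (B \<inter> window j) \<omega>) \<longlonglongrightarrow> cnt B \<omega>"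
        using npoints_incseq[OF incseq_Int_window, of "X \<omega>" B] by (simp only: UN_Int_window[OF B(2)] cnt_def)
      have le: "cnt (B \<inter> window j) \<omega> \<le> cnt B \<omega>" for j
        unfolding cnt_def by (intro npoints_mono) auto
      have ev: "\<forall>\<^sub>F j in sequentially. (cnt (B \<inter> window j) \<omega> = of_nat n) = (cnt B \<omega> = of_nat n)"
      proof (cases "finite (X \<omega> \<inter> B)")
        case True
        define k where "k = card (X \<omega> \<inter> B)"
        have k: "cnt B \<omega> = of_nat k" using True by (simp add: cnt_def npoints_def k_def)
        have "\<forall>\<^sub>F j in sequentially. cnt (B \<inter> window j) \<omega> = of_nat k"
        proof (cases k)
          case 0
          then show ?thesis using le k by simp
        next
          case (Suc i)
          have "(of_nat i :: ennreal) < cnt B \<omega>"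
            unfolding k Suc by (simp add: ennreal_of_nat_eq_real_of_nat ennreal_less_iff del: of_nat_Suc)
          from order_tendstoD(1)[OF lim this] show ?thesis
          proof eventually_elim
            case (elim j)
            have "finite (X \<omega> \<inter> (B \<inter> window j))" using True by (rule finite_subset[rotated]) auto
            then obtain i' where i': "cnt (B \<inter> window j) \<omega> = of_nat i'" by (simp add: cnt_def npoints_def)
            with elim le[of j] k Suc have "i < i'" "i' \<le> Suc i"
              by (simp_all add: ennreal_of_nat_eq_real_of_nat ennreal_less_iff del: of_nat_Suc)
            then have "i' = Suc i" by simp
            then show ?case using i' Suc by simp
          qed
        qed
        then show ?thesis by eventually_elim (simp add: k)
      next
        case False
        then have "cnt B \<omega> = \<infinity>" by (simp add: cnt_def npoints_def)
        then have "of_nat n < cnt B \<omega>" by (simp add: ennreal_of_nat_eq_real_of_nat)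
        from order_tendstoD(1)[OF lim this] show ?thesis
          by eventually_elim (use \<open>of_nat n < cnt B \<omega>\<close> in auto)
      qed
      then show ?thesis
        by (intro tendsto_eventually) (auto elim!: eventually_mono simp: indicator_def)
    qed
    then show "AE \<omega> in M. (\<lambda>j. indicator {\<omega> \<in> space M. cnt (B \<inter> window j) \<omega> = of_nat n} \<omega> :: real)
      \<longlonglongrightarrow> indicator {\<omega> \<in> space M. cnt B \<omega> = of_nat n} \<omega>" by simp
  qed (auto simp: indicator_def)
  then show ?thesis by simp
qed

lemma emeasure_Int_window_tendsto:
  assumes B: "B \<in> sets borel" "B \<subseteq> {0<..}"
  shows "(\<lambda>j. emeasure \<mu> (B \<inter> window j)) \<longlonglongrightarrow> emeasure \<mu> B"
proof -
  have "range (\<lambda>j. B \<inter> window j) \<subseteq> sets \<mu>" using B by auto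
  from Lim_emeasure_incseq[OF this incseq_Int_window] show ?thesis by (simp only: UN_Int_window[OF B(2)])
qed

text \<open>Passes from bounded to arbitrary Borel sets. The space is a completion from the start,
  as the definition of a Poisson process refers to completed events.\<close>

lemma poisson_point_process:
  assumes sub: "\<And>\<omega>. \<omega> \<in> space M \<Longrightarrow> X \<omega> \<subseteq> {0<..}"
    and N: "M = completion N"
  shows "poisson_point_process N X \<mu>"
proof -
  have AE_iff: "(AE \<omega> in N. P \<omega>) \<longleftrightarrow> (AE \<omega> in M. P \<omega>)" for P
    unfolding N by (rule AE_completion_iff[symmetric])
  have sp: "space N = space M" by (simp add: N)
  have bd: "B \<inter> window j \<in> bounded_sets" if "B \<in> sets borel" for B j
    using that by (rule window_bounded)
  show ?thesis
    unfolding poisson_point_process_def simple_point_process_def AE_iff sp N[symmetric] cnt_def[symmetric]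
  proof (intro conjI ballI impI allI)
    show "X \<in> M \<rightarrow>\<^sub>M point_configs"
      unfolding measurable_point_configs_iff cnt_def[symmetric] using cnt_measurable by auto
    show "AE \<omega> in M. X \<omega> \<subseteq> {0<..} \<and> (\<forall>a b. 0 < a \<longrightarrow> finite (X \<omega> \<inter> {a..b}))"
      using AE_locally_finite AE_space by eventually_elim (use sub in auto)
    fix B :: "real set" assume B: "B \<in> sets borel"
    {
      fix n :: nat assume B': "B \<subseteq> {0<..} \<and> emeasure \<mu> B < \<infinity>"
      have "(\<lambda>j. measure \<mu> (B \<inter> window j)) \<longlonglongrightarrow> measure \<mu> B"
        unfolding measure_def using emeasure_Int_window_tendsto[of B] B B'
        by (intro tendsto_enn2real) auto
      then have "(\<lambda>j. measure \<mu> (B \<inter> window j) ^ n / fact n * exp (- measure \<mu> (B \<inter> window j)))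
        \<longlonglongrightarrow> measure \<mu> B ^ n / fact n * exp (- measure \<mu> B)"
        by (intro tendsto_intros) auto
      then show "prob {\<omega> \<in> space M. cnt B \<omega> = of_nat n} = measure \<mu> B ^ n / fact n * exp (- measure \<mu> B)"
        using prob_cnt_tendsto[of B n] B B' unfolding prob_cnt_bounded[OF bd[OF B]]
        by (auto intro: LIMSEQ_unique)
    next
      assume B': "B \<subseteq> {0<..} \<and> emeasure \<mu> B = \<infinity>"
      have "filterlim (\<lambda>j. measure \<mu> (B \<inter> window j)) at_top sequentially"
      proof -
        have "(\<lambda>j. ennreal (measure \<mu> (B \<inter> window j))) \<longlonglongrightarrow> \<infinity>"
          using emeasure_Int_window_tendsto[of B] B B' emeasure_bounded[OF bd[OF B]]
          by (simp add: emeasure_eq_ennreal_measure[symmetric] less_top)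
        then show ?thesis by (simp add: ennreal_tendsto_top_eq_at_top)
      qed
      \<comment> \<open>Since \<open>x ^ n * exp (- x)\<close> vanishes at infinity, every finite
        value of the count gets probability 0, which leaves the value infinity.\<close>
      then have lim: "(\<lambda>j. measure \<mu> (B \<inter> window j) ^ n / fact n * exp (- measure \<mu> (B \<inter> window j))) \<longlonglongrightarrow> 0" for n
      proof -
        have "(\<lambda>j. measure \<mu> (B \<inter> window j) ^ n / exp (measure \<mu> (B \<inter> window j))) \<longlonglongrightarrow> 0"
          by (rule filterlim_compose[OF tendsto_power_div_exp_0]) fact
        from tendsto_mult_right_zero[OF this, of "inverse (fact n)"] show ?thesis
          by (simp add: exp_minus divide_inverse mult_ac)
      qed
      have meas: "cnt B \<in> borel_measurable M" using B B' by (intro cnt_measurable) auto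
      have "prob {\<omega> \<in> space M. cnt B \<omega> = of_nat n} = 0" for n
        using prob_cnt_tendsto[of B n] lim[of n] B B' unfolding prob_cnt_bounded[OF bd[OF B]]
        by (auto intro: LIMSEQ_unique)
      then have "AE \<omega> in M. cnt B \<omega> \<noteq> of_nat n" for n
        using meas by (subst (asm) prob_Collect_eq_0) auto
      then have "AE \<omega> in M. \<forall>n. cnt B \<omega> \<noteq> of_nat n" by (simp add: AE_all_countable)
      then show "AE \<omega> in M. cnt B \<omega> = \<infinity>"
        by eventually_elim (metis cnt_def npoints_cases)
    }
  next
    fix n :: nat and B :: "nat \<Rightarrow> real set"
    assume "(\<forall>i<n. B i \<in> sets borel \<and> B i \<subseteq> {0<..}) \<and> disjoint_family_on B {..<n}"
    then show "indep_vars (\<lambda>_. borel) (\<lambda>i \<omega>. cnt (B i) \<omega>) {..<n}"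
      using indep_cnt[of "{..<n}" B] by auto
  qed
qed

end

lemma one_le_npoints: "A \<inter> B \<noteq> {} \<Longrightarrow> 1 \<le> npoints A B"
proof (cases rule: npoints_cases[of A B])
  case (fin n)
  assume "A \<inter> B \<noteq> {}"
  then have "n \<noteq> 0" using npoints_empty_iff[of A B] fin by (intro notI) simp
  then have "(of_nat 1 :: ennreal) \<le> of_nat n" by (intro of_nat_mono) simp
  then show ?thesis using fin by simp
qed simp

section \<open>From intervals to Borel sets\<close>

text \<open>Void probabilities are assumed only for unions of cells of a single grid, which is what
  independent increments deliver. Completeness lets events be altered on null sets.\<close>

locale interval_void_process = prob_space + complete_measure +
  fixes X :: "'a \<Rightarrow> real set" and \<theta> :: real
  assumes theta_nonneg: "0 \<le> \<theta>"
    and cells_sets: "\<And>a b m S. 0 < a \<Longrightarrow> a < b \<Longrightarrow> S \<subseteq> {..<m} \<Longrightarrow>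
      {\<omega> \<in> space M. \<forall>i\<in>S. X \<omega> \<inter> cell a b m i = {}} \<in> events"
    and cells_prob: "\<And>a b m S. 0 < a \<Longrightarrow> a < b \<Longrightarrow> S \<subseteq> {..<m} \<Longrightarrow>
      prob {\<omega> \<in> space M. \<forall>i\<in>S. X \<omega> \<inter> cell a b m i = {}} = exp (- (\<Sum>i\<in>S. measure (scale_intensity \<theta>) (cell a b m i)))"
begin

abbreviation "\<mu> \<equiv> scale_intensity \<theta>"

context
  fixes a b :: real
  assumes ab: "0 < a" "a < b"
begin

lemma cell_intensity: "measure \<mu> (cell a b m i) \<le> \<theta> / a * ((b - a) / real m)"
proof -
  have "emeasure \<mu> (cell a b m i) \<le> ennreal (\<theta> / a * (grid a b m (Suc i) - grid a b m i))"
  proof (rule scale_intensity_le_length)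
    show "cell a b m i \<subseteq> {a<..}"
      using grid_le[OF ab(2), of 0 i m] by (auto simp: cell_def grid_0)
  qed (use ab theta_nonneg grid_le[OF ab(2), of i "Suc i" m] in \<open>auto simp: cell_def\<close>)
  then show ?thesis
    using ab theta_nonneg by (auto simp: grid_Suc_diff measure_def intro!: enn2real_leI)
qed

lemma cell_emeasure_finite: "i < m \<Longrightarrow> emeasure \<mu> (cell a b m i) \<noteq> \<infinity>"
  using scale_intensity_bounded[OF _ cell_subset[OF ab(2), of i m] ab(1) theta_nonneg] by (simp add: less_top)

lemma sum_cell_intensity:
  assumes "S \<subseteq> {..<m}"
  shows "measure \<mu> (\<Union>i\<in>S. cell a b m i) = (\<Sum>i\<in>S. measure \<mu> (cell a b m i))"
proof (rule measure_finite_Union)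
  show "disjoint_family_on (cell a b m) S"
    using disjoint_cell[OF ab(2)] by (auto simp: disjoint_family_on_def)
qed (use assms cell_emeasure_finite in \<open>auto intro: finite_subset\<close>)

lemma sum_cell_intensity_tendsto: "(\<lambda>m. \<Sum>i<m. measure \<mu> (cell a b m i)) \<longlonglongrightarrow> measure \<mu> {a<..b}"
proof (rule tendsto_eventually)
  show "\<forall>\<^sub>F m in sequentially. (\<Sum>i<m. measure \<mu> (cell a b m i)) = measure \<mu> {a<..b}"
    using eventually_gt_at_top[of 0]
    by eventually_elim (simp add: sum_cell_intensity[OF order_refl, symmetric] UN_cell ab)
qed

lemma ncells_measurable: "(\<lambda>\<omega>. of_nat (ncells a b m (X \<omega> \<inter> {a<..b})) :: ennreal) \<in> borel_measurable M"
  and nn_integral_ncells: "(\<integral>\<^sup>+\<omega>. of_nat (ncells a b m (X \<omega> \<inter> {a<..b})) \<partial>M)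
    = ennreal (\<Sum>i<m. 1 - exp (- measure \<mu> (cell a b m i)))"
proof -
  define V where "V i = {\<omega> \<in> space M. X \<omega> \<inter> cell a b m i = {}}" for i
  have V: "V i \<in> events" "prob (V i) = exp (- measure \<mu> (cell a b m i))" if "i < m" for i
    using cells_sets[OF ab, of "{i}" m] cells_prob[OF ab, of "{i}" m] that by (auto simp: V_def)
  have eq: "(of_nat (ncells a b m (X \<omega> \<inter> {a<..b})) :: ennreal) = (\<Sum>i<m. indicator (space M - V i) \<omega>)"
    if "\<omega> \<in> space M" for \<omega>
  proof -
    have "X \<omega> \<inter> {a<..b} \<inter> cell a b m i = X \<omega> \<inter> cell a b m i" if "i < m" for i
      using cell_subset[OF ab(2) that] by auto
    then show ?thesis
      unfolding ncells_eq_sum of_nat_sum using that by (intro sum.cong) (auto simp: V_def)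
  qed
  show "(\<lambda>\<omega>. of_nat (ncells a b m (X \<omega> \<inter> {a<..b})) :: ennreal) \<in> borel_measurable M"
    by (subst measurable_cong[OF eq]) (use V in auto)
  have "(\<integral>\<^sup>+\<omega>. of_nat (ncells a b m (X \<omega> \<inter> {a<..b})) \<partial>M) = (\<integral>\<^sup>+\<omega>. (\<Sum>i<m. indicator (space M - V i) \<omega>) \<partial>M)"
    by (intro nn_integral_cong eq)
  also have "\<dots> = (\<Sum>i<m. emeasure M (space M - V i))"
    using V by (subst nn_integral_sum) auto
  also have "\<dots> = (\<Sum>i<m. ennreal (1 - exp (- measure \<mu> (cell a b m i))))"
    by (intro sum.cong) (auto simp: emeasure_eq_measure prob_compl V)
  finally show "(\<integral>\<^sup>+\<omega>. of_nat (ncells a b m (X \<omega> \<inter> {a<..b})) \<partial>M)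
    = ennreal (\<Sum>i<m. 1 - exp (- measure \<mu> (cell a b m i)))" by (simp add: sum_ennreal)
qed

lemma npoints_Ioc_measurable: "(\<lambda>\<omega>. npoints (X \<omega>) {a<..b}) \<in> borel_measurable M"
  by (rule borel_measurable_LIMSEQ_order[OF _ ncells_measurable]) (rule ncells_tendsto_npoints[OF ab(2) order_refl])

lemma nn_integral_npoints_Ioc: "(\<integral>\<^sup>+\<omega>. npoints (X \<omega>) {a<..b} \<partial>M) = emeasure \<mu> {a<..b}"
proof -
  have "(\<lambda>m. \<Sum>i<m. 1 - exp (- measure \<mu> (cell a b m i))) \<longlonglongrightarrow> measure \<mu> {a<..b}"
    by (rule sum_one_minus_exp_tendsto[OF _ cell_intensity _ sum_cell_intensity_tendsto])
      (use lim_const_over_n[of "\<theta> / a * (b - a)"] in auto)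
  then have lim: "(\<lambda>m. \<integral>\<^sup>+\<omega>. of_nat (ncells a b m (X \<omega> \<inter> {a<..b})) \<partial>M) \<longlonglongrightarrow> ennreal (measure \<mu> {a<..b})"
    unfolding nn_integral_ncells by (rule tendsto_ennrealI)
  from ncells_measurable lim have "(\<integral>\<^sup>+\<omega>. npoints (X \<omega>) {a<..b} \<partial>M) = ennreal (measure \<mu> {a<..b})"
    by (rule nn_integral_npoints_eq_limit[OF ab(2) order_refl])
  also have "\<dots> = emeasure \<mu> {a<..b}"
    using scale_intensity_bounded[of "{a<..b}" a b \<theta>] ab theta_nonneg
    by (intro emeasure_eq_ennreal_measure[symmetric]) auto
  finally show ?thesis .
qed

lemma AE_finite_Ioc: "AE \<omega> in M. finite (X \<omega> \<inter> {a<..b})"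
proof -
  have "AE \<omega> in M. npoints (X \<omega>) {a<..b} \<noteq> \<infinity>"
    using nn_integral_npoints_Ioc scale_intensity_bounded[of "{a<..b}" a b \<theta>] ab theta_nonneg
    by (intro nn_integral_PInf_AE npoints_Ioc_measurable) auto
  then show ?thesis
    by eventually_elim (simp add: less_top npoints_finite_iff[symmetric])
qed

end

section \<open>Extension of void probabilities from cells to open sets and Borel sets\<close>

context
  fixes a b :: real
  assumes ab: "0 < a" "a < b"
begin

text \<open>Set to zero on the null event of infinitely many points, so that the mass is always
  finite and measures of complements are differences.\<close>

definition point_measure :: "'a \<Rightarrow> real measure" where
  "point_measure \<omega> = (if finite (X \<omega> \<inter> {a<..b}) then distr (count_space (X \<omega> \<inter> {a<..b})) borel id else null_measure borel)"

lemma sets_point_measure: "sets (point_measure \<omega>) = sets borel"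
  by (simp add: point_measure_def)

lemma emeasure_point_measure:
  "B \<in> sets borel \<Longrightarrow> emeasure (point_measure \<omega>) B = (if finite (X \<omega> \<inter> {a<..b}) then npoints (X \<omega>) (B \<inter> {a<..b}) else 0)"
proof (cases "finite (X \<omega> \<inter> {a<..b})")
  case True
  assume "B \<in> sets borel"
  moreover have "B \<inter> (X \<omega> \<inter> {a<..b}) = X \<omega> \<inter> (B \<inter> {a<..b})" by auto
  moreover have "finite (X \<omega> \<inter> (B \<inter> {a<..b}))" using True by (rule finite_subset[rotated]) auto
  moreover have "X \<omega> \<inter> (B \<inter> {a<..b}) \<subseteq> X \<omega> \<inter> {a<..b}" by auto
  ultimately show ?thesis
    using True by (simp add: point_measure_def emeasure_distr npoints_def emeasure_count_space_finite)
qed (simp add: point_measure_def)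

lemma finite_Ioc_sets: "{\<omega> \<in> space M. finite (X \<omega> \<inter> {a<..b})} \<in> events"
proof -
  have "{\<omega> \<in> space M. npoints (X \<omega>) {a<..b} < \<top>} \<in> events"
    using npoints_Ioc_measurable[OF ab] by measurable
  then show ?thesis by (simp only: npoints_finite_iff)
qed

text \<open>A Dynkin argument over intervals, whose counts are limits of cell counts. Complements go
  through because the random measures are finite.\<close>

lemma emeasure_point_measure_measurable:
  assumes "B \<in> sets borel"
  shows "(\<lambda>\<omega>. emeasure (point_measure \<omega>) B) \<in> borel_measurable M"
proof -
  define G where "G = range (\<lambda>(c, d). {c<..d::real})"
  have G: "sets borel = sigma_sets UNIV G"
    by (simp add: G_def borel_sigma_sets_Ioc)
  have "Int_stable G"
  proof (rule Int_stableI)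
    fix A B assume "A \<in> G" "B \<in> G"
    then obtain c d c' d' where "A = {c<..d}" "B = {c'<..d'}" by (auto simp: G_def)
    then have "A \<inter> B = {max c c'<..min d d'}" by auto
    then show "A \<inter> B \<in> G" by (auto simp: G_def)
  qed
  have borel_Ioc: "{c<..d} \<in> sets borel" for c d :: real by simp
  have interval: "(\<lambda>\<omega>. emeasure (point_measure \<omega>) {c<..d}) \<in> borel_measurable M" for c d
  proof -
    have n: "(\<lambda>\<omega>. npoints (X \<omega>) ({c<..d} \<inter> {a<..b})) \<in> borel_measurable M"
    proof (cases "max c a < min d b")
      case True
      have eq: "{c<..d} \<inter> {a<..b} = {max c a<..min d b}" by auto
      show ?thesis unfolding eq by (rule npoints_Ioc_measurable) (use True ab in auto)
    next
      case False
      then have eq: "{c<..d} \<inter> {a<..b} = {}" by auto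
      show ?thesis unfolding eq by (simp add: npoints_def)
    qed
    show ?thesis
      unfolding emeasure_point_measure[OF borel_Ioc]
      by (rule measurable_If[OF n measurable_const finite_Ioc_sets]) simp
  qed
  have "G \<subseteq> Pow UNIV" by simp
  from \<open>Int_stable G\<close> this assms[unfolded G] show ?thesis
  proof (induction rule: sigma_sets_induct_disjoint)
    case (basic A)
    then show ?case using interval by (auto simp: G_def)
  next
    case empty
    then show ?case by simp
  next
    case (compl A)
    have A: "A \<in> sets borel" using compl by (simp add: G)
    have "emeasure (point_measure \<omega>) (UNIV - A) = emeasure (point_measure \<omega>) UNIV - emeasure (point_measure \<omega>) A" for \<omega>
    proof -
      have "finite (X \<omega> \<inter> {a<..b}) \<Longrightarrow> finite (X \<omega> \<inter> (A \<inter> {a<..b}))"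
        by (erule finite_subset[rotated]) auto
      then have "emeasure (point_measure \<omega>) A \<noteq> \<infinity>"
        using A by (auto simp: emeasure_point_measure npoints_def)
      then show ?thesis
        using A by (intro emeasure_Diff) (auto simp: sets_point_measure)
    qed
    moreover have "(\<lambda>\<omega>. emeasure (point_measure \<omega>) UNIV) \<in> borel_measurable M"
    proof -
      have "emeasure (point_measure \<omega>) UNIV = emeasure (point_measure \<omega>) {a<..b}" for \<omega>
        by (simp add: emeasure_point_measure)
      then show ?thesis using interval by simp
    qed
    ultimately show ?case using compl by simp
  next
    case (union A)
    have A: "range A \<subseteq> sets borel" using union by (auto simp: G)
    have "emeasure (point_measure \<omega>) (\<Union>i. A i) = (\<Sum>i. emeasure (point_measure \<omega>) (A i))" for \<omega>
      using A union(1) by (intro suminf_emeasure[symmetric]) (auto simp: sets_point_measure)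
    then show ?case using union by simp
  qed
qed

definition mean_points :: "real measure" where
  "mean_points = mean_measure M borel point_measure"

lemma sets_mean_points [simp, measurable_cong]: "sets mean_points = sets borel"
  by (simp add: mean_points_def)

lemma emeasure_mean_points:
  "B \<in> sets borel \<Longrightarrow> emeasure mean_points B = (\<integral>\<^sup>+\<omega>. emeasure (point_measure \<omega>) B \<partial>M)"
  unfolding mean_points_def
  by (rule emeasure_mean_measure) (auto simp: sets_point_measure emeasure_point_measure_measurable)

lemma AE_emeasure_point_measure:
  "B \<in> sets borel \<Longrightarrow> AE \<omega> in M. emeasure (point_measure \<omega>) B = npoints (X \<omega>) (B \<inter> {a<..b})"
  using AE_finite_Ioc[OF ab] by eventually_elim (simp add: emeasure_point_measure)

lemma emeasure_mean_points_eq: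
  assumes B: "B \<in> sets borel"
  shows "emeasure mean_points B = emeasure \<mu> (B \<inter> {a<..b})"
proof -
  have D: "emeasure (density \<mu> (indicator {a<..b})) A = emeasure \<mu> (A \<inter> {a<..b})" if "A \<in> sets borel" for A
    using that by (subst emeasure_density) (auto simp: indicator_inter_arith[symmetric] mult.commute Int_commute)
  have "mean_points = density \<mu> (indicator {a<..b})"
  proof (rule measure_eqI_lessThan)
    fix c :: real
    have "emeasure mean_points {c<..} = (\<integral>\<^sup>+\<omega>. npoints (X \<omega>) ({c<..} \<inter> {a<..b}) \<partial>M)"
      unfolding emeasure_mean_points[of "{c<..}", simplified]
      by (intro nn_integral_cong_AE AE_emeasure_point_measure) auto
    also have "\<dots> = emeasure \<mu> ({c<..} \<inter> {a<..b})"
    proof (cases "max c a < b")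
      case True
      have "{c<..} \<inter> {a<..b} = {max c a<..b}" by auto
      then show ?thesis using nn_integral_npoints_Ioc[of "max c a" b] True ab by auto
    next
      case False
      then have "{c<..} \<inter> {a<..b} = {}" by auto
      then show ?thesis by (simp add: npoints_def)
    qed
    finally show eq: "emeasure mean_points {c<..} = emeasure (density \<mu> (indicator {a<..b})) {c<..}"
      by (simp add: D)
    have "emeasure \<mu> ({c<..} \<inter> {a<..b}) < \<infinity>"
      by (rule scale_intensity_bounded[of _ a b]) (use ab theta_nonneg in auto)
    then show "emeasure mean_points {c<..} < \<infinity>" by (simp add: eq D)
  qed auto
  then show ?thesis using B by (simp add: D)
qed

lemma finite_mean_points: "finite_measure mean_points"
proof
  have "emeasure \<mu> {a<..b} < \<infinity>"
    by (rule scale_intensity_bounded[of _ a b]) (use ab theta_nonneg in auto)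
  then show "emeasure mean_points (space mean_points) \<noteq> \<infinity>"
    by (simp add: mean_points_def emeasure_mean_points_eq[unfolded mean_points_def])
qed

lemma void_Borel_sets:
  assumes B: "B \<in> sets borel"
  shows "{\<omega> \<in> space M. X \<omega> \<inter> (B \<inter> {a<..b}) = {}} \<in> events"
proof -
  have "{\<omega> \<in> space M. emeasure (point_measure \<omega>) B = 0} \<in> events"
    using emeasure_point_measure_measurable[OF B] by measurable
  then show ?thesis
  proof (rule in_sets_AE[rotated])
    show "AE \<omega> in M. (\<omega> \<in> {\<omega> \<in> space M. emeasure (point_measure \<omega>) B = 0}) = (\<omega> \<in> {\<omega> \<in> space M. X \<omega> \<inter> (B \<inter> {a<..b}) = {}})"
      using AE_emeasure_point_measure[OF B] by eventually_elim (auto simp: npoints_empty_iff)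
  qed auto
qed

text \<open>The cells contained in \<open>U\<close> eventually cover each point of \<open>U\<close>
  in the interval. Their unions \<open>C m\<close> need not increase with \<open>m\<close>, so both
  sides pass to the limit by dominated convergence.\<close>

lemma prob_void_open:
  assumes U: "open U"
  shows "prob {\<omega> \<in> space M. X \<omega> \<inter> (U \<inter> {a<..b}) = {}} = exp (- measure mean_points U)"
proof -
  interpret mp: finite_measure mean_points by (rule finite_mean_points)
  define S where "S m = {i. i < m \<and> cell a b m i \<subseteq> U}" for m
  have S: "S m \<subseteq> {..<m}" for m by (auto simp: S_def)
  have cover: "\<forall>\<^sub>F m in sequentially. \<exists>i\<in>S m. x \<in> cell a b m i" if x: "x \<in> U" "x \<in> {a<..b}" for x
  proof -
    obtain e where e: "0 < e" "ball x e \<subseteq> U" using U x(1) by (auto simp: open_contains_ball)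
    from cell_eventually_small[OF e(1), of a b] eventually_gt_at_top[of 0] show ?thesis
    proof eventually_elim
      case (elim m)
      obtain i where i: "i < m" "x \<in> cell a b m i" using UN_cell[OF ab(2) \<open>0 < m\<close>] x(2) by blast
      have "cell a b m i \<subseteq> ball x e"
        using elim(1) i(2) by (auto simp: ball_def dist_real_def)
      then show ?case using e(2) i by (auto simp: S_def)
    qed
  qed
  define V where "V m = {\<omega> \<in> space M. \<forall>i\<in>S m. X \<omega> \<inter> cell a b m i = {}}" for m
  define C where "C m = (\<Union>i\<in>S m. cell a b m i)" for m
  have V: "V m \<in> events" "prob (V m) = exp (- measure mean_points (C m))" for m
  proof -
    have Cab: "C m \<inter> {a<..b} = C m" using cell_subset[OF ab(2)] by (fastforce simp: C_def S_def)
    have "C m \<in> sets borel" using S[of m] unfolding C_def by (intro sets.finite_UN) (auto intro: finite_subset)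
    then have "measure mean_points (C m) = measure \<mu> (C m)"
      by (simp add: measure_def emeasure_mean_points_eq Cab)
    then show "V m \<in> events" "prob (V m) = exp (- measure mean_points (C m))"
      unfolding V_def cells_prob[OF ab S]
      using cells_sets[OF ab S] sum_cell_intensity[OF ab S] by (auto simp: C_def)
  qed
  have Cm: "C m \<in> sets borel" for m
    using S[of m] unfolding C_def by (intro sets.finite_UN) (auto intro: finite_subset)
  have Vlim: "(\<lambda>m. prob (V m)) \<longlonglongrightarrow> prob {\<omega> \<in> space M. X \<omega> \<inter> (U \<inter> {a<..b}) = {}}"
  proof -
    have "(\<lambda>m. expectation (indicator (V m))) \<longlonglongrightarrow> (expectation (indicator {\<omega> \<in> space M. X \<omega> \<inter> (U \<inter> {a<..b}) = {}}) :: real)"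
    proof (rule integral_dominated_convergence[where w = "\<lambda>_. 1"])
      have ev: "\<forall>\<^sub>F m in sequentially. (\<omega> \<in> V m) = (X \<omega> \<inter> (U \<inter> {a<..b}) = {})" if "\<omega> \<in> space M" for \<omega>
      proof (cases "X \<omega> \<inter> (U \<inter> {a<..b}) = {}")
        case True
        have "\<omega> \<in> V m" for m
          using True that cell_subset[OF ab(2), of _ m] unfolding V_def S_def by blast
        then show ?thesis using True by simp
      next
        case False
        then obtain x where x: "x \<in> X \<omega>" "x \<in> U" "x \<in> {a<..b}" by blast
        from cover[OF x(2,3)] show ?thesis
          by eventually_elim (use x False in \<open>auto simp: V_def\<close>)
      qed
      have "(\<lambda>m. indicator (V m) \<omega> :: real) \<longlonglongrightarrow> indicator {\<omega> \<in> space M. X \<omega> \<inter> (U \<inter> {a<..b}) = {}} \<omega>"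
        if "\<omega> \<in> space M" for \<omega>
      proof -
        from ev[OF that] have "\<forall>\<^sub>F m in sequentially. (indicator (V m) \<omega> :: real) = indicator {\<omega> \<in> space M. X \<omega> \<inter> (U \<inter> {a<..b}) = {}} \<omega>"
          by eventually_elim (use that in \<open>auto simp: indicator_def\<close>)
        then show ?thesis by (rule tendsto_eventually)
      qed
      then show "AE \<omega> in M. (\<lambda>m. indicator (V m) \<omega> :: real) \<longlonglongrightarrow> indicator {\<omega> \<in> space M. X \<omega> \<inter> (U \<inter> {a<..b}) = {}} \<omega>"
        by (rule AE_I2)
    qed (use V void_Borel_sets[OF borel_open[OF U]] in \<open>auto simp: indicator_def\<close>)
    then show ?thesis using V void_Borel_sets[OF borel_open[OF U]] by simp
  qed
  have Clim: "(\<lambda>m. measure mean_points (C m)) \<longlonglongrightarrow> measure mean_points (U \<inter> {a<..b})"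
  proof -
    have "(\<lambda>m. \<integral>x. indicator (C m) x \<partial>mean_points) \<longlonglongrightarrow> (\<integral>x. indicator (U \<inter> {a<..b}) x \<partial>mean_points :: real)"
    proof (rule integral_dominated_convergence[where w = "\<lambda>_. 1"])
      have ev: "\<forall>\<^sub>F m in sequentially. (x \<in> C m) = (x \<in> U \<inter> {a<..b})" for x
      proof (cases "x \<in> U \<inter> {a<..b}")
        case True
        then have "\<forall>\<^sub>F m in sequentially. \<exists>i\<in>S m. x \<in> cell a b m i" by (intro cover) auto
        then show ?thesis by eventually_elim (use True in \<open>auto simp: C_def\<close>)
      next
        case False
        have "x \<notin> C m" for m using False cell_subset[OF ab(2), of _ m] unfolding C_def S_def by blast
        then show ?thesis using False by simp
      qed
      have "(\<lambda>m. indicator (C m) x :: real) \<longlonglongrightarrow> indicator (U \<inter> {a<..b}) x" for x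
      proof -
        from ev[of x] have "\<forall>\<^sub>F m in sequentially. (indicator (C m) x :: real) = indicator (U \<inter> {a<..b}) x"
          by eventually_elim (auto simp: indicator_def)
        then show ?thesis by (rule tendsto_eventually)
      qed
      then show "AE x in mean_points. (\<lambda>m. indicator (C m) x :: real) \<longlonglongrightarrow> indicator (U \<inter> {a<..b}) x"
        by simp
      show "AE x in mean_points. norm (indicator (C m) x :: real) \<le> 1" for m
        by (simp add: indicator_def)
      have "U \<inter> {a<..b} \<in> sets mean_points" using U by simp
      then show "(\<lambda>x. indicator (U \<inter> {a<..b}) x :: real) \<in> borel_measurable mean_points"
        by (rule borel_measurable_indicator)
    qed (use Cm in auto)
    then show ?thesis by (simp add: mean_points_def)
  qed
  have "measure mean_points (U \<inter> {a<..b}) = measure mean_points U"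
    using U by (simp add: measure_def emeasure_mean_points_eq)
  with Clim have "(\<lambda>m. prob (V m)) \<longlonglongrightarrow> exp (- measure mean_points U)"
    unfolding V by (intro tendsto_exp tendsto_minus) simp
  with Vlim show ?thesis by (rule LIMSEQ_unique)
qed

text \<open>Outer regularity of the mean measure gives an open \<open>U\<close> around
  \<open>B\<close> with little excess. The void events of \<open>B\<close> and \<open>U\<close> then
  differ by a small probability, and so do the two exponentials.\<close>

lemma prob_void_Borel:
  assumes B: "B \<in> sets borel"
  shows "prob {\<omega> \<in> space M. X \<omega> \<inter> (B \<inter> {a<..b}) = {}} = exp (- measure mean_points B)"
proof -
  interpret mp: finite_measure mean_points by (rule finite_mean_points)
  define V where "V A = {\<omega> \<in> space M. X \<omega> \<inter> (A \<inter> {a<..b}) = {}}" for A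
  have Vm: "V A \<in> events" if "A \<in> sets borel" for A
    unfolding V_def using that by (rule void_Borel_sets)
  have "\<bar>prob (V B) - exp (- measure mean_points B)\<bar> \<le> 0"
  proof (rule field_le_epsilon)
    fix e :: real assume e: "0 < e"
    have "emeasure mean_points B < emeasure mean_points B + ennreal (e / 2)"
      using e by (simp add: mp.emeasure_eq_measure ennreal_less_iff flip: ennreal_plus)
    moreover have "(INF U \<in> {U. B \<subseteq> U \<and> open U}. emeasure mean_points U) = emeasure mean_points B"
      by (rule outer_regular[symmetric]) (use B in \<open>simp_all add: mp.emeasure_eq_measure\<close>)
    ultimately have "(INF U \<in> {U. B \<subseteq> U \<and> open U}. emeasure mean_points U) < emeasure mean_points B + ennreal (e / 2)"
      by (simp only:)
    then obtain U where U: "B \<subseteq> U" "open U" "emeasure mean_points U < emeasure mean_points B + ennreal (e / 2)"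
      unfolding INF_less_iff by blast
    have Um: "U \<in> sets borel" using U(2) by simp
    have small: "measure mean_points U < measure mean_points B + e / 2"
      using U(3) e by (simp add: mp.emeasure_eq_measure ennreal_less_iff flip: ennreal_plus)
    have le: "measure mean_points B \<le> measure mean_points U"
      using U(1) Um by (intro mp.finite_measure_mono) auto
    have sub: "V U \<subseteq> V B" using U(1) by (auto simp: V_def)
    have "V B - V U \<in> events" using Vm B Um by auto
    \<comment> \<open>First-moment bound: on this event there is at least one point in
      \<open>U - B\<close>, so its probability is at most the mean number of such points.\<close>
    have "emeasure M (V B - V U) \<le> (\<integral>\<^sup>+\<omega>. emeasure (point_measure \<omega>) (U - B) \<partial>M)"
    proof -
      have "emeasure M (V B - V U) = (\<integral>\<^sup>+\<omega>. indicator (V B - V U) \<omega> \<partial>M)"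
        using \<open>V B - V U \<in> events\<close> by simp
      also have "\<dots> \<le> (\<integral>\<^sup>+\<omega>. emeasure (point_measure \<omega>) (U - B) \<partial>M)"
      proof (rule nn_integral_mono_AE)
        have "U - B \<in> sets borel" using B Um by auto
        from AE_emeasure_point_measure[OF this]
        show "AE \<omega> in M. indicator (V B - V U) \<omega> \<le> emeasure (point_measure \<omega>) (U - B)"
        proof eventually_elim
          case (elim \<omega>)
          show ?case
          proof (cases "\<omega> \<in> V B - V U")
            case True
            then have "X \<omega> \<inter> ((U - B) \<inter> {a<..b}) \<noteq> {}" by (auto simp: V_def)
            then have "1 \<le> npoints (X \<omega>) ((U - B) \<inter> {a<..b})"
              by (rule one_le_npoints)
            then show ?thesis using elim by (simp add: indicator_def)
          qed simp
        qed
      qed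
      finally show ?thesis .
    qed
    also have "\<dots> = emeasure mean_points (U - B)"
      using B Um by (intro emeasure_mean_points[symmetric]) auto
    finally have "prob (V B - V U) \<le> measure mean_points (U - B)"
      by (simp add: emeasure_eq_measure mp.emeasure_eq_measure)
    also have "measure mean_points (U - B) = measure mean_points U - measure mean_points B"
      using U(1) Um B by (intro mp.finite_measure_Diff) auto
    finally have 1: "prob (V B) - prob (V U) \<le> e / 2"
      using finite_measure_Diff[of "V B" "V U"] Vm B Um sub small by auto
    have 2: "prob (V U) \<le> prob (V B)" using sub Vm B by (intro finite_measure_mono) auto
    have 3: "prob (V U) = exp (- measure mean_points U)" unfolding V_def by (rule prob_void_open[OF U(2)])
    have "exp (- measure mean_points B) - exp (- measure mean_points U)
        = exp (- measure mean_points B) * (1 - exp (- (measure mean_points U - measure mean_points B)))"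
      by (simp add: right_diff_distrib mult_exp_exp)
    also have "\<dots> \<le> 1 * (measure mean_points U - measure mean_points B)"
      using le one_minus_exp_bounds(1)[of "measure mean_points U - measure mean_points B"]
      by (intro mult_mono) auto
    finally have 4: "exp (- measure mean_points B) - exp (- measure mean_points U) \<le> e / 2" using small by simp
    have 5: "exp (- measure mean_points U) \<le> exp (- measure mean_points B)" using le by simp
    show "\<bar>prob (V B) - exp (- measure mean_points B)\<bar> \<le> 0 + e"
      using 1 2 3 4 5 by linarith
  qed
  then show ?thesis by (simp add: V_def)
qed

end

lemma void_process: "void_process M X \<theta>"
proof
  fix B :: "real set" and c d assume B: "B \<in> sets borel" "B \<subseteq> {c<..d}" "0 < c"
  \<comment> \<open>The results above need a nonempty interval, while \<open>d\<close> may lie below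
    \<open>c\<close> when \<open>B\<close> is empty.\<close>
  define d' where "d' = max d (c + 1)"
  have d': "c < d'" "B \<inter> {c<..d'} = B" using B by (auto simp: d'_def less_max_iff_disj le_max_iff_disj)
  show "{\<omega> \<in> space M. X \<omega> \<inter> B = {}} \<in> events"
    using void_Borel_sets[OF B(3) d'(1) B(1)] by (simp add: d'(2))
  show "prob {\<omega> \<in> space M. X \<omega> \<inter> B = {}} = exp (- measure \<mu> B)"
    using prob_void_Borel[OF B(3) d'(1) B(1)] emeasure_mean_points_eq[OF B(3) d'(1) B(1)]
    by (simp add: d'(2) measure_def)
qed (rule theta_nonneg)

end

section \<open>Frullani integrals of the key function\<close>

lemma nn_integral_exp_half_line:
  fixes s :: real
  assumes "0 < s"
  shows "(\<integral>\<^sup>+y. ennreal (exp (- s * y)) * indicator {0..} y \<partial>lborel) = ennreal (1 / s)"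
proof -
  have "(\<integral>\<^sup>+y. ennreal (exp (- s * y)) * indicator {0..} y \<partial>lborel) = ennreal (0 - (- exp (- s * 0) / s))"
  proof (rule nn_integral_FTC_atLeast)
    show "((\<lambda>y. - exp (- s * y) / s) has_real_derivative exp (- s * y)) (at y)" for y
      using assms by (auto intro!: derivative_eq_intros)
    have "((\<lambda>y. exp (- s * y)) \<longlongrightarrow> 0) at_top"
      using assms
      by (intro filterlim_compose[OF exp_at_bot] filterlim_tendsto_neg_mult_at_bot[OF tendsto_const _ filterlim_ident]) auto
    from tendsto_divide[OF tendsto_minus[OF this] tendsto_const[of s]] assms
    show "((\<lambda>y. - exp (- s * y) / s) \<longlongrightarrow> 0) at_top" by simp
  qed auto
  then show ?thesis by simp
qed

lemma nn_integral_exp_interval: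
  fixes a b y :: real
  assumes "0 < y" "a \<le> b"
  shows "(\<integral>\<^sup>+s. ennreal (exp (- s * y)) * indicator {a..b} s \<partial>lborel) = ennreal ((exp (- a * y) - exp (- b * y)) / y)"
proof -
  have "(\<integral>\<^sup>+s. ennreal (exp (- s * y)) * indicator {a..b} s \<partial>lborel) = ennreal (- exp (- b * y) / y - (- exp (- a * y) / y))"
    using assms by (intro nn_integral_FTC_Icc) (auto intro!: derivative_eq_intros)
  then show ?thesis by (simp add: diff_divide_distrib)
qed

text \<open>The integrand is the integral of \<open>exp (- s * y)\<close> over \<open>s\<close> from
  \<open>a\<close> to \<open>b\<close>; Fubini leaves the integral of \<open>1 / s\<close>.\<close>

lemma frullani_exp:
  fixes a b :: real
  assumes "0 < a" "a < b"
  shows "(\<integral>\<^sup>+y. ennreal ((exp (- a * y) - exp (- b * y)) / y) * indicator {0<..} y \<partial>lborel) = ennreal (ln (b / a))"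
proof -
  let ?f = "\<lambda>(y::real) (s::real). ennreal (exp (- s * y)) * indicator {0<..} y * indicator {a..b} s"
  have "(\<integral>\<^sup>+y. ennreal ((exp (- a * y) - exp (- b * y)) / y) * indicator {0<..} y \<partial>lborel)
    = (\<integral>\<^sup>+y. \<integral>\<^sup>+s. ?f y s \<partial>lborel \<partial>lborel)"
  proof (rule nn_integral_cong)
    fix y :: real
    show "ennreal ((exp (- a * y) - exp (- b * y)) / y) * indicator {0<..} y = (\<integral>\<^sup>+s. ?f y s \<partial>lborel)"
      using nn_integral_exp_interval[of y a b] assms by (cases "0 < y") auto
  qed
  also have "\<dots> = (\<integral>\<^sup>+s. \<integral>\<^sup>+y. ?f y s \<partial>lborel \<partial>lborel)"
    by (rule lborel_pair.Fubini') measurable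
  also have "\<dots> = (\<integral>\<^sup>+s. ennreal (1 / s) * indicator {a..b} s \<partial>lborel)"
  proof (rule nn_integral_cong)
    fix s :: real
    show "(\<integral>\<^sup>+y. ?f y s \<partial>lborel) = ennreal (1 / s) * indicator {a..b} s"
    proof (cases "s \<in> {a..b}")
      case True
      have "(\<integral>\<^sup>+y. ?f y s \<partial>lborel) = (\<integral>\<^sup>+y. ennreal (exp (- s * y)) * indicator {0..} y \<partial>lborel)"
        using AE_lborel_singleton[of 0] True
        by (intro nn_integral_cong_AE) (auto elim!: eventually_mono simp: indicator_def)
      then show ?thesis using nn_integral_exp_half_line[of s] True assms by simp
    qed simp
  qed
  also have "\<dots> = ennreal (ln b - ln a)"
    using assms by (intro nn_integral_FTC_Icc) (auto intro!: derivative_eq_intros)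
  finally show ?thesis using assms by (simp add: ln_div)
qed

locale key_fun =
  fixes k :: "real \<Rightarrow> real" and \<theta> :: real
  assumes k_nonneg: "\<And>x. 0 < x \<Longrightarrow> 0 \<le> k x"
    and k_antimono: "antimono_on {0<..} k"
    and k_integrable: "set_integrable lborel {0<..} (\<lambda>x. min x 1 * (k x / x))"
    and k_zero: "(k \<longlongrightarrow> \<theta>) (at_right 0)"
begin

lemma k_mono: "0 < x \<Longrightarrow> x \<le> y \<Longrightarrow> k y \<le> k x"
  using k_antimono by (auto simp: monotone_on_def)

lemma k_le_theta:
  assumes "0 < x"
  shows "k x \<le> \<theta>"
proof (rule tendsto_lowerbound[OF k_zero])
  show "\<forall>\<^sub>F y in at_right 0. k x \<le> k y"
    unfolding eventually_at_right_field using assms by (intro exI[of _ x]) (auto intro: k_mono)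
qed simp

lemma theta_nonneg: "0 \<le> \<theta>"
  using k_nonneg[of 1] k_le_theta[of 1] by simp

text \<open>Values of \<open>k\<close> outside the positive half-line are arbitrary; with the
  extension by 0, integrals run over all of \<open>lborel\<close> without an indicator.\<close>

definition kk :: "real \<Rightarrow> real" where
  "kk x = (if 0 < x then k x else 0)"

lemma kk_nonneg: "0 \<le> kk x"
  using k_nonneg by (simp add: kk_def)

lemma kk_le_theta: "kk x \<le> \<theta>"
  using k_le_theta theta_nonneg by (simp add: kk_def)

lemma kk_mono: "0 < x \<Longrightarrow> x \<le> y \<Longrightarrow> kk y \<le> kk x"
  using k_mono by (simp add: kk_def)

lemma integrable_kk: "integrable lborel (\<lambda>x. min x 1 * (kk x / x))"
proof -
  have "(\<lambda>x. indicator {0<..} x *\<^sub>R (min x 1 * (k x / x))) = (\<lambda>x. min x 1 * (kk x / x))"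
    by (auto simp: kk_def)
  then show ?thesis using k_integrable by (simp add: set_integrable_def)
qed

text \<open>Extracted from the integrability condition by dividing out its weight, which is positive
  where \<open>kk\<close> can be nonzero.\<close>

lemma kk_measurable [measurable]: "kk \<in> borel_measurable borel"
proof -
  have [measurable]: "(\<lambda>x. min x 1 * (kk x / x)) \<in> borel_measurable borel"
    using borel_measurable_integrable[OF integrable_kk] by simp
  have "(\<lambda>x. (min x 1 * (kk x / x)) * (x / min x 1)) \<in> borel_measurable borel" by measurable
  also have "(\<lambda>x. (min x 1 * (kk x / x)) * (x / min x 1)) = kk"
    by (auto simp: kk_def min_def)
  finally show ?thesis .
qed

lemma kk_at_right: "(kk \<longlongrightarrow> \<theta>) (at_right 0)"
proof (rule Lim_transform_eventually[OF k_zero])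
  show "\<forall>\<^sub>F x in at_right 0. k x = kk x"
    using eventually_at_right_less[of 0] by eventually_elim (simp add: kk_def)
qed

text \<open>The integral of \<open>kk x / x\<close> over \<open>{real n<..2 * real n}\<close> tends
  to 0 and, by monotonicity, is at least \<open>real n\<close> times
  \<open>kk (2 * real n) / (2 * real n)\<close>, that is, half of
  \<open>kk (2 * real n)\<close>.\<close>

lemma kk_at_top: "(kk \<longlongrightarrow> 0) at_top"
proof -
  define f where "f x = min x 1 * (kk x / x)" for x
  have f: "integrable lborel f" unfolding f_def by (rule integrable_kk)
  have f_nonneg: "0 \<le> f x" for x
    using kk_nonneg[of x] by (cases "0 < x") (auto simp: f_def kk_def)
  define g where "g n x = f x * indicator {real n<..2 * real n} x" for n x
  have lim: "(\<lambda>n. \<integral>x. g n x \<partial>lborel) \<longlonglongrightarrow> (\<integral>x. (0 :: real) \<partial>(lborel :: real measure))"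
  proof (rule integral_dominated_convergence[where w = f])
    show "AE x in lborel. (\<lambda>n. g n x) \<longlonglongrightarrow> 0"
    proof (intro AE_I2 tendsto_eventually)
      fix x :: real
      obtain N :: nat where "x < real N" using reals_Archimedean2 by blast
      then have "g n x = 0" if "N \<le> n" for n using that by (auto simp: g_def)
      then show "\<forall>\<^sub>F n in sequentially. g n x = 0" by (auto simp: eventually_sequentially)
    qed
  qed (use f f_nonneg in \<open>auto simp: g_def indicator_def\<close>)
  have le: "kk (2 * real n) / 2 \<le> (\<integral>x. g n x \<partial>lborel)" if "1 \<le> n" for n
  proof -
    have "kk (2 * real n) / 2 = (\<integral>x. kk (2 * real n) / (2 * real n) * indicator {real n<..2 * real n} x \<partial>lborel)"
      using that by simp
    also have "\<dots> \<le> (\<integral>x. g n x \<partial>lborel)"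
    proof (rule integral_mono)
      show "integrable lborel (g n)"
        unfolding g_def using f by (intro integrable_mult_indicator[of _ lborel f, simplified mult.commute real_scaleR_def]) auto
      fix x
      show "kk (2 * real n) / (2 * real n) * indicator {real n<..2 * real n} x \<le> g n x"
      proof (cases "x \<in> {real n<..2 * real n}")
        case True
        then have "kk (2 * real n) / (2 * real n) \<le> kk x / x"
          using that kk_mono[of x "2 * real n"] kk_nonneg by (intro frac_le) auto
        moreover have "min x 1 = 1"
        proof -
          have "1 \<le> real n" using that by simp
          moreover have "real n < x" using True by simp
          ultimately show ?thesis by linarith
        qed
        ultimately show ?thesis using True by (simp add: g_def f_def)
      qed (simp add: g_def)
    qed auto
    finally show ?thesis .
  qed
  show ?thesis
  proof (rule order_tendstoI)
    fix e :: real assume e: "0 < e"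
    have "\<forall>\<^sub>F n in sequentially. (\<integral>x. g n x \<partial>lborel) < e / 2"
      using order_tendstoD(2)[OF lim, of "e / 2"] e by simp
    then obtain n where n: "1 \<le> n" "(\<integral>x. g n x \<partial>lborel) < e / 2"
      unfolding eventually_sequentially by (meson nat_le_linear order_refl le_trans max.cobounded1 max.cobounded2)
    then have "kk (2 * real n) < e" using le[of n] by simp
    then have "kk x < e" if "2 * real n \<le> x" for x
      using kk_mono[of "2 * real n" x] that n by simp
    then show "\<forall>\<^sub>F x in at_top. kk x < e" by (auto simp: eventually_at_top_linorder)
  next
    fix e :: real assume "e < 0"
    then show "\<forall>\<^sub>F x in at_top. e < kk x" using kk_nonneg by (intro always_eventually allI) (rule less_le_trans)
  qed
qed

text \<open>The Laplace exponent of \<open>T 1\<close>; by self-similarity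
  \<open>expo (u * s)\<close> is that of \<open>T s\<close> at \<open>u\<close>.\<close>

definition expo :: "real \<Rightarrow> real" where
  "expo u = (\<integral>x. (1 - exp (- u * x)) * (kk x / x) \<partial>lborel)"

lemma integrable_expo:
  assumes "0 \<le> u"
  shows "integrable lborel (\<lambda>x. (1 - exp (- u * x)) * (kk x / x))"
proof (rule Bochner_Integration.integrable_bound)
  show "integrable lborel (\<lambda>x. (u + 1) * (min x 1 * (kk x / x)))"
    by (intro integrable_mult_right integrable_kk)
  show "AE x in lborel. norm ((1 - exp (- u * x)) * (kk x / x)) \<le> norm ((u + 1) * (min x 1 * (kk x / x)))"
  proof (rule AE_I2)
    fix x :: real
    show "norm ((1 - exp (- u * x)) * (kk x / x)) \<le> norm ((u + 1) * (min x 1 * (kk x / x)))"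
    proof (cases "0 < x")
      case True
      have ux: "0 \<le> u * x" using True assms by simp
      \<comment> \<open>The left side is at most \<open>u * x\<close> and at most 1; the constant
        \<open>u + 1\<close> covers both the range up to 1 and the range beyond.\<close>
      have "1 - exp (- (u * x)) \<le> (u + 1) * min x 1"
      proof (cases "x \<le> 1")
        case True
        have "1 - exp (- (u * x)) \<le> u * x" using one_minus_exp_bounds(1)[OF ux] .
        also have "\<dots> \<le> (u + 1) * x" using \<open>0 < x\<close> by (simp add: algebra_simps)
        finally show ?thesis using True by simp
      next
        case False
        have "0 < exp (- (u * x))" by simp
        then show ?thesis using False assms by (simp del: exp_gt_zero)
      qed
      then have "(1 - exp (- (u * x))) * (kk x / x) \<le> ((u + 1) * min x 1) * (kk x / x)"
        using True kk_nonneg[of x] by (intro mult_right_mono) auto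
      moreover have "0 \<le> (1 - exp (- (u * x))) * (kk x / x)"
        using True kk_nonneg[of x] ux by simp
      ultimately have "norm ((1 - exp (- u * x)) * (kk x / x)) \<le> (u + 1) * (min x 1 * (kk x / x))"
        by (simp only: real_norm_def abs_of_nonneg mult.assoc mult_minus_left)
      also have "\<dots> \<le> norm ((u + 1) * (min x 1 * (kk x / x)))" by (simp only: real_norm_def abs_ge_self)
      finally show ?thesis .
    qed (simp add: kk_def)
  qed
qed measurable

text \<open>Substitution in an integral against the scale invariant measure \<open>1 / x dx\<close>:
  only the argument of \<open>kk\<close> is rescaled.\<close>

lemma expo_scale:
  assumes "0 \<le> u" "0 < b"
  shows "integrable lborel (\<lambda>x. (1 - exp (- u * x)) * (kk (x / b) / x))"
    and "expo (u * b) = (\<integral>x. (1 - exp (- u * x)) * (kk (x / b) / x) \<partial>lborel)"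
proof -
  let ?f = "\<lambda>x. (1 - exp (- (u * b) * x)) * (kk x / x)"
  have eq: "?f (0 + (1 / b) * x) = b * ((1 - exp (- u * x)) * (kk (x / b) / x))" for x
    using assms by simp
  have "integrable lborel ?f" using assms by (intro integrable_expo) auto
  then have "integrable lborel (\<lambda>x. ?f (0 + (1 / b) * x))"
    using assms by (intro lborel_integrable_real_affine) auto
  then show "integrable lborel (\<lambda>x. (1 - exp (- u * x)) * (kk (x / b) / x))"
    unfolding eq by (subst (asm) integrable_mult_left_iff) (use assms in auto)
  have "expo (u * b) = \<bar>1 / b\<bar> *\<^sub>R (\<integral>x. ?f (0 + (1 / b) * x) \<partial>lborel)"
    unfolding expo_def using assms by (intro lborel_integral_real_affine) auto
  also have "\<dots> = (\<integral>x. (1 - exp (- u * x)) * (kk (x / b) / x) \<partial>lborel)"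
    unfolding eq integral_mult_right_zero using assms by simp
  finally show "expo (u * b) = (\<integral>x. (1 - exp (- u * x)) * (kk (x / b) / x) \<partial>lborel)" .
qed

text \<open>The Levy density of \<open>T b - T a\<close>: that of \<open>T b\<close> is
  \<open>kk (x / b) / x\<close>, and independence of increments makes the densities subtract. It is
  nonnegative because the key function is non-increasing.\<close>

definition jump_density :: "real \<Rightarrow> real \<Rightarrow> real \<Rightarrow> real" where
  "jump_density a b x = (kk (x / b) - kk (x / a)) / x"

lemma jump_density_measurable [measurable]: "jump_density a b \<in> borel_measurable borel"
  unfolding jump_density_def by measurable

lemma jump_density_nonneg: "0 < a \<Longrightarrow> a < b \<Longrightarrow> 0 \<le> jump_density a b x"
  using kk_mono[of "x / b" "x / a"]
  by (cases "0 < x") (auto simp: jump_density_def kk_def field_simps zero_less_divide_iff)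

lemma jump_density_nonpos: "x \<le> 0 \<Longrightarrow> 0 < a \<Longrightarrow> a < b \<Longrightarrow> jump_density a b x = 0"
  by (auto simp: jump_density_def kk_def zero_less_divide_iff)

lemma expo_diff:
  assumes "0 \<le> u" "0 < a" "a < b"
  shows "integrable lborel (\<lambda>x. (1 - exp (- u * x)) * jump_density a b x)"
    and "expo (u * b) - expo (u * a) = (\<integral>x. (1 - exp (- u * x)) * jump_density a b x \<partial>lborel)"
proof -
  have eq: "(1 - exp (- u * x)) * jump_density a b x =
      (1 - exp (- u * x)) * (kk (x / b) / x) - (1 - exp (- u * x)) * (kk (x / a) / x)" for x
    by (simp add: jump_density_def diff_divide_distrib right_diff_distrib)
  show "integrable lborel (\<lambda>x. (1 - exp (- u * x)) * jump_density a b x)"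
    unfolding eq using assms by (intro Bochner_Integration.integrable_diff expo_scale) auto
  show "expo (u * b) - expo (u * a) = (\<integral>x. (1 - exp (- u * x)) * jump_density a b x \<partial>lborel)"
    unfolding eq using assms
    by (subst Bochner_Integration.integral_diff[OF expo_scale(1)[of u b] expo_scale(1)[of u a]])
      (simp_all add: expo_scale(2))
qed

text \<open>Rescaling by the Laplace argument turns the difference into an integral of the Frullani
  kernel \<open>D\<close> times \<open>kk (y / real (Suc n))\<close>. The second factor tends to
  \<open>\<theta>\<close>, and \<open>\<theta>\<close> also dominates it.\<close>

lemma expo_diff_tendsto:
  assumes ab: "0 < a" "a < b"
  shows "(\<lambda>n. expo (real (Suc n) * b) - expo (real (Suc n) * a)) \<longlonglongrightarrow> \<theta> * ln (b / a)"
proof -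
  define D where "D y = (exp (- a * y) - exp (- b * y)) / y * indicator {0<..} y" for y
  have Dm[measurable]: "D \<in> borel_measurable borel" unfolding D_def by measurable
  have D_nonneg: "0 \<le> D y" for y using ab by (auto simp: D_def indicator_def)
  have nn: "(\<integral>\<^sup>+y. ennreal (D y) \<partial>lborel) = ennreal (ln (b / a))"
    unfolding frullani_exp[OF ab, symmetric] by (intro nn_integral_cong) (auto simp: D_def indicator_def)
  have D: "integrable lborel D" "(\<integral>y. D y \<partial>lborel) = ln (b / a)"
  proof -
    have "has_bochner_integral lborel D (ln (b / a))"
      using nn ab D_nonneg by (intro has_bochner_integral_nn_integral) auto
    then show "integrable lborel D" "(\<integral>y. D y \<partial>lborel) = ln (b / a)"
      by (auto simp: has_bochner_integral_iff)
  qed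
  have eq: "expo (real (Suc n) * b) - expo (real (Suc n) * a) = (\<integral>y. D y * kk (y / real (Suc n)) \<partial>lborel)" for n
  proof -
    have "expo (c * real (Suc n)) = (\<integral>x. (1 - exp (- c * x)) * (kk (x / real (Suc n)) / x) \<partial>lborel)"
      "integrable lborel (\<lambda>x. (1 - exp (- c * x)) * (kk (x / real (Suc n)) / x))" if "0 < c" for c
      using expo_scale[of c "real (Suc n)"] that by auto
    note c = this[of a] this[of b]
    have "expo (b * real (Suc n)) - expo (a * real (Suc n)) =
      (\<integral>x. (1 - exp (- b * x)) * (kk (x / real (Suc n)) / x) - (1 - exp (- a * x)) * (kk (x / real (Suc n)) / x) \<partial>lborel)"
      using c ab by simp
    also have "\<dots> = (\<integral>y. D y * kk (y / real (Suc n)) \<partial>lborel)"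
      by (intro Bochner_Integration.integral_cong)
        (auto simp: D_def kk_def indicator_def zero_less_divide_iff diff_divide_distrib left_diff_distrib)
    finally show ?thesis by (simp only: mult.commute)
  qed
  have "(\<lambda>n. \<integral>y. D y * kk (y / real (Suc n)) \<partial>lborel) \<longlonglongrightarrow> (\<integral>y. D y * \<theta> \<partial>lborel)"
  proof (rule integral_dominated_convergence[where w = "\<lambda>y. D y * \<theta>"])
    show "AE y in lborel. (\<lambda>n. D y * kk (y / real (Suc n))) \<longlonglongrightarrow> D y * \<theta>"
    proof (rule AE_I2)
      fix y :: real
      show "(\<lambda>n. D y * kk (y / real (Suc n))) \<longlonglongrightarrow> D y * \<theta>"
      proof (cases "0 < y")
        case True
        have "(\<lambda>n. y / real (Suc n)) \<longlonglongrightarrow> 0" by (rule LIMSEQ_Suc[OF lim_const_over_n])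
        then have "filterlim (\<lambda>n. y / real (Suc n)) (at_right 0) sequentially"
          using True by (auto simp: filterlim_at)
        from filterlim_compose[OF kk_at_right this] show ?thesis by (intro tendsto_intros)
      qed (simp add: D_def)
    qed
    show "AE y in lborel. norm (D y * kk (y / real (Suc n))) \<le> D y * \<theta>" for n
      using D_nonneg kk_le_theta kk_nonneg by (auto simp: abs_mult intro!: mult_left_mono)
  qed (use D in auto)
  moreover have "(\<integral>y. D y * \<theta> \<partial>lborel) = \<theta> * ln (b / a)" using D by (simp add: mult.commute)
  ultimately show ?thesis unfolding eq by (simp only:)
qed

definition jump_measure :: "real \<Rightarrow> real \<Rightarrow> real measure" where
  "jump_measure a b = density lborel (\<lambda>x. ennreal (jump_density a b x))"

lemma sets_jump_measure [simp, measurable_cong]: "sets (jump_measure a b) = sets borel"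
  by (simp add: jump_measure_def)

lemma space_jump_measure [simp]: "space (jump_measure a b) = UNIV"
  by (simp add: jump_measure_def)

text \<open>The integrals of \<open>1 - exp (- u * x)\<close> against the density are differences of
  Laplace exponents; as \<open>u\<close> grows they increase to the total mass.\<close>

lemma emeasure_jump_measure_UNIV:
  assumes ab: "0 < a" "a < b"
  shows "emeasure (jump_measure a b) UNIV = ennreal (\<theta> * ln (b / a))"
proof -
  have lim: "(\<lambda>n. \<integral>\<^sup>+x. ennreal ((1 - exp (- real (Suc n) * x)) * jump_density a b x) \<partial>lborel)
    \<longlonglongrightarrow> (\<integral>\<^sup>+x. ennreal (jump_density a b x) \<partial>lborel)"
  proof (rule nn_integral_LIMSEQ)
    show "incseq (\<lambda>n x. ennreal ((1 - exp (- real (Suc n) * x)) * jump_density a b x))"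
    proof (intro incseq_SucI le_funI ennreal_leI)
      fix n x
      show "(1 - exp (- real (Suc n) * x)) * jump_density a b x \<le> (1 - exp (- real (Suc (Suc n)) * x)) * jump_density a b x"
      proof (cases "0 < x")
        case True
        then show ?thesis using jump_density_nonneg[OF ab, of x] by (intro mult_right_mono) auto
      qed (simp add: jump_density_nonpos[OF _ ab])
    qed
    show "(\<lambda>n. ennreal ((1 - exp (- real (Suc n) * x)) * jump_density a b x)) \<longlonglongrightarrow> ennreal (jump_density a b x)" for x
    proof (cases "0 < x")
      case True
      have "filterlim (\<lambda>n. - x * real (Suc n)) at_bot sequentially"
        using True
        by (intro filterlim_tendsto_neg_mult_at_bot[OF tendsto_const] filterlim_compose[OF filterlim_real_sequentially filterlim_Suc]) auto
      from filterlim_compose[OF exp_at_bot this]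
      moreover have "(\<lambda>n. - x * real (Suc n)) = (\<lambda>n. - real (Suc n) * x)" by (auto simp: fun_eq_iff algebra_simps)
      ultimately have "(\<lambda>n. exp (- real (Suc n) * x)) \<longlonglongrightarrow> 0" by (simp only: fun_eq_iff)
      then have "(\<lambda>n. (1 - exp (- real (Suc n) * x)) * jump_density a b x) \<longlonglongrightarrow> (1 - 0) * jump_density a b x"
        by (intro tendsto_intros)
      then show ?thesis by (intro tendsto_ennrealI) simp
    qed (simp add: jump_density_nonpos[OF _ ab])
  qed measurable
  have "(\<integral>\<^sup>+x. ennreal ((1 - exp (- real (Suc n) * x)) * jump_density a b x) \<partial>lborel)
    = ennreal (expo (real (Suc n) * b) - expo (real (Suc n) * a))" for n
    unfolding expo_diff(2)[OF of_nat_0_le_iff ab]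
  proof (rule nn_integral_eq_integral)
    show "AE x in lborel. 0 \<le> (1 - exp (- real (Suc n) * x)) * jump_density a b x"
    proof (rule AE_I2)
      fix x
      show "0 \<le> (1 - exp (- real (Suc n) * x)) * jump_density a b x"
      proof (cases "0 < x")
        case True
        then have "0 \<le> 1 - exp (- real (Suc n) * x)" by (simp add: mult_nonpos_nonneg)
        then show ?thesis using jump_density_nonneg[OF ab] by (rule mult_nonneg_nonneg)
      qed (simp add: jump_density_nonpos[OF _ ab])
    qed
  qed (use expo_diff(1)[OF _ ab, of "real (Suc n)"] in simp)
  then have "(\<lambda>n. \<integral>\<^sup>+x. ennreal ((1 - exp (- real (Suc n) * x)) * jump_density a b x) \<partial>lborel) \<longlonglongrightarrow> ennreal (\<theta> * ln (b / a))"
    using tendsto_ennrealI[OF expo_diff_tendsto[OF ab]] by simp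
  with lim have "(\<integral>\<^sup>+x. ennreal (jump_density a b x) \<partial>lborel) = ennreal (\<theta> * ln (b / a))"
    by (rule LIMSEQ_unique)
  then show ?thesis by (simp add: jump_measure_def emeasure_density)
qed

lemma finite_jump_measure: "0 < a \<Longrightarrow> a < b \<Longrightarrow> finite_measure (jump_measure a b)"
  by (rule finite_measureI) (simp add: emeasure_jump_measure_UNIV)

lemma AE_jump_measure:
  assumes ab: "0 < a" "a < b"
  shows "AE x in jump_measure a b. 0 < x"
proof -
  have "jump_density a b x > 0 \<Longrightarrow> 0 < x" for x
    using jump_density_nonpos[OF _ ab, of x] by (cases "0 < x") auto
  then show ?thesis unfolding jump_measure_def by (subst AE_density) auto
qed

lemma laplace_jump_measure:
  assumes "0 \<le> u" and ab: "0 < a" "a < b"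
  shows "(\<integral>x. 1 - exp (- u * x) \<partial>jump_measure a b) = expo (u * b) - expo (u * a)"
  unfolding expo_diff(2)[OF assms] jump_measure_def
  using jump_density_nonneg[OF ab] by (subst integral_density) (auto simp: mult.commute)

text \<open>In the density \<open>kk (x / b)\<close> rises to \<open>\<theta>\<close> and
  \<open>kk (x / a)\<close> falls to 0 as the window grows, so monotone convergence applies. The
  shift by 2 keeps the left end strictly below the right end also for \<open>n = 0\<close>.\<close>

lemma jump_measure_tendsto:
  assumes B: "B \<in> sets borel"
  shows "(\<lambda>n. emeasure (jump_measure (1 / real (n + 2)) (real (n + 2))) B) \<longlonglongrightarrow> emeasure (scale_intensity \<theta>) B"
proof -
  let ?d = "\<lambda>n. jump_density (1 / real (n + 2)) (real (n + 2))"
  have ab: "0 < 1 / real (n + 2)" "1 / real (n + 2) < real (n + 2)" for n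
    by (auto intro: less_le_trans[of _ 1])
  have d: "?d n x = (kk (x / real (n + 2)) - kk (x * real (n + 2))) / x" for n x
    by (simp add: jump_density_def)
  have "(\<lambda>n. \<integral>\<^sup>+x. ennreal (?d n x) * indicator B x \<partial>lborel) \<longlonglongrightarrow> (\<integral>\<^sup>+x. ennreal (\<theta> / x) * indicator (B \<inter> {0<..}) x \<partial>lborel)"
  proof (rule nn_integral_LIMSEQ)
    show "incseq (\<lambda>n x. ennreal (?d n x) * indicator B x)"
    proof (intro incseq_SucI le_funI mult_right_mono ennreal_leI)
      fix n x
      show "?d n x \<le> ?d (Suc n) x"
      proof (cases "0 < x")
        case True
        have "kk (x / real (n + 2)) \<le> kk (x / real (Suc n + 2))" "kk (x * real (Suc n + 2)) \<le> kk (x * real (n + 2))"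
          using True by (auto intro!: kk_mono divide_left_mono mult_left_mono)
        then show ?thesis unfolding d using True by (intro divide_right_mono) auto
      qed (use ab[of n] ab[of "Suc n"] in \<open>simp add: jump_density_nonpos\<close>)
    qed simp
    show "(\<lambda>n. ennreal (?d n x) * indicator B x) \<longlonglongrightarrow> ennreal (\<theta> / x) * indicator (B \<inter> {0<..}) x" for x
    proof (cases "0 < x")
      case True
      have "(\<lambda>n. x / real (n + 2)) \<longlonglongrightarrow> 0" using LIMSEQ_ignore_initial_segment[OF lim_const_over_n, of x 2] by simp
      then have "filterlim (\<lambda>n. x / real (n + 2)) (at_right 0) sequentially"
        using True by (auto simp: filterlim_at)
      from filterlim_compose[OF kk_at_right this]
      have 1: "(\<lambda>n. kk (x / real (n + 2))) \<longlonglongrightarrow> \<theta>" .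
      have "filterlim (\<lambda>n. x * real (n + 2)) at_top sequentially"
        using True
        by (intro filterlim_tendsto_pos_mult_at_top[OF tendsto_const] filterlim_compose[OF filterlim_real_sequentially filterlim_add_const_nat_at_top]) auto
      from filterlim_compose[OF kk_at_top this]
      have 2: "(\<lambda>n. kk (x * real (n + 2))) \<longlonglongrightarrow> 0" .
      have "(\<lambda>n. ?d n x) \<longlonglongrightarrow> (\<theta> - 0) / x"
        unfolding d using True by (intro tendsto_intros 1 2) auto
      from tendsto_ennrealI[OF this] show ?thesis
        using True by (cases "x \<in> B") (auto simp: indicator_def)
    next
      case False
      then have "?d n x = 0" for n using ab[of n] by (intro jump_density_nonpos) auto
      then show ?thesis using False by simp
    qed
  qed (use B in measurable)
  then show ?thesis
    using B by (simp add: jump_measure_def emeasure_density emeasure_scale_intensity)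
qed

end

section \<open>Monotone pure jump paths\<close>

locale jump_path =
  fixes f :: "real \<Rightarrow> real"
  assumes cadlag: "cadlag_path f"
    and mono: "mono_on {0<..} f"
    and zero: "(f \<longlongrightarrow> 0) (at_right 0)"
    and jumps: "\<And>s. 0 < s \<Longrightarrow> ((\<lambda>u. f u - left_lim f u) has_sum f s) {u \<in> jump_times f. u \<le> s}"
begin

definition jump :: "real \<Rightarrow> real" where
  "jump u = f u - left_lim f u"

lemma mono': "0 < s \<Longrightarrow> s \<le> t \<Longrightarrow> f s \<le> f t"
  using mono by (auto simp: mono_on_def)

lemma nonneg:
  assumes "0 < s"
  shows "0 \<le> f s"
proof (rule tendsto_upperbound[OF zero])
  show "\<forall>\<^sub>F y in at_right 0. f y \<le> f s"
    unfolding eventually_at_right_field using assms by (intro exI[of _ s]) (auto intro: mono')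
qed simp

lemma left_lim_tendsto:
  assumes "0 < s"
  shows "(f \<longlongrightarrow> left_lim f s) (at_left s)"
proof -
  obtain l where l: "(f \<longlongrightarrow> l) (at_left s)"
    using cadlag assms by (auto simp: cadlag_path_def)
  then have "left_lim f s = l"
    unfolding left_lim_def by (intro tendsto_Lim) auto
  with l show ?thesis by simp
qed

lemma le_left_lim:
  assumes "0 < s" "s < t"
  shows "f s \<le> left_lim f t"
proof (rule tendsto_lowerbound[OF left_lim_tendsto])
  show "\<forall>\<^sub>F y in at_left t. f s \<le> f y"
    unfolding eventually_at_left_field using assms by (intro exI[of _ s]) (auto intro: mono')
qed (use assms in auto)

lemma jump_pos: "s \<in> jump_times f \<Longrightarrow> 0 < jump s"
  by (auto simp: jump_times_def jump_def)

text \<open>Without increase, monotonicity leaves no room between a left limit and the value.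
  Conversely, without jumps both values are sums over the same set of jumps.\<close>

lemma constant_iff:
  assumes "0 < s" "s \<le> t"
  shows "f s = f t \<longleftrightarrow> jump_times f \<inter> {s<..t} = {}"
proof
  assume eq: "f s = f t"
  have "u \<notin> jump_times f" if u: "u \<in> {s<..t}" for u
  proof -
    have "f u \<le> f t" using u assms by (intro mono') auto
    then have "f u \<le> left_lim f u" using le_left_lim[of s u] u assms eq by auto
    then show ?thesis by (simp add: jump_times_def)
  qed
  then show "jump_times f \<inter> {s<..t} = {}" by auto
next
  assume "jump_times f \<inter> {s<..t} = {}"
  then have "{u \<in> jump_times f. u \<le> t} = {u \<in> jump_times f. u \<le> s}"
    using assms(2) by fastforce
  then show "f s = f t"
    using jumps[of s] jumps[of t] assms by (auto intro: has_sum_unique)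
qed

lemma single_jump:
  assumes "0 < s" "s < t" "jump_times f \<inter> {s<..t} = {u}"
  shows "f t - f s = jump u"
proof -
  have u: "u \<in> jump_times f" "s < u" "u \<le> t" using assms(3) by auto
  have "{v \<in> jump_times f. v \<le> t} = {v \<in> jump_times f. v \<le> s} \<union> {u}"
    using assms(2,3) u by fastforce
  moreover have "((\<lambda>u. f u - left_lim f u) has_sum (f s + jump u)) ({v \<in> jump_times f. v \<le> s} \<union> {u})"
  proof (rule has_sum_Un_disjoint[OF jumps[OF assms(1)]])
    show "((\<lambda>u. f u - left_lim f u) has_sum jump u) {u}"
      using has_sum_finite[of "{u}" "\<lambda>u. f u - left_lim f u"] by (simp add: jump_def)
  qed (use u in auto)
  ultimately have "f t = f s + jump u"
    using jumps[of t] assms by (auto intro: has_sum_unique)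
  then show ?thesis by simp
qed

text \<open>Once every cell holds at most one jump, each increment is a single jump or 0, and
  \<open>g 0 = 0\<close> discards the latter. The values of \<open>g\<close> are kept general
  because both real and \<open>ennreal\<close> sums are needed.\<close>

lemma sum_increments_eventually:
  fixes g :: "real \<Rightarrow> 'b::comm_monoid_add"
  assumes ab: "0 < a" "a < b" and fin: "finite (jump_times f \<inter> {a<..b})" and g: "g 0 = 0"
  shows "\<forall>\<^sub>F m in sequentially. (\<Sum>i<m. g (f (grid a b m (Suc i)) - f (grid a b m i))) =
    (\<Sum>s\<in>jump_times f \<inter> {a<..b}. g (jump s))"
  using cell_eventually_separates[OF fin, of a b] eventually_gt_at_top[of 0]
proof eventually_elim
  case (elim m)
  let ?F = "jump_times f \<inter> {a<..b}"
  have cell: "?F \<inter> cell a b m i = jump_times f \<inter> {grid a b m i<..grid a b m (Suc i)}" if "i < m" for i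
    using cell_subset[OF ab(2) that] by (auto simp: cell_def)
  have step: "g (f (grid a b m (Suc i)) - f (grid a b m i)) = (\<Sum>s\<in>?F \<inter> cell a b m i. g (jump s))" if i: "i < m" for i
  proof -
    have pos: "0 < grid a b m i" using grid_le[OF ab(2), of 0 i m] ab by (simp add: grid_0)
    have less: "grid a b m i < grid a b m (Suc i)" using elim by (intro grid_less ab) auto
    show ?thesis
    proof (cases "?F \<inter> cell a b m i = {}")
      case True
      then have "f (grid a b m i) = f (grid a b m (Suc i))"
        using cell[OF i] constant_iff[OF pos less_imp_le[OF less]] by simp
      then show ?thesis unfolding True by (simp add: g)
    next
      case False
      then obtain u where u: "?F \<inter> cell a b m i = {u}"
        using elim(1) by blast
      then have "f (grid a b m (Suc i)) - f (grid a b m i) = jump u"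
        using cell[OF i] by (intro single_jump[OF pos less]) simp
      then show ?thesis unfolding u by simp
    qed
  qed
  have "(\<Sum>i<m. g (f (grid a b m (Suc i)) - f (grid a b m i))) = (\<Sum>i<m. \<Sum>s\<in>?F \<inter> cell a b m i. g (jump s))"
    by (intro sum.cong) (auto simp: step)
  also have "\<dots> = (\<Sum>s\<in>(\<Union>i<m. ?F \<inter> cell a b m i). g (jump s))"
  proof (rule sum.UNION_disjoint[symmetric])
    show "\<forall>i\<in>{..<m}. \<forall>j\<in>{..<m}. i \<noteq> j \<longrightarrow> ?F \<inter> cell a b m i \<inter> (?F \<inter> cell a b m j) = {}"
      using disjoint_cell[OF ab(2)] by blast
  qed (use fin in auto)
  also have "(\<Union>i<m. ?F \<inter> cell a b m i) = ?F"
    using UN_cell[OF ab(2), of m] elim by auto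
  finally show ?case .
qed

text \<open>Valid for every \<open>m\<close>, not just eventually: it lets the number of jumps
  dominate sums over increments.\<close>

lemma card_nonzero_increments_le:
  assumes ab: "0 < a" "a < b" and fin: "finite (jump_times f \<inter> {a<..b})"
  shows "card {i. i < m \<and> f (grid a b m (Suc i)) \<noteq> f (grid a b m i)} \<le> card (jump_times f \<inter> {a<..b})"
proof (cases "m = 0")
  case False
  have "{i. i < m \<and> f (grid a b m (Suc i)) \<noteq> f (grid a b m i)} \<subseteq>
      {i. i < m \<and> jump_times f \<inter> {a<..b} \<inter> cell a b m i \<noteq> {}}"
  proof safe
    fix i assume i: "i < m" and empty: "jump_times f \<inter> {a<..b} \<inter> cell a b m i = {}"
      and neq: "f (grid a b m (Suc i)) \<noteq> f (grid a b m i)"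
    have "jump_times f \<inter> {grid a b m i<..grid a b m (Suc i)} = {}"
      using empty cell_subset[OF ab(2) i] by (auto simp: cell_def)
    moreover have "0 < grid a b m i" using grid_le[OF ab(2), of 0 i m] ab by (simp add: grid_0)
    ultimately show False using neq constant_iff[of "grid a b m i" "grid a b m (Suc i)"] grid_le[OF ab(2), of i "Suc i" m] by auto
  qed
  then have "card {i. i < m \<and> f (grid a b m (Suc i)) \<noteq> f (grid a b m i)} \<le> ncells a b m (jump_times f \<inter> {a<..b})"
    unfolding ncells_def by (intro card_mono) auto
  also have "\<dots> \<le> card (jump_times f \<inter> {a<..b})" by (rule ncells_le_card[OF ab(2) fin])
  finally show ?thesis .
qed simp

end

locale step_path = jump_path +
  assumes locally_finite: "\<And>a b. 0 < a \<Longrightarrow> finite (jump_times f \<inter> {a..b})"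
begin

lemma finite_Ioc: "0 < a \<Longrightarrow> finite (jump_times f \<inter> {a<..b})"
  by (rule finite_subset[OF _ locally_finite[of a b]]) auto

lemma last_jump:
  assumes "0 < a" "a \<le> s" "jump_times f \<inter> {a<..s} \<noteq> {}"
  obtains u where "u \<in> jump_times f" "a < u" "u \<le> s" "f u = f s"
proof -
  define u where "u = Max (jump_times f \<inter> {a<..s})"
  have u: "u \<in> jump_times f \<inter> {a<..s}" unfolding u_def using assms finite_Ioc by (intro Max_in) auto
  have max: "v \<le> u" if "v \<in> jump_times f \<inter> {a<..s}" for v
    unfolding u_def using that finite_Ioc[OF assms(1)] by (intro Max_ge) auto
  have "jump_times f \<inter> {u<..s} = {}" using u max by fastforce
  then have "f u = f s" using u assms by (subst constant_iff) auto
  then show ?thesis using that u by auto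
qed

text \<open>The path is a bijection from these jump times onto these range points. It increases
  strictly at each jump, and a value taken at \<open>s\<close> is already taken at the last jump up
  to \<open>s\<close>.\<close>

lemma range_counts_jumps:
  assumes ab: "0 < a" "a < b"
  shows "npoints (path_range f) {f a<..f b} = npoints (jump_times f) {a<..b}"
proof -
  have strict: "f u < f v" if "0 < u" "u < v" "v \<in> jump_times f" for u v
    using le_left_lim[of u v] that by (auto simp: jump_times_def)
  have "bij_betw f (jump_times f \<inter> {a<..b}) (path_range f \<inter> {f a<..f b})"
    unfolding bij_betw_def
  proof
    show "inj_on f (jump_times f \<inter> {a<..b})"
    proof (rule linorder_inj_onI)
      fix u v assume "u < v" "u \<in> jump_times f \<inter> {a<..b}" "v \<in> jump_times f \<inter> {a<..b}"
      then show "f u \<noteq> f v" using strict[of u v] ab by auto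
    qed auto
    show "f ` (jump_times f \<inter> {a<..b}) = path_range f \<inter> {f a<..f b}"
    proof safe
      fix u assume u: "u \<in> jump_times f" "u \<in> {a<..b}"
      have "f a < f u" using u ab strict[of a u] by auto
      moreover have "f u \<le> f b" using u ab by (intro mono') auto
      moreover have "0 \<le> f a" using ab by (intro nonneg)
      ultimately show "f u \<in> path_range f" "f u \<in> {f a<..f b}"
        using u ab by (auto simp: path_range_def)
    next
      fix y assume "y \<in> path_range f" and y: "y \<in> {f a<..f b}"
      then obtain s0 where s0: "0 < s0" "y = f s0" by (auto simp: path_range_def)
      \<comment> \<open>A value at most \<open>f b\<close> that is taken after \<open>b\<close>
        equals \<open>f b\<close>, so the time can be moved back to \<open>b\<close>.\<close>
      define s where "s = min s0 b"
      have fs: "y = f s"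
      proof (cases "s0 \<le> b")
        case False
        then have "f b \<le> f s0" using ab by (intro mono') auto
        then show ?thesis using y s0 False by (auto simp: s_def)
      qed (use s0 in \<open>simp add: s_def\<close>)
      have "a < s"
      proof (rule ccontr)
        assume "\<not> a < s"
        then have "f s \<le> f a" using s0 ab by (intro mono') (auto simp: s_def)
        then show False using fs y by auto
      qed
      then have "jump_times f \<inter> {a<..s} \<noteq> {}" using constant_iff[of a s] ab fs y by auto
      then obtain u where "u \<in> jump_times f" "a < u" "u \<le> s" "f u = f s"
        using last_jump[of a s] ab \<open>a < s\<close> by auto
      then show "y \<in> f ` (jump_times f \<inter> {a<..b})"
        using fs by (intro image_eqI[of _ _ u]) (auto simp: s_def)
    qed
  qed
  then have "finite (path_range f \<inter> {f a<..f b})" "card (jump_times f \<inter> {a<..b}) = card (path_range f \<inter> {f a<..f b})"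
    using finite_Ioc[OF ab(1)] bij_betw_finite bij_betw_same_card by blast+
  then show ?thesis using finite_Ioc[OF ab(1), of b] by (simp add: npoints_def)
qed

lemma finite_range_Ioc:
  assumes "0 < a" "a < b"
  shows "finite (path_range f \<inter> {f a<..f b})"
proof -
  have "npoints (path_range f) {f a<..f b} < \<top>"
    unfolding range_counts_jumps[OF assms] by (simp add: npoints_finite_iff finite_Ioc assms)
  then show ?thesis by (simp add: npoints_finite_iff)
qed

lemma right_constant:
  assumes "0 < s"
  shows "\<exists>t>s. \<forall>v\<in>{s..t}. f v = f s"
proof -
  let ?F = "jump_times f \<inter> {s<..s + 1}"
  \<comment> \<open>The midpoint between \<open>s\<close> and the next jump stays strictly before
    that jump.\<close>
  define t where "t = (if ?F = {} then s + 1 else (s + Min ?F) / 2)"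
  have t: "s < t \<and> jump_times f \<inter> {s<..t} = {}"
  proof (cases "?F = {}")
    case True
    then show ?thesis by (auto simp: t_def)
  next
    case False
    have fin: "finite ?F" using finite_Ioc[OF assms] .
    have "Min ?F \<in> ?F" using False fin by (intro Min_in) auto
    then have "s < Min ?F" "Min ?F \<le> s + 1" by auto
    moreover have "v \<notin> jump_times f" if "s < v" "v \<le> (s + Min ?F) / 2" for v
    proof
      assume "v \<in> jump_times f"
      then have "v \<in> ?F" using that calculation by auto
      then have "Min ?F \<le> v" using fin by (intro Min_le) auto
      then show False using that calculation by simp
    qed
    ultimately show ?thesis using False by (auto simp: t_def)
  qed
  have "f v = f s" if "v \<in> {s..t}" for v
  proof -
    have "jump_times f \<inter> {s<..v} = {}" using t that by auto
    then show ?thesis using constant_iff[of s v] assms that by auto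
  qed
  then show ?thesis using t by blast
qed

text \<open>Each value is held for a positive time, so a dense set of times sees all of them. This
  makes the range a function of countably many coordinates.\<close>

lemma path_range_dense:
  assumes D: "D \<subseteq> {0<..}" "\<And>s t. 0 < s \<Longrightarrow> s < t \<Longrightarrow> \<exists>q\<in>D. s < q \<and> q < t"
  shows "path_range f = f ` D \<inter> {0<..}"
proof -
  have "f s \<in> f ` D" if "0 < s" for s
  proof -
    obtain t where t: "s < t" "\<forall>v\<in>{s..t}. f v = f s" using right_constant[OF \<open>0 < s\<close>] by blast
    obtain q where q: "q \<in> D" "s < q" "q < t" using D(2)[OF \<open>0 < s\<close> t(1)] by blast
    then have "f q = f s" using bspec[OF t(2), of q] by simp
    then have "f s = f q" ..
    then show ?thesis using q(1) by (rule image_eqI)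
  qed
  then show ?thesis using D(1) by (auto simp: path_range_def)
qed

end

section \<open>Laplace transforms of the increments\<close>

locale ssa_process = prob_space M + key_fun k \<theta>
  for M :: "'w measure" and k :: "real \<Rightarrow> real" and \<theta> :: real +
  fixes T :: "real \<Rightarrow> 'w \<Rightarrow> real"
  assumes ssa: "SSA_process M T"
    and nondec: "nondecreasing_process M T"
    and nodrift: "no_drift M T"
    and laplace_key: "\<And>u. 0 \<le> u \<Longrightarrow>
      ln (\<integral>\<omega>. exp (- u * T 1 \<omega>) \<partial>M) = (LBINT x:{0<..}. (exp (- u * x) - 1) * (k x / x))"
begin

lemma T_measurable [measurable]: "0 < s \<Longrightarrow> T s \<in> borel_measurable M"
  using ssa by (auto simp: SSA_process_def)

abbreviation path :: "'w \<Rightarrow> real \<Rightarrow> real" where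
  "path \<omega> \<equiv> (\<lambda>s. T s \<omega>)"

lemma AE_jump_path: "AE \<omega> in M. jump_path (path \<omega>)"
proof -
  have "AE \<omega> in M. cadlag_path (path \<omega>)" "AE \<omega> in M. (path \<omega> \<longlongrightarrow> 0) (at_right 0)"
    using ssa by (auto simp: SSA_process_def)
  moreover have "AE \<omega> in M. mono_on {0<..} (path \<omega>)"
    using nondec by (simp add: nondecreasing_process_def)
  ultimately show ?thesis
    using nodrift unfolding no_drift_def by eventually_elim (auto intro!: jump_path.intro)
qed

lemma AE_nonneg: "0 < s \<Longrightarrow> AE \<omega> in M. 0 \<le> T s \<omega>"
  using AE_jump_path by eventually_elim (rule jump_path.nonneg)

lemma AE_mono: "0 < s \<Longrightarrow> s \<le> t \<Longrightarrow> AE \<omega> in M. T s \<omega> \<le> T t \<omega>"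
  using AE_jump_path by eventually_elim (rule jump_path.mono')

lemma integrable_exp_neg:
  fixes u :: real
  assumes "0 \<le> u" "X \<in> borel_measurable M" "AE \<omega> in M. 0 \<le> X \<omega>"
  shows "integrable M (\<lambda>\<omega>. exp (- u * X \<omega>))"
proof (rule integrable_const_bound[where B = 1])
  show "AE \<omega> in M. norm (exp (- u * X \<omega>)) \<le> 1"
    using assms(3) by eventually_elim (use assms(1) in simp)
qed (use assms(2) in measurable)

lemma laplace_1:
  assumes "0 \<le> u"
  shows "expectation (\<lambda>\<omega>. exp (- u * T 1 \<omega>)) = exp (- expo u)"
proof -
  have "0 < expectation (\<lambda>\<omega>. exp (- u * T 1 \<omega>))"
    using assms by (intro expectation_greater integrable_exp_neg AE_nonneg) auto
  moreover have "ln (expectation (\<lambda>\<omega>. exp (- u * T 1 \<omega>))) = - expo u"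
  proof -
    have "(LBINT x:{0<..}. (exp (- u * x) - 1) * (k x / x)) = (\<integral>x. - ((1 - exp (- u * x)) * (kk x / x)) \<partial>lborel)"
      unfolding set_lebesgue_integral_def
      by (intro Bochner_Integration.integral_cong) (auto simp: kk_def indicator_def left_diff_distrib diff_divide_distrib)
    then have "(LBINT x:{0<..}. (exp (- u * x) - 1) * (k x / x)) = - expo u"
      unfolding expo_def by simp
    then show ?thesis using laplace_key[OF assms] by (simp only:)
  qed
  ultimately show ?thesis by (metis exp_ln)
qed

lemma laplace_T:
  assumes "0 \<le> u" "0 < s"
  shows "expectation (\<lambda>\<omega>. exp (- u * T s \<omega>)) = exp (- expo (u * s))"
proof -
  let ?P = "PiM {1::real} (\<lambda>_. borel) :: (real \<Rightarrow> real) measure"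
  have eq: "distr M ?P (\<lambda>\<omega>. \<lambda>r\<in>{1}. T (s * r) \<omega>) = distr M ?P (\<lambda>\<omega>. \<lambda>r\<in>{1}. s * T r \<omega>)"
    using ssa assms(2) by (auto simp: SSA_process_def self_similar_def)
  have "expectation (\<lambda>\<omega>. exp (- u * T s \<omega>)) = (\<integral>x. exp (- u * x 1) \<partial>distr M ?P (\<lambda>\<omega>. \<lambda>r\<in>{1}. T (s * r) \<omega>))"
    using assms(2) by (subst integral_distr) (auto intro!: measurable_restrict)
  also have "\<dots> = expectation (\<lambda>\<omega>. exp (- (u * s) * T 1 \<omega>))"
    unfolding eq using assms(2) by (subst integral_distr) (auto intro!: measurable_restrict simp: mult.assoc)
  also have "\<dots> = exp (- expo (u * s))" using assms by (intro laplace_1) auto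
  finally show ?thesis .
qed

text \<open>The bound on \<open>g\<close> is asked only at nonnegative arguments, where increments
  live almost surely, so that \<open>exp (- u * x)\<close> qualifies.\<close>

lemma indep_increments_prod:
  fixes g :: "nat \<Rightarrow> real \<Rightarrow> real"
  assumes t: "0 < t 0" "strict_mono_on {..n} t" and S: "S \<subseteq> {..<n}"
    and g: "\<And>i. g i \<in> borel_measurable borel" "\<And>i x. 0 \<le> x \<Longrightarrow> \<bar>g i x\<bar> \<le> 1"
  shows "expectation (\<lambda>\<omega>. \<Prod>i\<in>S. g i (T (t (Suc i)) \<omega> - T (t i) \<omega>))
    = (\<Prod>i\<in>S. expectation (\<lambda>\<omega>. g i (T (t (Suc i)) \<omega> - T (t i) \<omega>)))"
proof (rule indep_vars_lebesgue_integral)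
  have "indep_vars (\<lambda>_. borel) (\<lambda>i \<omega>. T (t (Suc i)) \<omega> - T (t i) \<omega>) {..<n}"
    using ssa t by (auto simp: SSA_process_def independent_increments_def)
  then have "indep_vars (\<lambda>_. borel) (\<lambda>i \<omega>. T (t (Suc i)) \<omega> - T (t i) \<omega>) S"
    using S by (rule indep_vars_subset)
  then show "indep_vars (\<lambda>_. borel) (\<lambda>i \<omega>. g i (T (t (Suc i)) \<omega> - T (t i) \<omega>)) S"
    by (rule indep_vars_compose2) (rule g)
  show "finite S" using S finite_subset by blast
  fix i assume "i \<in> S"
  then have i: "i < n" using S by auto
  then have "t i < t (Suc i)" "t 0 \<le> t i"
    using t(2) by (auto simp: strict_mono_on_def intro: strict_mono_on_leD[OF t(2)])
  then have pos: "0 < t i" "t i \<le> t (Suc i)" "0 < t (Suc i)" using t(1) by auto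
  note [measurable] = T_measurable[OF pos(1)] T_measurable[OF pos(3)] g(1)
  show "integrable M (\<lambda>\<omega>. g i (T (t (Suc i)) \<omega> - T (t i) \<omega>))"
  proof (rule integrable_const_bound[where B = 1])
    show "AE \<omega> in M. norm (g i (T (t (Suc i)) \<omega> - T (t i) \<omega>)) \<le> 1"
      using AE_mono[OF pos(1,2)] by eventually_elim (simp add: g(2))
  qed measurable
qed

text \<open>Increments are independent only between strictly positive times, so \<open>T a\<close>
  itself is not among them. Increments started at \<open>e n\<close> factorize at \<open>a\<close>,
  and \<open>e n\<close> then tends to 0, where the path vanishes.\<close>

lemma laplace_increment:
  assumes u: "0 \<le> u" and ab: "0 < a" "a < b"
  shows "expectation (\<lambda>\<omega>. exp (- u * (T b \<omega> - T a \<omega>))) = exp (- (expo (u * b) - expo (u * a)))"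
proof -
  define e where "e n = a / real (n + 2)" for n
  have e: "0 < e n" "e n < a" for n
    using ab by (auto simp: e_def divide_less_eq)
  have e_lim: "filterlim e (at_right 0) sequentially"
    unfolding filterlim_at
  proof
    show "\<forall>\<^sub>F n in sequentially. e n \<in> {0<..} \<and> e n \<noteq> 0" using e(1) by (intro always_eventually allI) (metis greaterThan_iff less_irrefl)
    show "e \<longlonglongrightarrow> 0" unfolding e_def using LIMSEQ_ignore_initial_segment[OF lim_const_over_n, of a 2] by simp
  qed
  let ?L = "\<lambda>s t. expectation (\<lambda>\<omega>. exp (- u * (T t \<omega> - T s \<omega>)))"
  have split: "?L (e n) b = ?L (e n) a * ?L a b" for n
  proof -
    define t where "t i = (if i = 0 then e n else if i = 1 then a else b)" for i :: nat
    have "strict_mono_on {..2} t"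
      using e[of n] ab by (auto simp: strict_mono_on_def t_def)
    then have "expectation (\<lambda>\<omega>. \<Prod>i<2. exp (- u * (T (t (Suc i)) \<omega> - T (t i) \<omega>)))
      = (\<Prod>i<2. ?L (t i) (t (Suc i)))"
      using e[of n] u
      by (intro indep_increments_prod[of t 2 "{..<2}" "\<lambda>_ x. exp (- u * x)"]) (auto simp: t_def)
    then show ?thesis
      by (simp add: t_def numeral_2_eq_2 mult_exp_exp algebra_simps)
  qed
  have lim: "(\<lambda>n. ?L (e n) s) \<longlonglongrightarrow> exp (- expo (u * s))" if s: "a \<le> s" for s
  proof -
    have "(\<lambda>n. ?L (e n) s) \<longlonglongrightarrow> expectation (\<lambda>\<omega>. exp (- u * (T s \<omega> - 0)))"
    proof (rule integral_dominated_convergence[where w = "\<lambda>_. 1"])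
      show "AE \<omega> in M. (\<lambda>n. exp (- u * (T s \<omega> - T (e n) \<omega>))) \<longlonglongrightarrow> exp (- u * (T s \<omega> - 0))"
        using AE_jump_path
      proof eventually_elim
        case (elim \<omega>)
        have "(\<lambda>n. T (e n) \<omega>) \<longlonglongrightarrow> 0"
          by (rule filterlim_compose[OF jump_path.zero[OF elim] e_lim])
        then show ?case by (intro tendsto_intros)
      qed
      show "AE \<omega> in M. norm (exp (- u * (T s \<omega> - T (e n) \<omega>))) \<le> 1" for n
        using AE_mono[OF e(1)[of n], of s] e(2)[of n] s u by auto
      have [measurable]: "T s \<in> borel_measurable M" using ab s by simp
      show "(\<lambda>\<omega>. exp (- u * (T s \<omega> - 0))) \<in> borel_measurable M" by simp
      show "(\<lambda>\<omega>. exp (- u * (T s \<omega> - T (e n) \<omega>))) \<in> borel_measurable M" for n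
        using e(1)[of n] by simp
    qed simp
    then show ?thesis using laplace_T[OF u, of s] ab s by simp
  qed
  have "(\<lambda>n. ?L (e n) a * ?L a b) \<longlonglongrightarrow> exp (- expo (u * a)) * ?L a b"
    by (intro tendsto_intros lim) simp
  then have "exp (- expo (u * b)) = exp (- expo (u * a)) * ?L a b"
    using lim[of b] ab unfolding split by (auto intro: LIMSEQ_unique)
  then show ?thesis by (simp add: exp_diff exp_minus field_simps)
qed

lemma measure_scale_intensity_Ioc: "0 < a \<Longrightarrow> a \<le> b \<Longrightarrow> measure (scale_intensity \<theta>) {a<..b} = \<theta> * ln (b / a)"
  using theta_nonneg by (simp add: measure_def scale_intensity_Ioc)

lemma prob_no_increment:
  assumes ab: "0 < a" "a < b"
  shows "prob {\<omega> \<in> space M. T b \<omega> = T a \<omega>} = exp (- measure (scale_intensity \<theta>) {a<..b})"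
proof -
  note [measurable] = T_measurable[OF ab(1)] T_measurable[OF less_trans[OF ab]]
  have "(\<lambda>n. expectation (\<lambda>\<omega>. exp (- real (Suc n) * (T b \<omega> - T a \<omega>))))
    \<longlonglongrightarrow> expectation (indicator {\<omega> \<in> space M. T b \<omega> = T a \<omega>})"
  proof (rule integral_dominated_convergence[where w = "\<lambda>_. 1"])
    show "AE \<omega> in M. (\<lambda>n. exp (- real (Suc n) * (T b \<omega> - T a \<omega>))) \<longlonglongrightarrow> indicator {\<omega> \<in> space M. T b \<omega> = T a \<omega>} \<omega>"
      using AE_mono[OF ab(1) less_imp_le[OF ab(2)]] AE_space
    proof eventually_elim
      case (elim \<omega>)
      show ?case
      proof (cases "T b \<omega> = T a \<omega>")
        case False
        have "filterlim (\<lambda>n. - (T b \<omega> - T a \<omega>) * real (Suc n)) at_bot sequentially"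
          using elim False
          by (intro filterlim_tendsto_neg_mult_at_bot[OF tendsto_const] filterlim_compose[OF filterlim_real_sequentially filterlim_Suc]) auto
        from filterlim_compose[OF exp_at_bot this]
        have "(\<lambda>n. exp (- (T b \<omega> - T a \<omega>) * real (Suc n))) \<longlonglongrightarrow> 0" .
        moreover have "(\<lambda>n. - (T b \<omega> - T a \<omega>) * real (Suc n)) = (\<lambda>n. - real (Suc n) * (T b \<omega> - T a \<omega>))"
          by (auto simp: fun_eq_iff algebra_simps)
        ultimately show ?thesis using False by (simp add: fun_eq_iff)
      qed (use elim in simp)
    qed
    show "AE \<omega> in M. norm (exp (- real (Suc n) * (T b \<omega> - T a \<omega>))) \<le> 1" for n
      using AE_mono[OF ab(1) less_imp_le[OF ab(2)]] by eventually_elim (simp add: mult_nonpos_nonneg)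
  qed auto
  moreover have "(\<lambda>n. expectation (\<lambda>\<omega>. exp (- real (Suc n) * (T b \<omega> - T a \<omega>)))) \<longlonglongrightarrow> exp (- (\<theta> * ln (b / a)))"
    unfolding laplace_increment[OF of_nat_0_le_iff ab]
    by (intro tendsto_exp tendsto_minus expo_diff_tendsto ab)
  ultimately have "prob {\<omega> \<in> space M. T b \<omega> = T a \<omega>} = exp (- (\<theta> * ln (b / a)))"
    by (simp add: LIMSEQ_unique)
  then show ?thesis using ab by (simp add: measure_scale_intensity_Ioc)
qed

section \<open>Jump times\<close>

lemma strict_mono_grid: "a < b \<Longrightarrow> 0 < m \<Longrightarrow> strict_mono_on {..m} (grid a b m)"
  using grid_less by (auto simp: strict_mono_on_def)

text \<open>Refers to finitely many times and is therefore measurable before completion; almost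
  surely it is the event that the chosen cells contain no jump.\<close>

definition no_increment :: "real \<Rightarrow> real \<Rightarrow> nat \<Rightarrow> nat set \<Rightarrow> 'w set" where
  "no_increment a b m S = {\<omega> \<in> space M. \<forall>i\<in>S. T (grid a b m (Suc i)) \<omega> = T (grid a b m i) \<omega>}"

lemma grid_pos: "0 < a \<Longrightarrow> a < b \<Longrightarrow> 0 < grid a b m i"
  using grid_le[of a b 0 i m] by (simp add: grid_0)

lemma no_increment_sets: "0 < a \<Longrightarrow> a < b \<Longrightarrow> S \<subseteq> {..<m} \<Longrightarrow> no_increment a b m S \<in> events"
  unfolding no_increment_def
  by (rule sets.sets_Collect_finite_All) (auto intro: finite_subset simp: grid_pos)

lemma prob_no_increment_grid:
  assumes ab: "0 < a" "a < b" and S: "S \<subseteq> {..<m}"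
  shows "prob (no_increment a b m S) = exp (- (\<Sum>i\<in>S. measure (scale_intensity \<theta>) (cell a b m i)))"
proof (cases "m = 0")
  case True
  then have "S = {}" using S by auto
  then show ?thesis by (simp add: no_increment_def prob_space)
next
  case False
  have fin: "finite S" using S finite_subset by blast
  let ?I = "\<lambda>i \<omega>. T (grid a b m (Suc i)) \<omega> - T (grid a b m i) \<omega>"
  have "prob (no_increment a b m S) = expectation (indicator (no_increment a b m S))"
    using no_increment_sets[OF ab S] by simp
  also have "\<dots> = expectation (\<lambda>\<omega>. \<Prod>i\<in>S. indicator {0} (?I i \<omega>))"
  proof (intro Bochner_Integration.integral_cong refl)
    fix \<omega> assume "\<omega> \<in> space M"
    then show "indicator (no_increment a b m S) \<omega> = (\<Prod>i\<in>S. indicator {0} (?I i \<omega>) :: real)"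
      using fin by (auto simp: no_increment_def indicator_def)
  qed
  also have "\<dots> = (\<Prod>i\<in>S. expectation (\<lambda>\<omega>. indicator {0} (?I i \<omega>)))"
    using ab S strict_mono_grid[OF ab(2)] False
    by (intro indep_increments_prod[of "grid a b m" m S "\<lambda>_. indicator {0}"]) (auto simp: grid_0 indicator_def)
  also have "\<dots> = (\<Prod>i\<in>S. exp (- measure (scale_intensity \<theta>) (cell a b m i)))"
  proof (intro prod.cong refl)
    fix i assume "i \<in> S"
    have less: "grid a b m i < grid a b m (Suc i)" using False by (intro grid_less ab) auto
    note [measurable] = T_measurable[OF grid_pos[OF ab]]
    have "expectation (\<lambda>\<omega>. indicator {0} (?I i \<omega>)) =
        expectation (indicator {\<omega> \<in> space M. T (grid a b m (Suc i)) \<omega> = T (grid a b m i) \<omega>})"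
      by (intro Bochner_Integration.integral_cong) (auto simp: indicator_def)
    also have "\<dots> = prob {\<omega> \<in> space M. T (grid a b m (Suc i)) \<omega> = T (grid a b m i) \<omega>}"
      by simp
    finally show "expectation (\<lambda>\<omega>. indicator {0} (?I i \<omega>)) = exp (- measure (scale_intensity \<theta>) (cell a b m i))"
      using prob_no_increment[OF grid_pos[OF ab] less] by (simp add: cell_def)
  qed
  finally show ?thesis by (simp add: exp_sum fin flip: sum_negf)
qed

abbreviation J :: "'w \<Rightarrow> real set" where
  "J \<omega> \<equiv> jump_times (path \<omega>)"

lemma AE_no_jump_iff:
  assumes ab: "0 < a" "a < b" and S: "S \<subseteq> {..<m}"
  shows "AE \<omega> in M. \<omega> \<in> no_increment a b m S \<longleftrightarrow> (\<forall>i\<in>S. J \<omega> \<inter> cell a b m i = {})"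
  using AE_jump_path AE_space
proof eventually_elim
  case (elim \<omega>)
  interpret jump_path "path \<omega>" by fact
  have "T (grid a b m (Suc i)) \<omega> = T (grid a b m i) \<omega> \<longleftrightarrow> J \<omega> \<inter> cell a b m i = {}" for i
    unfolding cell_def using constant_iff[of "grid a b m i" "grid a b m (Suc i)"] grid_pos[OF ab] grid_le[OF ab(2), of i "Suc i" m]
    by auto
  then show ?case using elim(2) by (simp add: no_increment_def)
qed

lemma interval_void_jump_times: "interval_void_process (completion M) J \<theta>"
proof -
  interpret C: prob_space "completion M" by (rule prob_space_completion)
  have sets: "{\<omega> \<in> space M. \<forall>i\<in>S. J \<omega> \<inter> cell a b m i = {}} \<in> sets (completion M)"
    and AE: "AE \<omega> in completion M. \<omega> \<in> no_increment a b m S \<longleftrightarrow> \<omega> \<in> {\<omega> \<in> space M. \<forall>i\<in>S. J \<omega> \<inter> cell a b m i = {}}"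
    if "0 < a" "a < b" "S \<subseteq> {..<m}" for a b m S
  proof -
    show AE: "AE \<omega> in completion M. \<omega> \<in> no_increment a b m S \<longleftrightarrow> \<omega> \<in> {\<omega> \<in> space M. \<forall>i\<in>S. J \<omega> \<inter> cell a b m i = {}}"
      using AE_completion[OF AE_no_jump_iff[OF that]] AE_completion[OF AE_space]
      by eventually_elim auto
    show "{\<omega> \<in> space M. \<forall>i\<in>S. J \<omega> \<inter> cell a b m i = {}} \<in> sets (completion M)"
      by (rule completion.in_sets_AE[OF AE]) (use no_increment_sets[OF that] in auto)
  qed
  show ?thesis
  proof (unfold_locales, unfold space_completion)
    fix a b :: real and m S assume *: "0 < a" "a < b" "S \<subseteq> {..<m :: nat}"
    show "{\<omega> \<in> space M. \<forall>i\<in>S. J \<omega> \<inter> cell a b m i = {}} \<in> sets (completion M)"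
      by (rule sets[OF *])
    have "C.prob {\<omega> \<in> space M. \<forall>i\<in>S. J \<omega> \<inter> cell a b m i = {}} = C.prob (no_increment a b m S)"
      by (rule measure_eq_AE) (use AE[OF *] sets[OF *] no_increment_sets[OF *] in auto)
    also have "\<dots> = exp (- (\<Sum>i\<in>S. measure (scale_intensity \<theta>) (cell a b m i)))"
      using prob_no_increment_grid[OF *] no_increment_sets[OF *] by simp
    finally show "C.prob {\<omega> \<in> space M. \<forall>i\<in>S. J \<omega> \<inter> cell a b m i = {}} =
      exp (- (\<Sum>i\<in>S. measure (scale_intensity \<theta>) (cell a b m i)))" .
  qed (rule theta_nonneg)
qed

lemma jump_times_poisson: "scale_invariant_poisson_process M J \<theta>"
  unfolding scale_invariant_poisson_process_def
proof (rule void_process.poisson_point_process)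
  show "void_process (completion M) J \<theta>"
    by (rule interval_void_process.void_process) (rule interval_void_jump_times)
qed (auto simp: jump_times_def)

text \<open>Local finiteness does not follow from path regularity: it rests on the finite mean
  number of jump times just established.\<close>

lemma AE_step_path: "AE \<omega> in M. step_path (path \<omega>)"
proof -
  interpret V: void_process "completion M" J \<theta>
    by (rule interval_void_process.void_process) (rule interval_void_jump_times)
  have "AE \<omega> in M. \<forall>a b. 0 < a \<longrightarrow> finite (J \<omega> \<inter> {a..b})"
    using V.AE_locally_finite by (simp add: AE_completion_iff)
  with AE_jump_path show ?thesis
    by eventually_elim (auto simp: step_path_def step_path_axioms_def)
qed

end

section \<open>Jump sizes\<close>

lemma (in complete_measure) measurable_AE_cong:
  assumes f: "f \<in> M \<rightarrow>\<^sub>M N" and AE: "AE x in M. f x = g x" and g: "\<And>x. x \<in> space M \<Longrightarrow> g x \<in> space N"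
  shows "g \<in> M \<rightarrow>\<^sub>M N"
proof (rule measurableI)
  fix A assume A: "A \<in> sets N"
  have "AE x in M. (x \<in> f -` A \<inter> space M) \<longleftrightarrow> (x \<in> g -` A \<inter> space M)"
    using AE by eventually_elim simp
  then show "g -` A \<inter> space M \<in> sets M"
    by (rule in_sets_AE) (use measurable_sets[OF f A] in auto)
qed (rule g)

context ssa_process
begin

abbreviation jump_of :: "'w \<Rightarrow> real \<Rightarrow> real" where
  "jump_of \<omega> s \<equiv> T s \<omega> - left_lim (path \<omega>) s"

context
  fixes a b :: real
  assumes ab: "0 < a" "a < b"
begin

definition increment :: "nat \<Rightarrow> nat \<Rightarrow> 'w \<Rightarrow> real" where
  "increment m i \<omega> = T (grid a b m (Suc i)) \<omega> - T (grid a b m i) \<omega>"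

lemma increment_measurable [measurable]: "increment m i \<in> borel_measurable M"
  unfolding increment_def using T_measurable[OF grid_pos[OF ab]] by measurable

lemma AE_increment_nonneg: "AE \<omega> in M. 0 \<le> increment m i \<omega>"
  using AE_mono[of "grid a b m i" "grid a b m (Suc i)"] grid_pos[OF ab] grid_le[OF ab(2), of i "Suc i" m]
  by (auto simp: increment_def)

lemma AE_sum_increments:
  fixes g :: "real \<Rightarrow> 'b::comm_monoid_add"
  assumes "g 0 = 0"
  shows "AE \<omega> in M. \<forall>\<^sub>F m in sequentially. (\<Sum>i<m. g (increment m i \<omega>)) = (\<Sum>s\<in>J \<omega> \<inter> {a<..b}. g (jump_of \<omega> s))"
  using AE_step_path
proof eventually_elim
  case (elim \<omega>)
  interpret step_path "path \<omega>" by fact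
  show ?case
    using sum_increments_eventually[where g = g, OF ab finite_Ioc[OF ab(1), of b] assms]
    unfolding increment_def jump_def .
qed

text \<open>Counts jumps by size with multiplicity, unlike the set \<open>jump_sizes\<close>. Void
  events do not see multiplicities, so its mean still yields the void probabilities of the
  set.\<close>

definition size_measure :: "'w \<Rightarrow> real measure" where
  "size_measure \<omega> = distr (count_space (J \<omega> \<inter> {a<..b})) borel (jump_of \<omega>)"

lemma sets_size_measure [simp]: "sets (size_measure \<omega>) = sets borel"
  by (simp add: size_measure_def)

lemma nn_integral_size_measure:
  assumes "h \<in> borel_measurable borel" "finite (J \<omega> \<inter> {a<..b})"
  shows "(\<integral>\<^sup>+x. h x \<partial>size_measure \<omega>) = (\<Sum>s\<in>J \<omega> \<inter> {a<..b}. h (jump_of \<omega> s))"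
  using assms by (simp add: size_measure_def nn_integral_distr nn_integral_count_space_finite)

lemma AE_nn_integral_size_measure:
  assumes h: "h \<in> borel_measurable borel" "h 0 = 0"
  shows "AE \<omega> in M. \<forall>\<^sub>F m in sequentially. (\<Sum>i<m. h (increment m i \<omega>)) = (\<integral>\<^sup>+x. h x \<partial>size_measure \<omega>)"
  using AE_sum_increments[of h, OF h(2)] AE_step_path
proof eventually_elim
  case (elim \<omega>)
  interpret step_path "path \<omega>" by fact
  show ?case
    using elim(1) by eventually_elim (simp add: nn_integral_size_measure[OF h(1) finite_Ioc[OF ab(1)]])
qed

text \<open>Sums over increments see only functions vanishing at 0, as cells without a jump
  contribute increment 0. Removing 0 from \<open>A\<close> costs nothing since jumps are
  positive.\<close>

lemma AE_emeasure_size_measure: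
  assumes "A \<in> sets borel"
  shows "AE \<omega> in M. emeasure (size_measure \<omega>) A = (\<integral>\<^sup>+x. indicator (A - {0}) x \<partial>size_measure \<omega>)"
  using AE_step_path
proof eventually_elim
  case (elim \<omega>)
  interpret step_path "path \<omega>" by fact
  have "(\<Sum>s\<in>J \<omega> \<inter> {a<..b}. indicator A (jump_of \<omega> s)) = (\<Sum>s\<in>J \<omega> \<inter> {a<..b}. indicator (A - {0}) (jump_of \<omega> s) :: ennreal)"
  proof (rule sum.cong)
    fix s assume "s \<in> J \<omega> \<inter> {a<..b}"
    then have "jump_of \<omega> s \<noteq> 0" using jump_pos[of s] by (simp add: jump_def)
    then show "indicator A (jump_of \<omega> s) = (indicator (A - {0}) (jump_of \<omega> s) :: ennreal)"
      by (simp add: indicator_def)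
  qed simp
  then have "(\<integral>\<^sup>+x. indicator A x \<partial>size_measure \<omega>) = (\<integral>\<^sup>+x. indicator (A - {0}) x \<partial>size_measure \<omega>)"
    using assms nn_integral_size_measure[OF _ finite_Ioc[OF ab(1)], of "indicator A"]
      nn_integral_size_measure[OF _ finite_Ioc[OF ab(1)], of "indicator (A - {0})"] by simp
  then show ?case using assms by simp
qed

text \<open>The integral is almost surely an eventually constant limit of functions of increments;
  \<open>liminf\<close> supplies a measurable version.\<close>

lemma nn_integral_size_measure_measurable:
  assumes h: "h \<in> borel_measurable borel" "h 0 = 0"
  shows "(\<lambda>\<omega>. \<integral>\<^sup>+x. h x \<partial>size_measure \<omega>) \<in> borel_measurable (completion M)"
proof (rule completion.measurable_AE_cong)
  note [measurable] = h(1)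
  show "(\<lambda>\<omega>. liminf (\<lambda>m. \<Sum>i<m. h (increment m i \<omega>))) \<in> borel_measurable (completion M)"
    by (rule measurable_completion) measurable
  show "AE \<omega> in completion M. liminf (\<lambda>m. \<Sum>i<m. h (increment m i \<omega>)) = (\<integral>\<^sup>+x. h x \<partial>size_measure \<omega>)"
    using AE_completion[OF AE_nn_integral_size_measure[OF h]]
    by eventually_elim (rule lim_imp_Liminf, simp, rule tendsto_eventually)
qed simp

lemma emeasure_size_measure_measurable:
  assumes A: "A \<in> sets borel"
  shows "(\<lambda>\<omega>. emeasure (size_measure \<omega>) A) \<in> borel_measurable (completion M)"
proof (rule completion.measurable_AE_cong)
  show "(\<lambda>\<omega>. \<integral>\<^sup>+x. indicator (A - {0}) x \<partial>size_measure \<omega>) \<in> borel_measurable (completion M)"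
    using A by (intro nn_integral_size_measure_measurable) auto
  show "AE \<omega> in completion M. (\<integral>\<^sup>+x. indicator (A - {0}) x \<partial>size_measure \<omega>) = emeasure (size_measure \<omega>) A"
    using AE_completion[OF AE_emeasure_size_measure[OF A]] by eventually_elim simp
qed simp

definition mean_sizes :: "real measure" where
  "mean_sizes = mean_measure (completion M) borel size_measure"

lemma sets_mean_sizes [simp, measurable_cong]: "sets mean_sizes = sets borel"
  by (simp add: mean_sizes_def)

lemma space_mean_sizes [simp]: "space mean_sizes = UNIV"
  by (simp add: mean_sizes_def)

lemma emeasure_mean_sizes: "A \<in> sets borel \<Longrightarrow> emeasure mean_sizes A = (\<integral>\<^sup>+\<omega>. emeasure (size_measure \<omega>) A \<partial>completion M)"
  unfolding mean_sizes_def by (rule emeasure_mean_measure) (auto intro: emeasure_size_measure_measurable)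

lemma nn_integral_mean_sizes:
  "h \<in> borel_measurable borel \<Longrightarrow> (\<integral>\<^sup>+x. h x \<partial>mean_sizes) = (\<integral>\<^sup>+\<omega>. (\<integral>\<^sup>+x. h x \<partial>size_measure \<omega>) \<partial>completion M)"
  unfolding mean_sizes_def
  using nn_integral_mean_measure[of size_measure borel "completion M" h] emeasure_size_measure_measurable by auto

lemma nn_integral_jump_count: "(\<integral>\<^sup>+\<omega>. npoints (J \<omega>) {a<..b} \<partial>completion M) = ennreal (\<theta> * ln (b / a))"
  using interval_void_process.nn_integral_npoints_Ioc[OF interval_void_jump_times ab]
  by (simp add: scale_intensity_Ioc ab less_imp_le theta_nonneg)

lemma emeasure_mean_sizes_UNIV: "emeasure mean_sizes UNIV = ennreal (\<theta> * ln (b / a))"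
proof -
  have "emeasure (size_measure \<omega>) UNIV = npoints (J \<omega>) {a<..b}" for \<omega>
    by (simp add: size_measure_def emeasure_distr npoints_def emeasure_count_space)
  then show ?thesis by (simp add: emeasure_mean_sizes nn_integral_jump_count)
qed

lemma finite_mean_sizes: "finite_measure mean_sizes"
  by (rule finite_measureI) (simp add: emeasure_mean_sizes_UNIV)

text \<open>Reduces integrals against the mean measure to one-dimensional laws of increments. At
  most as many increments are nonzero as there are jumps, and the number of jumps has finite
  mean.\<close>

lemma sum_increments_tendsto:
  assumes h: "h \<in> borel_measurable borel" "h 0 = 0" "\<And>x. 0 \<le> x \<Longrightarrow> h x \<le> 1"
  shows "(\<lambda>m. \<Sum>i<m. \<integral>\<^sup>+\<omega>. h (increment m i \<omega>) \<partial>M) \<longlonglongrightarrow> (\<integral>\<^sup>+x. h x \<partial>mean_sizes)"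
proof -
  note [measurable] = h(1)
  have "(\<lambda>m. \<integral>\<^sup>+\<omega>. (\<Sum>i<m. h (increment m i \<omega>)) \<partial>completion M) \<longlonglongrightarrow> (\<integral>\<^sup>+\<omega>. (\<integral>\<^sup>+x. h x \<partial>size_measure \<omega>) \<partial>completion M)"
  proof (rule nn_integral_dominated_convergence[where w = "\<lambda>\<omega>. npoints (J \<omega>) {a<..b}"])
    show "(\<lambda>\<omega>. \<Sum>i<m. h (increment m i \<omega>)) \<in> borel_measurable (completion M)" for m
      by (rule measurable_completion) measurable
    show "(\<lambda>\<omega>. \<integral>\<^sup>+x. h x \<partial>size_measure \<omega>) \<in> borel_measurable (completion M)"
      by (rule nn_integral_size_measure_measurable) fact+
    show "(\<lambda>\<omega>. npoints (J \<omega>) {a<..b}) \<in> borel_measurable (completion M)"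
      by (rule interval_void_process.npoints_Ioc_measurable[OF interval_void_jump_times ab])
    show "(\<integral>\<^sup>+\<omega>. npoints (J \<omega>) {a<..b} \<partial>completion M) < \<infinity>"
      by (simp add: nn_integral_jump_count)
    show "AE \<omega> in completion M. (\<lambda>m. \<Sum>i<m. h (increment m i \<omega>)) \<longlonglongrightarrow> (\<integral>\<^sup>+x. h x \<partial>size_measure \<omega>)"
      using AE_completion[OF AE_nn_integral_size_measure[OF h(1,2)]]
      by eventually_elim (rule tendsto_eventually)
    show "AE \<omega> in completion M. (\<Sum>i<m. h (increment m i \<omega>)) \<le> npoints (J \<omega>) {a<..b}" for m
    proof -
      have "AE \<omega> in M. (\<Sum>i<m. h (increment m i \<omega>)) \<le> npoints (J \<omega>) {a<..b}"
        using AE_step_path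
      proof eventually_elim
        case (elim \<omega>)
        interpret step_path "path \<omega>" by fact
        let ?S = "{i. i < m \<and> T (grid a b m (Suc i)) \<omega> \<noteq> T (grid a b m i) \<omega>}"
        have nonneg: "0 \<le> increment m i \<omega>" for i
          unfolding increment_def using mono'[of "grid a b m i" "grid a b m (Suc i)"] grid_pos[OF ab] grid_le[OF ab(2), of i "Suc i" m] by simp
        have "(\<Sum>i<m. h (increment m i \<omega>)) = (\<Sum>i\<in>?S. h (increment m i \<omega>))"
          by (rule sum.mono_neutral_right) (auto simp: increment_def h(2))
        also have "\<dots> \<le> (\<Sum>i\<in>?S. 1)" by (intro sum_mono h(3) nonneg)
        also have "\<dots> = of_nat (card ?S)" by simp
        also have "\<dots> \<le> of_nat (card (J \<omega> \<inter> {a<..b}))"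
          by (intro of_nat_mono card_nonzero_increments_le[OF ab finite_Ioc[OF ab(1)]])
        also have "\<dots> = npoints (J \<omega>) {a<..b}" using finite_Ioc[OF ab(1)] by (simp add: npoints_def)
        finally show ?case .
      qed
      then show ?thesis by (rule AE_completion)
    qed
  qed
  then show ?thesis
    unfolding nn_integral_mean_sizes[OF h(1)] nn_integral_completion by (subst (asm) nn_integral_sum) auto
qed

lemma grid_cell_intensity: "\<theta> * ln (grid a b m (Suc i) / grid a b m i) \<le> \<theta> / a * ((b - a) / real m)" if "0 < m"
  using interval_void_process.cell_intensity[OF interval_void_jump_times ab, of m i]
    measure_scale_intensity_Ioc[OF grid_pos[OF ab] less_imp_le[OF grid_less[OF ab(2) that lessI]]]
  by (simp add: cell_def)

lemma prob_increment_nonzero_le: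
  assumes "i < m"
  shows "prob {\<omega> \<in> space M. increment m i \<omega> \<noteq> 0} \<le> \<theta> / a * ((b - a) / real m)"
proof -
  have m: "0 < m" using assms by simp
  have less: "grid a b m i < grid a b m (Suc i)" by (rule grid_less[OF ab(2) m lessI])
  have "{\<omega> \<in> space M. increment m i \<omega> \<noteq> 0} = space M - {\<omega> \<in> space M. T (grid a b m (Suc i)) \<omega> = T (grid a b m i) \<omega>}"
    by (auto simp: increment_def)
  moreover have "{\<omega> \<in> space M. T (grid a b m (Suc i)) \<omega> = T (grid a b m i) \<omega>} \<in> events"
    using T_measurable[OF grid_pos[OF ab]] by measurable
  ultimately have "prob {\<omega> \<in> space M. increment m i \<omega> \<noteq> 0} = 1 - exp (- measure (scale_intensity \<theta>) {grid a b m i<..grid a b m (Suc i)})"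
    using prob_no_increment[OF grid_pos[OF ab] less] by (simp add: prob_compl)
  also have "\<dots> \<le> measure (scale_intensity \<theta>) {grid a b m i<..grid a b m (Suc i)}"
    by (rule one_minus_exp_bounds) simp
  also have "\<dots> \<le> \<theta> / a * ((b - a) / real m)"
    using grid_cell_intensity[OF m, of i] measure_scale_intensity_Ioc[OF grid_pos[OF ab] less_imp_le[OF less]] by simp
  finally show ?thesis .
qed

text \<open>The increment over a cell has Laplace transform \<open>exp (- \<phi> m i)\<close>. The
  \<open>\<phi> m i\<close> telescope over the grid and form a null array, since
  \<open>\<phi> m i\<close> is at most the mass of the jump measure of that cell.\<close>

lemma laplace_mean_sizes:
  assumes u: "0 \<le> u"
  shows "(\<integral>\<^sup>+x. ennreal (1 - exp (- u * x)) \<partial>mean_sizes) = ennreal (expo (u * b) - expo (u * a))"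
proof -
  define \<phi> where "\<phi> m i = expo (u * grid a b m (Suc i)) - expo (u * grid a b m i)" for m i
  have \<phi>: "0 \<le> \<phi> m i" "\<phi> m i \<le> \<theta> / a * ((b - a) / real m)" if "i < m" for m i
  proof -
    have m: "0 < m" using that by simp
    have g: "0 < grid a b m i" "grid a b m i < grid a b m (Suc i)"
      using grid_pos[OF ab] grid_less[OF ab(2) m lessI] by auto
    interpret finite_measure "jump_measure (grid a b m i) (grid a b m (Suc i))" by (rule finite_jump_measure[OF g])
    have \<phi>_eq: "\<phi> m i = (\<integral>x. 1 - exp (- u * x) \<partial>jump_measure (grid a b m i) (grid a b m (Suc i)))"
      unfolding \<phi>_def by (rule laplace_jump_measure[OF u g, symmetric])
    have bounds: "AE x in jump_measure (grid a b m i) (grid a b m (Suc i)). 0 \<le> 1 - exp (- u * x) \<and> 1 - exp (- u * x) \<le> 1"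
      using AE_jump_measure[OF g] by eventually_elim (use u in simp)
    show "0 \<le> \<phi> m i" unfolding \<phi>_eq using bounds by (intro integral_nonneg_AE) auto
    have "\<phi> m i \<le> (\<integral>x. 1 \<partial>jump_measure (grid a b m i) (grid a b m (Suc i)))"
      unfolding \<phi>_eq
    proof (rule integral_mono_AE)
      show "integrable (jump_measure (grid a b m i) (grid a b m (Suc i))) (\<lambda>x. 1 - exp (- u * x))"
        using bounds by (intro integrable_const_bound[where B = 1]) auto
    qed (use bounds in auto)
    also have "\<dots> = \<theta> * ln (grid a b m (Suc i) / grid a b m i)"
      using g theta_nonneg by (simp add: measure_def emeasure_jump_measure_UNIV)
    also have "\<dots> \<le> \<theta> / a * ((b - a) / real m)" by (rule grid_cell_intensity[OF m])
    finally show "\<phi> m i \<le> \<theta> / a * ((b - a) / real m)" .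
  qed
  have telescope: "(\<Sum>i<m. \<phi> m i) = expo (u * b) - expo (u * a)" if "0 < m" for m
    unfolding \<phi>_def using that
    by (subst sum_lessThan_telescope[of "\<lambda>i. expo (u * grid a b m i)"]) (simp add: grid_0 grid_end)
  have "(\<lambda>m. \<Sum>i<m. 1 - exp (- \<phi> m i)) \<longlonglongrightarrow> expo (u * b) - expo (u * a)"
  proof (rule sum_one_minus_exp_tendsto)
    show "(\<lambda>m. \<theta> / a * ((b - a) / real m)) \<longlonglongrightarrow> 0" using lim_const_over_n[of "\<theta> / a * (b - a)"] by simp
    show "(\<lambda>m. \<Sum>i<m. \<phi> m i) \<longlonglongrightarrow> expo (u * b) - expo (u * a)"
      by (rule tendsto_eventually, rule eventually_mono[OF eventually_gt_at_top[of 0]], rule telescope)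
  qed (use \<phi> in auto)
  then have lim: "(\<lambda>m. ennreal (\<Sum>i<m. 1 - exp (- \<phi> m i))) \<longlonglongrightarrow> ennreal (expo (u * b) - expo (u * a))"
    by (rule tendsto_ennrealI)
  have eq: "(\<integral>\<^sup>+\<omega>. ennreal (1 - exp (- u * increment m i \<omega>)) \<partial>M) = ennreal (1 - exp (- \<phi> m i))" if "i < m" for m i
  proof -
    have m: "0 < m" using that by simp
    have int: "integrable M (\<lambda>\<omega>. exp (- u * increment m i \<omega>))"
      by (rule integrable_exp_neg[OF u increment_measurable AE_increment_nonneg])
    have "(\<integral>\<^sup>+\<omega>. ennreal (1 - exp (- u * increment m i \<omega>)) \<partial>M) = ennreal (expectation (\<lambda>\<omega>. 1 - exp (- u * increment m i \<omega>)))"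
    proof (rule nn_integral_eq_integral)
      show "AE \<omega> in M. 0 \<le> 1 - exp (- u * increment m i \<omega>)"
        using AE_increment_nonneg[of m i] by eventually_elim (use u in simp)
    qed (use int in simp)
    also have "expectation (\<lambda>\<omega>. 1 - exp (- u * increment m i \<omega>)) = 1 - exp (- \<phi> m i)"
      using int laplace_increment[OF u grid_pos[OF ab] grid_less[OF ab(2) m lessI]]
      by (simp add: prob_space \<phi>_def increment_def)
    finally show ?thesis .
  qed
  have "(\<lambda>m. \<Sum>i<m. \<integral>\<^sup>+\<omega>. ennreal (1 - exp (- u * increment m i \<omega>)) \<partial>M) \<longlonglongrightarrow> (\<integral>\<^sup>+x. ennreal (1 - exp (- u * x)) \<partial>mean_sizes)"
  proof (rule sum_increments_tendsto)
    show "ennreal (1 - exp (- u * x)) \<le> 1" for x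
      by (simp add: ennreal_le_1)
  qed auto
  moreover have "(\<Sum>i<m. \<integral>\<^sup>+\<omega>. ennreal (1 - exp (- u * increment m i \<omega>)) \<partial>M) = ennreal (\<Sum>i<m. 1 - exp (- \<phi> m i))" for m
  proof -
    have "(\<Sum>i<m. \<integral>\<^sup>+\<omega>. ennreal (1 - exp (- u * increment m i \<omega>)) \<partial>M) = (\<Sum>i<m. ennreal (1 - exp (- \<phi> m i)))"
      by (intro sum.cong) (simp_all only: eq lessThan_iff)
    also have "\<dots> = ennreal (\<Sum>i<m. 1 - exp (- \<phi> m i))"
      by (rule sum_ennreal) (use \<phi>(1) in auto)
    finally show ?thesis .
  qed
  ultimately show ?thesis using lim by (auto intro: LIMSEQ_unique)
qed

lemma AE_mean_sizes: "AE x in mean_sizes. 0 \<le> x"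
proof -
  have "AE \<omega> in M. emeasure (size_measure \<omega>) {..<0} = 0"
    using AE_step_path
  proof eventually_elim
    case (elim \<omega>)
    interpret step_path "path \<omega>" by fact
    have "(\<integral>\<^sup>+x. indicator {..<0} x \<partial>size_measure \<omega>) = 0"
    proof (subst nn_integral_size_measure[OF _ finite_Ioc[OF ab(1)]])
      show "(\<Sum>s\<in>J \<omega> \<inter> {a<..b}. indicator {..<0} (jump_of \<omega> s)) = (0 :: ennreal)"
      proof (rule sum.neutral, rule ballI)
        fix s assume "s \<in> J \<omega> \<inter> {a<..b}"
        then have "jump_of \<omega> s \<notin> {..<0}" using jump_pos[of s] by (simp add: jump_def)
        then show "indicator {..<0} (jump_of \<omega> s) = (0 :: ennreal)" by simp
      qed
    qed simp
    then show ?case by simp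
  qed
  then have "emeasure mean_sizes {..<0} = (\<integral>\<^sup>+\<omega>. 0 \<partial>completion M)"
    unfolding emeasure_mean_sizes[OF lessThan_borel] by (intro nn_integral_cong_AE AE_completion)
  then have "{..<0} \<in> null_sets mean_sizes" by (auto simp: null_sets_def)
  from AE_not_in[OF this] show ?thesis by eventually_elim simp
qed

lemma mean_sizes_eq: "mean_sizes = jump_measure a b"
proof (rule laplace_transform_unique)
  interpret A: finite_measure mean_sizes by (rule finite_mean_sizes)
  interpret B: finite_measure "jump_measure a b" by (rule finite_jump_measure[OF ab])
  fix n :: nat
  have exp_int: "integrable \<rho> (\<lambda>x. exp (- real n * x))"
    if "finite_measure \<rho>" "sets \<rho> = sets borel" "AE x in \<rho>. 0 \<le> x" for \<rho>
  proof (rule finite_measure.integrable_const_bound[OF that(1), where B = 1])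
    show "AE x in \<rho>. norm (exp (- real n * x)) \<le> 1" using that(3) by eventually_elim simp
    show "(\<lambda>x. exp (- real n * x)) \<in> borel_measurable \<rho>" using that(2) by (simp cong: measurable_cong_sets)
  qed
  have posB: "AE x in jump_measure a b. 0 \<le> x" using AE_jump_measure[OF ab] by eventually_elim simp
  note iA = exp_int[OF finite_mean_sizes sets_mean_sizes AE_mean_sizes]
  note iB = exp_int[OF finite_jump_measure[OF ab] sets_jump_measure posB]
  have "ennreal (\<integral>x. 1 - exp (- real n * x) \<partial>mean_sizes) = (\<integral>\<^sup>+x. ennreal (1 - exp (- real n * x)) \<partial>mean_sizes)"
  proof (rule nn_integral_eq_integral[symmetric])
    show "AE x in mean_sizes. 0 \<le> 1 - exp (- real n * x)"
      using AE_mean_sizes by eventually_elim simp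
  qed (use iA in simp)
  also have "\<dots> = ennreal (expo (real n * b) - expo (real n * a))" by (rule laplace_mean_sizes) simp
  finally have e: "ennreal (\<integral>x. 1 - exp (- real n * x) \<partial>mean_sizes) = ennreal (\<integral>x. 1 - exp (- real n * x) \<partial>jump_measure a b)"
    by (simp only: laplace_jump_measure[OF of_nat_0_le_iff ab])
  have "(\<integral>x. 1 - exp (- real n * x) \<partial>mean_sizes) = (\<integral>x. 1 - exp (- real n * x) \<partial>jump_measure a b)"
  proof -
    have "0 \<le> (\<integral>x. 1 - exp (- real n * x) \<partial>mean_sizes)"
      by (rule integral_nonneg_AE) (use AE_mean_sizes in \<open>auto elim!: eventually_mono\<close>)
    moreover have "0 \<le> (\<integral>x. 1 - exp (- real n * x) \<partial>jump_measure a b)"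
      by (rule integral_nonneg_AE) (use posB in \<open>auto elim!: eventually_mono\<close>)
    ultimately show ?thesis using e by simp
  qed
  \<comment> \<open>Integrals of \<open>1 - exp (- u * x)\<close> do not detect an atom at 0;
    equality of the total masses closes this gap.\<close>
  moreover have "measure mean_sizes UNIV = measure (jump_measure a b) UNIV"
    by (simp add: measure_def emeasure_mean_sizes_UNIV emeasure_jump_measure_UNIV ab)
  ultimately show "(\<integral>x. exp (- real n * x) \<partial>mean_sizes) = (\<integral>x. exp (- real n * x) \<partial>jump_measure a b)"
    using iA iB by simp
next
  show "AE x in jump_measure a b. 0 \<le> x" using AE_jump_measure[OF ab] by eventually_elim simp
qed (auto intro: finite_mean_sizes finite_jump_measure ab AE_mean_sizes)

section \<open>Void probabilities of the jump sizes\<close>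

definition void_sizes :: "real set \<Rightarrow> 'w set" where
  "void_sizes A = {\<omega> \<in> space M. \<forall>s\<in>J \<omega> \<inter> {a<..b}. jump_of \<omega> s \<notin> A}"

text \<open>On fine grids the event says that no increment falls into \<open>A'\<close>.
  Independence turns its probability into a product of \<open>1 - p m i\<close>, and the sums of the
  \<open>p m i\<close> tend to the mean number of jumps with size in \<open>A\<close>.\<close>

lemma void_sizes:
  assumes A: "A \<in> sets borel"
  shows void_sizes_sets: "void_sizes A \<in> sets (completion M)"
    and prob_void_sizes: "measure (completion M) (void_sizes A) = exp (- measure (jump_measure a b) A)"
proof -
  interpret C: prob_space "completion M" by (rule prob_space_completion)
  define A' where "A' = A - {0}"
  define V where "V m = {\<omega> \<in> space M. \<forall>i\<in>{..<m}. increment m i \<omega> \<notin> A'}" for m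
  have Am[measurable]: "A' \<in> sets borel" using A by (simp add: A'_def)
  have V: "V m \<in> events" for m
    unfolding V_def using Am by measurable
  have ev: "AE \<omega> in M. \<forall>\<^sub>F m in sequentially. (\<omega> \<in> V m) = (\<omega> \<in> void_sizes A)"
    using AE_sum_increments[of "indicator A' :: real \<Rightarrow> real", unfolded A'_def, simplified, folded A'_def] AE_step_path AE_space
  proof eventually_elim
    case (elim \<omega>)
    interpret step_path "path \<omega>" by fact
    from elim(1) show ?case
    proof eventually_elim
      case (elim m)
      have "\<omega> \<in> V m \<longleftrightarrow> (\<Sum>i<m. indicator A' (increment m i \<omega>) :: real) = 0"
        using \<open>\<omega> \<in> space M\<close> by (subst sum_nonneg_eq_0_iff) (auto simp: V_def indicator_def)
      also have "\<dots> \<longleftrightarrow> (\<Sum>s\<in>J \<omega> \<inter> {a<..b}. indicator A' (jump_of \<omega> s) :: real) = 0"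
        using elim by simp
      also have "\<dots> \<longleftrightarrow> (\<forall>s\<in>J \<omega> \<inter> {a<..b}. jump_of \<omega> s \<notin> A')"
        using finite_Ioc[OF ab(1)] by (subst sum_nonneg_eq_0_iff) (auto simp: indicator_def)
      also have "\<dots> \<longleftrightarrow> \<omega> \<in> void_sizes A"
        using jump_pos \<open>\<omega> \<in> space M\<close> by (force simp: void_sizes_def jump_def A'_def)
      finally show ?case .
    qed
  qed
  have lim_ind: "AE \<omega> in completion M. (\<lambda>m. indicator (V m) \<omega> :: real) \<longlonglongrightarrow> indicator (void_sizes A) \<omega>"
    using AE_completion[OF ev]
  proof eventually_elim
    case (elim \<omega>)
    then have "\<forall>\<^sub>F m in sequentially. (indicator (V m) \<omega> :: real) = indicator (void_sizes A) \<omega>"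
      by eventually_elim (auto simp: indicator_def)
    then show ?case by (rule tendsto_eventually)
  qed
  have ind_meas: "(indicator (void_sizes A) :: 'w \<Rightarrow> real) \<in> borel_measurable (completion M)"
  proof (rule completion.measurable_AE_cong)
    show "(\<lambda>\<omega>. lim (\<lambda>m. indicator (V m) \<omega> :: real)) \<in> borel_measurable (completion M)"
      using V by (intro borel_measurable_lim_metric borel_measurable_indicator) auto
    show "AE \<omega> in completion M. lim (\<lambda>m. indicator (V m) \<omega> :: real) = indicator (void_sizes A) \<omega>"
      using lim_ind by eventually_elim (rule limI)
  qed simp
  show sets: "void_sizes A \<in> sets (completion M)"
  proof -
    have "void_sizes A = indicator (void_sizes A) -` {1::real} \<inter> space (completion M)"
      by (auto simp: indicator_def void_sizes_def)
    then show ?thesis using measurable_sets[OF ind_meas, of "{1}"] by simp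
  qed
  have "(\<lambda>m. C.expectation (indicator (V m))) \<longlonglongrightarrow> (C.expectation (indicator (void_sizes A)) :: real)"
  proof (rule integral_dominated_convergence[where w = "\<lambda>_. 1"])
    show "indicator (V m) \<in> borel_measurable (completion M)" for m
      using V by (intro borel_measurable_indicator) auto
    show "AE \<omega> in completion M. norm (indicator (V m) \<omega> :: real) \<le> 1" for m
      by (simp add: indicator_def)
  qed (use ind_meas lim_ind in simp_all)
  moreover have "void_sizes A \<inter> space M = void_sizes A" by (auto simp: void_sizes_def)
  ultimately have lim1: "(\<lambda>m. prob (V m)) \<longlonglongrightarrow> measure (completion M) (void_sizes A)"
    using V sets by simp
  define p where "p m i = prob {\<omega> \<in> space M. increment m i \<omega> \<in> A'}" for m i
  have inc_sets: "{\<omega> \<in> space M. increment m i \<omega> \<in> A'} \<in> events" for m i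
    using Am by measurable
  have probV: "prob (V m) = (\<Prod>i<m. 1 - p m i)" for m
  proof (cases "m = 0")
    case True
    then show ?thesis by (simp add: V_def prob_space)
  next
    case False
    have "prob (V m) = expectation (indicator (V m))" using V by simp
    also have "\<dots> = expectation (\<lambda>\<omega>. \<Prod>i<m. indicator (- A') (increment m i \<omega>))"
    proof (intro Bochner_Integration.integral_cong refl)
      fix \<omega> assume \<omega>: "\<omega> \<in> space M"
      show "indicator (V m) \<omega> = (\<Prod>i<m. indicator (- A') (increment m i \<omega>) :: real)"
      proof (cases "\<omega> \<in> V m")
        case True
        then show ?thesis by (simp add: V_def)
      next
        case False
        then obtain i where "i < m" "increment m i \<omega> \<in> A'" using \<omega> by (auto simp: V_def)
        then have "(\<Prod>i<m. indicator (- A') (increment m i \<omega>) :: real) = 0"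
          by (intro prod_zero bexI[of _ i]) simp_all
        then show ?thesis using False by simp
      qed
    qed
    also have "\<dots> = (\<Prod>i<m. expectation (\<lambda>\<omega>. indicator (- A') (increment m i \<omega>)))"
      unfolding increment_def
      using ab strict_mono_grid[OF ab(2)] False Am
      by (intro indep_increments_prod[of "grid a b m" m "{..<m}" "\<lambda>_. indicator (- A')"]) (auto simp: grid_0 indicator_def)
    also have "\<dots> = (\<Prod>i<m. 1 - p m i)"
    proof (intro prod.cong refl)
      fix i
      have "expectation (\<lambda>\<omega>. indicator (- A') (increment m i \<omega>)) = expectation (indicator (space M - {\<omega> \<in> space M. increment m i \<omega> \<in> A'}))"
        by (intro Bochner_Integration.integral_cong) (auto simp: indicator_def)
      also have "\<dots> = prob (space M - {\<omega> \<in> space M. increment m i \<omega> \<in> A'})" using inc_sets by simp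
      also have "\<dots> = 1 - p m i" unfolding p_def by (rule prob_compl[OF inc_sets])
      finally show "expectation (\<lambda>\<omega>. indicator (- A') (increment m i \<omega>)) = 1 - p m i" .
    qed
    finally show ?thesis .
  qed
  have "(\<lambda>m. \<Prod>i<m. 1 - p m i) \<longlonglongrightarrow> exp (- measure (jump_measure a b) A)"
  proof (rule prod_one_minus_tendsto_exp)
    show "(\<lambda>m. \<theta> / a * ((b - a) / real m)) \<longlonglongrightarrow> 0" using lim_const_over_n[of "\<theta> / a * (b - a)"] by simp
    show "p m i \<le> \<theta> / a * ((b - a) / real m)" if "i \<in> {..<m}" for m i
    proof -
      have "p m i \<le> prob {\<omega> \<in> space M. increment m i \<omega> \<noteq> 0}"
        unfolding p_def by (intro finite_measure_mono) (auto simp: A'_def)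
      also have "\<dots> \<le> \<theta> / a * ((b - a) / real m)" using that by (intro prob_increment_nonzero_le) simp
      finally show ?thesis .
    qed
    have lim: "(\<lambda>m. \<Sum>i<m. \<integral>\<^sup>+\<omega>. indicator A' (increment m i \<omega>) \<partial>M) \<longlonglongrightarrow> (\<integral>\<^sup>+x. indicator A' x \<partial>mean_sizes)"
    proof (rule sum_increments_tendsto)
      show "(indicator A' :: real \<Rightarrow> ennreal) \<in> borel_measurable borel" using Am by (rule borel_measurable_indicator)
    qed (auto simp: indicator_def A'_def)
    have "(\<integral>\<^sup>+x. indicator A' x \<partial>mean_sizes) = emeasure mean_sizes A"
    proof -
      have "(\<integral>\<^sup>+x. indicator A' x \<partial>mean_sizes) = (\<integral>\<^sup>+\<omega>. (\<integral>\<^sup>+x. indicator A' x \<partial>size_measure \<omega>) \<partial>completion M)"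
        using Am by (intro nn_integral_mean_sizes) auto
      also have "\<dots> = (\<integral>\<^sup>+\<omega>. emeasure (size_measure \<omega>) A \<partial>completion M)"
        using AE_completion[OF AE_emeasure_size_measure[OF A, folded A'_def]] by (intro nn_integral_cong_AE) auto
      finally show ?thesis by (simp add: emeasure_mean_sizes[OF A])
    qed
    moreover have "(\<Sum>i<m. \<integral>\<^sup>+\<omega>. indicator A' (increment m i \<omega>) \<partial>M) = ennreal (\<Sum>i<m. p m i)" for m
    proof -
      have "(\<integral>\<^sup>+\<omega>. indicator A' (increment m i \<omega>) \<partial>M) = ennreal (p m i)" for i
      proof -
        have "(\<integral>\<^sup>+\<omega>. indicator A' (increment m i \<omega>) \<partial>M) = (\<integral>\<^sup>+\<omega>. indicator {\<omega> \<in> space M. increment m i \<omega> \<in> A'} \<omega> \<partial>M)"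
          by (intro nn_integral_cong) (auto simp: indicator_def)
        then show ?thesis using inc_sets[of m i] by (simp only: nn_integral_indicator p_def emeasure_eq_measure)
      qed
      then show ?thesis by (simp add: p_def sum_ennreal)
    qed
    ultimately have "(\<lambda>m. ennreal (\<Sum>i<m. p m i)) \<longlonglongrightarrow> ennreal (measure (jump_measure a b) A)"
      using lim finite_measure.emeasure_eq_measure[OF finite_jump_measure[OF ab]] by (simp add: mean_sizes_eq)
    then show "(\<lambda>m. \<Sum>i<m. p m i) \<longlonglongrightarrow> measure (jump_measure a b) A"
      by (subst (asm) tendsto_ennreal_iff) (auto simp: p_def intro!: sum_nonneg always_eventually)
  qed (auto simp: p_def)
  then have "(\<lambda>m. prob (V m)) \<longlonglongrightarrow> exp (- measure (jump_measure a b) A)" by (simp only: probV)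
  with lim1 show "measure (completion M) (void_sizes A) = exp (- measure (jump_measure a b) A)"
    by (rule LIMSEQ_unique)
qed

end

text \<open>The void events over growing time windows decrease to the void event over all times, and
  their exponents converge by \<open>jump_measure_tendsto\<close>.\<close>

lemma void_jump_sizes: "void_process (completion M) (\<lambda>\<omega>. jump_sizes (path \<omega>)) \<theta>"
proof -
  interpret C: prob_space "completion M" by (rule prob_space_completion)
  have ab: "0 < 1 / real (n + 2)" "1 / real (n + 2) < real (n + 2)" for n
    by (auto intro: less_le_trans[of _ 1])
  define W where "W A n = void_sizes (1 / real (n + 2)) (real (n + 2)) A" for A n
  note W_def' = W_def void_sizes_def[OF ab]
  have W: "W A n \<in> sets (completion M)"
    "C.prob (W A n) = exp (- measure (jump_measure (1 / real (n + 2)) (real (n + 2))) A)" if "A \<in> sets borel" for A n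
    unfolding W_def using void_sizes_sets[OF ab that] prob_void_sizes[OF ab that] by auto
  \<comment> \<open>The index is shifted because \<open>window 0\<close> is empty, whereas
    \<open>void_sizes\<close> needs a nondegenerate time interval.\<close>
  have window: "window (Suc n) = {1 / real (n + 2)<..real (n + 2)}" for n
    by (simp add: window_def)
  have dec: "decseq (W A)" for A
  proof (rule decseq_SucI)
    fix n
    have "window (Suc n) \<subseteq> window (Suc (Suc n))" using incseq_window by (simp add: incseq_Suc_iff)
    then show "W A (Suc n) \<subseteq> W A n" unfolding W_def' window[symmetric] by auto
  qed
  have Int: "(\<Inter>n. W A n) = {\<omega> \<in> space M. jump_sizes (path \<omega>) \<inter> A = {}}" for A
  proof -
    have "(\<Union>n. window (Suc n)) = {0<..}"
    proof -
      have "window n \<subseteq> window (Suc n)" for n using incseq_window by (simp add: incseq_Suc_iff)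
      then have "(\<Union>n. window n) \<subseteq> (\<Union>n. window (Suc n))" by (rule UN_mono[OF subset_refl])
      moreover have "(\<Union>n. window (Suc n)) \<subseteq> {0<..}" by (intro UN_least window_subset)
      ultimately show ?thesis by (simp add: UN_window)
    qed
    then have "\<exists>n. s \<in> window (Suc n)" if "s \<in> J \<omega>" for s \<omega>
      using that by (auto simp: jump_times_def)
    then have "(\<Inter>n. W A n) = {\<omega> \<in> space M. \<forall>s\<in>J \<omega>. jump_of \<omega> s \<notin> A}"
      unfolding W_def' window[symmetric] by blast
    also have "jump_sizes (path \<omega>) = jump_of \<omega> ` J \<omega>" for \<omega>
      by (auto simp: jump_sizes_def jump_times_def)
    then have "{\<omega> \<in> space M. \<forall>s\<in>J \<omega>. jump_of \<omega> s \<notin> A} = {\<omega> \<in> space M. jump_sizes (path \<omega>) \<inter> A = {}}"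
      by auto
    finally show ?thesis .
  qed
  show ?thesis
  proof (unfold_locales, unfold space_completion)
    fix B :: "real set" and c d :: real assume B: "B \<in> sets borel" "B \<subseteq> {c<..d}" "0 < c"
    show "{\<omega> \<in> space M. jump_sizes (path \<omega>) \<inter> B = {}} \<in> sets (completion M)"
      unfolding Int[symmetric] using W(1)[OF B(1)] by auto
    have fin: "emeasure (scale_intensity \<theta>) B < \<infinity>"
      by (rule scale_intensity_bounded[OF B theta_nonneg])
    have "(\<lambda>n. C.prob (W B n)) \<longlonglongrightarrow> C.prob (\<Inter>n. W B n)"
      by (rule C.finite_Lim_measure_decseq[OF _ dec]) (use W(1)[OF B(1)] in auto)
    moreover have "(\<lambda>n. measure (jump_measure (1 / real (n + 2)) (real (n + 2))) B) \<longlonglongrightarrow> measure (scale_intensity \<theta>) B"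
    proof (unfold measure_def, rule tendsto_enn2real)
      have "ennreal (enn2real (emeasure (scale_intensity \<theta>) B)) = emeasure (scale_intensity \<theta>) B"
        using fin by (intro ennreal_enn2real) simp
      then show "(\<lambda>n. emeasure (jump_measure (1 / real (n + 2)) (real (n + 2))) B)
          \<longlonglongrightarrow> ennreal (enn2real (emeasure (scale_intensity \<theta>) B))"
        using jump_measure_tendsto[OF B(1)] by (simp only:)
    qed simp
    then have "(\<lambda>n. C.prob (W B n)) \<longlonglongrightarrow> exp (- measure (scale_intensity \<theta>) B)"
      unfolding W(2)[OF B(1)] by (intro tendsto_exp tendsto_minus)
    ultimately show "C.prob {\<omega> \<in> space M. jump_sizes (path \<omega>) \<inter> B = {}} = exp (- measure (scale_intensity \<theta>) B)"
      unfolding Int by (rule LIMSEQ_unique)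
  qed (rule theta_nonneg)
qed

lemma jump_sizes_poisson: "scale_invariant_poisson_process M (\<lambda>\<omega>. jump_sizes (path \<omega>)) \<theta>"
  unfolding scale_invariant_poisson_process_def
  by (rule void_process.poisson_point_process[OF void_jump_sizes]) (auto simp: jump_sizes_def)

end

section \<open>Random countable sets\<close>

text \<open>Each point is counted at the first index that enumerates it. This makes the number of
  points of a randomly enumerated set measurable.\<close>

lemma count_range:
  fixes x :: "nat \<Rightarrow> 'a"
  shows "emeasure (count_space UNIV) (range x \<inter> B) = (\<Sum>n. if x n \<in> B \<and> (\<forall>j<n. x j \<noteq> x n) then 1 else 0)"
proof -
  define N where "N = {n. x n \<in> B \<and> (\<forall>j<n. x j \<noteq> x n)}"
  have "bij_betw x N (range x \<inter> B)"
    unfolding bij_betw_def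
  proof
    show "inj_on x N"
    proof (rule linorder_inj_onI)
      fix i j assume "i < j" "i \<in> N" "j \<in> N"
      then show "x i \<noteq> x j" by (auto simp: N_def)
    qed auto
    show "x ` N = range x \<inter> B"
    proof safe
      fix n assume n: "x n \<in> B"
      define l where "l = (LEAST j. x j = x n)"
      have l: "x l = x n" unfolding l_def by (rule LeastI) simp
      moreover have "x j \<noteq> x l" if "j < l" for j
        using not_less_Least[of j "\<lambda>j. x j = x n"] that l by (simp add: l_def)
      ultimately have "l \<in> N" using n by (simp add: N_def)
      then show "x n \<in> x ` N" using l by (intro image_eqI[of _ _ l]) auto
    qed (auto simp: N_def)
  qed
  then have "finite (range x \<inter> B) = finite N" "card (range x \<inter> B) = card N"
    using bij_betw_finite bij_betw_same_card by metis+
  then have "emeasure (count_space UNIV) (range x \<inter> B) = emeasure (count_space UNIV) N"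
    by (cases "finite N") auto
  also have "\<dots> = (\<integral>\<^sup>+n. indicator N n \<partial>count_space UNIV)" by simp
  also have "\<dots> = (\<Sum>n. indicator N n)" by (rule nn_integral_count_space_nat)
  also have "\<dots> = (\<Sum>n. if x n \<in> B \<and> (\<forall>j<n. x j \<noteq> x n) then 1 else 0)"
    by (intro suminf_cong) (auto simp: N_def)
  finally show ?thesis .
qed

lemma npoints_range_measurable:
  fixes x :: "nat \<Rightarrow> 'w \<Rightarrow> real"
  assumes [measurable]: "\<And>n. x n \<in> borel_measurable N" and [measurable]: "\<And>n. Measurable.pred N (\<lambda>\<omega>. x n \<omega> \<in> B \<omega>)"
  shows "(\<lambda>\<omega>. npoints (range (\<lambda>n. x n \<omega>)) (B \<omega>)) \<in> borel_measurable N"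
  unfolding npoints_def count_range by measurable

lemma mult_image_Int_pos:
  fixes c :: real
  assumes "0 < c"
  shows "(*) c ` (A \<inter> {0<..}) = (*) c ` A \<inter> {0<..}"
  using assms by (auto simp: zero_less_mult_iff)

text \<open>A signed count: at least one of the two intervals is empty, and moving downwards counts
  negatively.\<close>

definition crossing :: "real set \<Rightarrow> real \<Rightarrow> real \<Rightarrow> real" where
  "crossing A p q = enn2real (npoints A {p<..q}) - enn2real (npoints A {q<..p})"

text \<open>For a locally finite set, the signed count is a difference of values of the counting
  function \<open>h\<close> based below all three points.\<close>

lemma crossing_cocycle:
  assumes fin: "\<And>l h. 0 < l \<Longrightarrow> finite (A \<inter> {l..h})" and pos: "0 < p" "0 < q" "0 < r"
  shows "crossing A p q + crossing A q r = crossing A p r"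
proof -
  define l where "l = min p (min q r)"
  have l: "0 < l" "l \<le> p" "l \<le> q" "l \<le> r" using pos by (auto simp: l_def)
  have finI: "finite (A \<inter> {x<..y})" if "l \<le> x" for x y
    by (rule finite_subset[OF _ fin[OF l(1), of y]]) (use that in auto)
  define h where "h x = real (card (A \<inter> {l<..x}))" for x
  have np: "enn2real (npoints A {x<..y}) = real (card (A \<inter> {x<..y}))" if "l \<le> x" for x y
    using finI[OF that] by (simp add: npoints_def ennreal_of_nat_eq_real_of_nat)
  have add: "real (card (A \<inter> {x<..y})) = h y - h x" if "l \<le> x" "x \<le> y" for x y
  proof -
    have "A \<inter> {l<..y} = (A \<inter> {l<..x}) \<union> (A \<inter> {x<..y})" using that by auto
    moreover have "card ((A \<inter> {l<..x}) \<union> (A \<inter> {x<..y})) = card (A \<inter> {l<..x}) + card (A \<inter> {x<..y})"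
      using finI that by (intro card_Un_disjoint) auto
    ultimately show ?thesis by (simp add: h_def)
  qed
  have "crossing A x y = h y - h x" if "l \<le> x" "l \<le> y" for x y
    using that add[of x y] add[of y x] by (cases "x \<le> y") (auto simp: crossing_def np npoints_def[of _ "{}"])
  then show ?thesis using l by simp
qed

text \<open>
  \<open>X\<close> and \<open>Y\<close> need not be integrable, but the positive part of \<open>X - Y = V - U\<close> is dominated by
  \<open>V\<close>; truncating \<open>X\<close> and \<open>Y\<close> at the same level then shows that the mean of \<open>X - Y\<close> is 0.
\<close>

lemma (in prob_space) mean_eq_of_same_law:
  fixes X Y U V :: "'a \<Rightarrow> real"
  assumes [measurable]: "X \<in> borel_measurable M" "Y \<in> borel_measurable M" "U \<in> borel_measurable M" "V \<in> borel_measurable M"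
    and law: "distr M borel X = distr M borel Y"
    and nonneg: "\<And>\<omega>. 0 \<le> U \<omega>" "\<And>\<omega>. 0 \<le> V \<omega>" and V: "integrable M V"
    and eq: "AE \<omega> in M. U \<omega> + X \<omega> = Y \<omega> + V \<omega>"
  shows "(\<integral>\<^sup>+\<omega>. ennreal (U \<omega>) \<partial>M) = (\<integral>\<^sup>+\<omega>. ennreal (V \<omega>) \<partial>M)"
proof -
  define clip where "clip n x = max (- real n) (min (real n) x)" for n and x :: real
  have [measurable]: "clip n \<in> borel_measurable borel" for n unfolding clip_def by measurable
  \<comment> \<open>Clipping is monotone and does not increase distances, so \<open>P n\<close> and
    \<open>Q n\<close> lie below the positive and negative parts of \<open>X - Y\<close>; for each
    \<open>\<omega>\<close> they eventually equal them.\<close>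
  define P where "P n \<omega> = max 0 (clip n (X \<omega>) - clip n (Y \<omega>))" for n \<omega>
  define Q where "Q n \<omega> = max 0 (clip n (Y \<omega>) - clip n (X \<omega>))" for n \<omega>
  define Wp where "Wp \<omega> = max 0 (X \<omega> - Y \<omega>)" for \<omega>
  define Wm where "Wm \<omega> = max 0 (Y \<omega> - X \<omega>)" for \<omega>
  have [measurable]: "P n \<in> borel_measurable M" "Q n \<in> borel_measurable M" "Wp \<in> borel_measurable M" "Wm \<in> borel_measurable M" for n
    unfolding P_def Q_def Wp_def Wm_def by measurable
  have le: "0 \<le> P n \<omega>" "0 \<le> Q n \<omega>" "P n \<omega> \<le> Wp \<omega>" "Q n \<omega> \<le> Wm \<omega>" "P n \<omega> \<le> 2 * real n" "Q n \<omega> \<le> 2 * real n" for n \<omega>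
    by (auto simp: P_def Q_def Wp_def Wm_def clip_def max_def min_def)
  have lim: "(\<lambda>n. P n \<omega>) \<longlonglongrightarrow> Wp \<omega>" "(\<lambda>n. Q n \<omega>) \<longlonglongrightarrow> Wm \<omega>" for \<omega>
  proof -
    obtain N :: nat where N: "max \<bar>X \<omega>\<bar> \<bar>Y \<omega>\<bar> < real N" using reals_Archimedean2 by blast
    have "clip n (X \<omega>) = X \<omega>" "clip n (Y \<omega>) = Y \<omega>" if "N \<le> n" for n
    proof -
      have "\<bar>X \<omega>\<bar> < real n" "\<bar>Y \<omega>\<bar> < real n" using N that by simp_all
      then show "clip n (X \<omega>) = X \<omega>" "clip n (Y \<omega>) = Y \<omega>" by (auto simp: clip_def)
    qed
    then have "\<forall>\<^sub>F n in sequentially. P n \<omega> = Wp \<omega>" "\<forall>\<^sub>F n in sequentially. Q n \<omega> = Wm \<omega>"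
      by (auto simp: eventually_sequentially P_def Q_def Wp_def Wm_def intro!: exI[of _ N])
    then show "(\<lambda>n. P n \<omega>) \<longlonglongrightarrow> Wp \<omega>" "(\<lambda>n. Q n \<omega>) \<longlonglongrightarrow> Wm \<omega>" by (auto intro: tendsto_eventually)
  qed
  have int: "integrable M (P n)" "integrable M (Q n)" for n
    using le by (auto intro!: integrable_const_bound[where B = "2 * real n"])
  have PQ: "expectation (P n) = expectation (Q n)" for n
  proof -
    have clip_int: "integrable M (\<lambda>\<omega>. clip n (Z \<omega>))" if [measurable]: "Z \<in> borel_measurable M" for Z
      by (rule integrable_const_bound[where B = "real n"]) (auto simp: clip_def)
    have "expectation (\<lambda>\<omega>. clip n (X \<omega>)) = (\<integral>x. clip n x \<partial>distr M borel X)" by (simp add: integral_distr)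
    also have "\<dots> = expectation (\<lambda>\<omega>. clip n (Y \<omega>))" unfolding law by (simp add: integral_distr)
    finally have "expectation (\<lambda>\<omega>. clip n (X \<omega>) - clip n (Y \<omega>)) = 0"
      using clip_int by simp
    moreover have "(\<lambda>\<omega>. clip n (X \<omega>) - clip n (Y \<omega>)) = (\<lambda>\<omega>. P n \<omega> - Q n \<omega>)"
      by (auto simp: P_def Q_def fun_eq_iff)
    ultimately show ?thesis using int by simp
  qed
  have WpV: "AE \<omega> in M. Wp \<omega> \<le> V \<omega>"
    using eq by eventually_elim (use nonneg in \<open>auto simp: Wp_def\<close>, smt (verit, best))
  have Wp_int: "integrable M Wp"
    by (rule Bochner_Integration.integrable_bound[OF V]) (use WpV nonneg in \<open>auto elim!: eventually_mono simp: Wp_def\<close>)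
  have EP: "(\<lambda>n. expectation (P n)) \<longlonglongrightarrow> expectation Wp"
  proof (rule integral_dominated_convergence[where w = Wp])
    show "AE \<omega> in M. norm (P n \<omega>) \<le> Wp \<omega>" for n using le by simp
  qed (use lim Wp_int in auto)
  have nnQ: "(\<integral>\<^sup>+\<omega>. ennreal (Q n \<omega>) \<partial>M) = ennreal (expectation (P n))" for n
    unfolding PQ using int le by (intro nn_integral_eq_integral) auto
  have limQ: "(\<lambda>n. \<integral>\<^sup>+\<omega>. ennreal (Q n \<omega>) \<partial>M) \<longlonglongrightarrow> ennreal (expectation Wp)"
    unfolding nnQ by (rule tendsto_ennrealI[OF EP])
  \<comment> \<open>No integrable bound on \<open>Wm\<close> is known yet, so its integral is
    trapped by Fatou's lemma and by \<open>Q n \<le> Wm\<close>.\<close>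
  have Wm: "(\<integral>\<^sup>+\<omega>. ennreal (Wm \<omega>) \<partial>M) = ennreal (expectation Wp)"
  proof (rule antisym)
    have "(\<integral>\<^sup>+\<omega>. ennreal (Wm \<omega>) \<partial>M) = (\<integral>\<^sup>+\<omega>. liminf (\<lambda>n. ennreal (Q n \<omega>)) \<partial>M)"
      by (intro nn_integral_cong, rule lim_imp_Liminf[symmetric], simp) (rule tendsto_ennrealI, rule lim(2))
    also have "\<dots> \<le> liminf (\<lambda>n. \<integral>\<^sup>+\<omega>. ennreal (Q n \<omega>) \<partial>M)" by (rule nn_integral_liminf) simp
    also have "\<dots> = ennreal (expectation Wp)" by (rule lim_imp_Liminf[OF _ limQ]) simp
    finally show "(\<integral>\<^sup>+\<omega>. ennreal (Wm \<omega>) \<partial>M) \<le> ennreal (expectation Wp)" .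
    show "ennreal (expectation Wp) \<le> (\<integral>\<^sup>+\<omega>. ennreal (Wm \<omega>) \<partial>M)"
      by (rule LIMSEQ_le_const2[OF limQ]) (use le in \<open>auto intro!: nn_integral_mono ennreal_leI\<close>)
  qed
  have Wp': "(\<integral>\<^sup>+\<omega>. ennreal (Wp \<omega>) \<partial>M) = ennreal (expectation Wp)"
  proof (rule nn_integral_eq_integral[OF Wp_int])
    show "AE \<omega> in M. 0 \<le> Wp \<omega>" by (simp add: Wp_def)
  qed
  \<comment> \<open>Written with additions only, the identity lives in \<open>ennreal\<close>; the
    equal and finite means of \<open>Wp\<close> and \<open>Wm\<close> then cancel.\<close>
  have "(\<integral>\<^sup>+\<omega>. ennreal (U \<omega>) \<partial>M) + (\<integral>\<^sup>+\<omega>. ennreal (Wp \<omega>) \<partial>M) = (\<integral>\<^sup>+\<omega>. ennreal (U \<omega>) + ennreal (Wp \<omega>) \<partial>M)"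
    by (rule nn_integral_add[symmetric]) auto
  also have "\<dots> = (\<integral>\<^sup>+\<omega>. ennreal (V \<omega>) + ennreal (Wm \<omega>) \<partial>M)"
  proof (rule nn_integral_cong_AE)
    show "AE \<omega> in M. ennreal (U \<omega>) + ennreal (Wp \<omega>) = ennreal (V \<omega>) + ennreal (Wm \<omega>)"
      using eq
    proof eventually_elim
      case (elim \<omega>)
      then have "U \<omega> + Wp \<omega> = V \<omega> + Wm \<omega>" by (auto simp: Wp_def Wm_def max_def)
      moreover have "0 \<le> Wp \<omega>" "0 \<le> Wm \<omega>" by (auto simp: Wp_def Wm_def)
      ultimately show ?case using nonneg[of \<omega>] by (metis ennreal_plus)
    qed
  qed
  also have "\<dots> = (\<integral>\<^sup>+\<omega>. ennreal (V \<omega>) \<partial>M) + (\<integral>\<^sup>+\<omega>. ennreal (Wm \<omega>) \<partial>M)"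
    by (rule nn_integral_add) auto
  finally show ?thesis unfolding Wp' Wm by simp
qed

section \<open>The range\<close>

context ssa_process
begin

section \<open>The range as a function of the path at rational times\<close>

definition posrat :: "real set" where
  "posrat = \<rat> \<inter> {0<..}"

lemma posrat: "countable posrat" "posrat \<subseteq> {0<..}" "1 \<in> posrat"
  by (auto simp: posrat_def countable_rat)

lemma posrat_dense: "0 < s \<Longrightarrow> s < t \<Longrightarrow> \<exists>q\<in>posrat. s < q \<and> q < t"
  using Rats_dense_in_real[of s t] by (auto simp: posrat_def)

definition rat_path :: "real \<Rightarrow> 'w \<Rightarrow> real \<Rightarrow> real" where
  "rat_path c \<omega> = (\<lambda>q\<in>posrat. T (c * q) \<omega>)"

abbreviation path_space :: "(real \<Rightarrow> real) measure" where
  "path_space \<equiv> PiM posrat (\<lambda>_. borel)"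

lemma rat_path_measurable [measurable]:
  assumes "0 < c"
  shows "rat_path c \<in> M \<rightarrow>\<^sub>M path_space"
  unfolding rat_path_def
proof (rule measurable_restrict)
  fix q assume "q \<in> posrat"
  then have "0 < c * q" using assms posrat(2) by auto
  then show "T (c * q) \<in> borel_measurable M" by (rule T_measurable)
qed

lemma scale_measurable [measurable]: "(\<lambda>y. \<lambda>q\<in>posrat. c * y q) \<in> path_space \<rightarrow>\<^sub>M path_space" for c :: real
  by measurable

text \<open>Lifts self-similarity from finitely many times to a countable family: cylinder sets
  determine a finite measure on the product space.\<close>

lemma distr_rat_path:
  assumes c: "0 < c"
  shows "distr M path_space (rat_path c) = distr M path_space (\<lambda>\<omega>. \<lambda>q\<in>posrat. c * rat_path 1 \<omega> q)"
proof (rule measure_eqI_PiM_infinite)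
  have m: "rat_path c \<in> M \<rightarrow>\<^sub>M path_space" "(\<lambda>\<omega>. \<lambda>q\<in>posrat. c * rat_path 1 \<omega> q) \<in> M \<rightarrow>\<^sub>M path_space"
    using c by measurable
  show "finite_measure (distr M path_space (rat_path c))"
    by (rule finite_measure_distr[OF m(1)])
  fix A :: "real \<Rightarrow> real set" and K assume K: "finite K" "K \<subseteq> posrat" and A: "\<And>i. i \<in> K \<Longrightarrow> A i \<in> sets borel"
  have K0: "K \<subseteq> {0<..}" using K posrat by auto
  let ?P = "PiM K (\<lambda>_. borel) :: (real \<Rightarrow> real) measure"
  have mK: "(\<lambda>\<omega>. \<lambda>s\<in>K. T (c * s) \<omega>) \<in> M \<rightarrow>\<^sub>M ?P" "(\<lambda>\<omega>. \<lambda>s\<in>K. c * T s \<omega>) \<in> M \<rightarrow>\<^sub>M ?P"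
    using K0 c by (auto intro!: measurable_restrict)
  have E: "Pi\<^sub>E K A \<in> sets ?P" using K A by (intro sets_PiM_I_finite) auto
  have emb: "prod_emb posrat (\<lambda>_. borel) K (Pi\<^sub>E K A) \<in> sets path_space"
    using K A by (intro sets_PiM_I) auto
  have law: "distr M ?P (\<lambda>\<omega>. \<lambda>s\<in>K. T (c * s) \<omega>) = distr M ?P (\<lambda>\<omega>. \<lambda>s\<in>K. c * T s \<omega>)"
    using ssa c K(1) K0 by (auto simp: SSA_process_def self_similar_def)
  have "emeasure (distr M path_space (rat_path c)) (prod_emb posrat (\<lambda>_. borel) K (Pi\<^sub>E K A))
    = emeasure M (rat_path c -` prod_emb posrat (\<lambda>_. borel) K (Pi\<^sub>E K A) \<inter> space M)"
    by (rule emeasure_distr[OF m(1) emb])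
  also have "rat_path c -` prod_emb posrat (\<lambda>_. borel) K (Pi\<^sub>E K A) \<inter> space M = (\<lambda>\<omega>. \<lambda>s\<in>K. T (c * s) \<omega>) -` Pi\<^sub>E K A \<inter> space M"
    using K(2) by (auto simp: prod_emb_def rat_path_def PiE_iff subset_iff)
  also have "emeasure M \<dots> = emeasure (distr M ?P (\<lambda>\<omega>. \<lambda>s\<in>K. c * T s \<omega>)) (Pi\<^sub>E K A)"
    using emeasure_distr[OF mK(1) E] law by simp
  also have "\<dots> = emeasure M ((\<lambda>\<omega>. \<lambda>s\<in>K. c * T s \<omega>) -` Pi\<^sub>E K A \<inter> space M)"
    by (rule emeasure_distr[OF mK(2) E])
  also have "(\<lambda>\<omega>. \<lambda>s\<in>K. c * T s \<omega>) -` Pi\<^sub>E K A \<inter> space M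
      = (\<lambda>\<omega>. \<lambda>q\<in>posrat. c * rat_path 1 \<omega> q) -` prod_emb posrat (\<lambda>_. borel) K (Pi\<^sub>E K A) \<inter> space M"
    using K(2) by (auto simp: prod_emb_def rat_path_def PiE_iff subset_iff)
  also have "emeasure M \<dots> = emeasure (distr M path_space (\<lambda>\<omega>. \<lambda>q\<in>posrat. c * rat_path 1 \<omega> q)) (prod_emb posrat (\<lambda>_. borel) K (Pi\<^sub>E K A))"
    by (rule emeasure_distr[OF m(2) emb, symmetric])
  finally show "emeasure (distr M path_space (rat_path c)) (prod_emb posrat (\<lambda>_. borel) K (Pi\<^sub>E K A))
    = emeasure (distr M path_space (\<lambda>\<omega>. \<lambda>q\<in>posrat. c * rat_path 1 \<omega> q)) (prod_emb posrat (\<lambda>_. borel) K (Pi\<^sub>E K A))" .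
qed simp_all

definition pos_values :: "(real \<Rightarrow> real) \<Rightarrow> real set" where
  "pos_values y = y ` posrat \<inter> {0<..}"

lemma npoints_pos_values_measurable:
  assumes B: "\<And>y. B y \<subseteq> {0<..}" and m: "\<And>q. q \<in> posrat \<Longrightarrow> Measurable.pred path_space (\<lambda>y. y q \<in> B y)"
  shows "(\<lambda>y. npoints (pos_values y) (B y)) \<in> borel_measurable path_space"
proof -
  define e where "e = from_nat_into posrat"
  have e: "range e = posrat" unfolding e_def using posrat by (intro range_from_nat_into) auto
  then have e_in: "e n \<in> posrat" for n by auto
  have "pos_values y \<inter> B y = range (\<lambda>n. y (e n)) \<inter> B y" for y
    using B[of y] by (auto simp: pos_values_def e[symmetric])
  then have eq: "npoints (pos_values y) (B y) = npoints (range (\<lambda>n. y (e n))) (B y)" for y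
    by (simp add: npoints_def)
  show ?thesis
    unfolding eq using e_in m by (intro npoints_range_measurable) (auto intro: measurable_component_singleton)
qed

lemma pos_values_measurable: "pos_values \<in> path_space \<rightarrow>\<^sub>M point_configs"
  unfolding measurable_point_configs_iff
proof (intro ballI impI)
  fix B :: "real set" assume B: "B \<in> sets borel" "B \<subseteq> {0<..}"
  show "(\<lambda>y. npoints (pos_values y) B) \<in> borel_measurable path_space"
  proof (rule npoints_pos_values_measurable)
    fix q assume "q \<in> posrat"
    then have [measurable]: "(\<lambda>y. y q) \<in> path_space \<rightarrow>\<^sub>M borel" by (rule measurable_component_singleton)
    show "Measurable.pred path_space (\<lambda>y. y q \<in> B)" using B(1) by measurable
  qed (rule B)
qed

abbreviation R :: "'w \<Rightarrow> real set" where
  "R \<omega> \<equiv> path_range (path \<omega>)"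

text \<open>Multiples of the positive rationals by \<open>c\<close> are dense too, so every time
  scale recovers the same range. The freedom in \<open>c\<close> is what turns self-similarity of
  the path into scale invariance of the range.\<close>

lemma AE_R:
  assumes c: "0 < c"
  shows "AE \<omega> in M. R \<omega> = pos_values (rat_path c \<omega>)"
  using AE_step_path
proof eventually_elim
  case (elim \<omega>)
  interpret step_path "path \<omega>" by fact
  have "path_range (path \<omega>) = path \<omega> ` ((*) c ` posrat) \<inter> {0<..}"
  proof (rule path_range_dense)
    show "(*) c ` posrat \<subseteq> {0<..}" using c posrat(2) by auto
    fix s t :: real assume "0 < s" "s < t"
    then obtain q where "q \<in> posrat" "s / c < q" "q < t / c"
      using posrat_dense[of "s / c" "t / c"] c by (auto simp: divide_strict_right_mono)
    then show "\<exists>q\<in>(*) c ` posrat. s < q \<and> q < t"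
      using c by (intro bexI[of _ "c * q"]) (auto simp: field_simps)
  qed
  also have "path \<omega> ` ((*) c ` posrat) = rat_path c \<omega> ` posrat"
    by (force simp: rat_path_def image_image)
  finally show ?case by (simp add: pos_values_def)
qed

lemma R_measurable: "R \<in> completion M \<rightarrow>\<^sub>M point_configs"
proof (rule completion.measurable_AE_cong)
  show "(\<lambda>\<omega>. pos_values (rat_path 1 \<omega>)) \<in> completion M \<rightarrow>\<^sub>M point_configs"
    by (rule measurable_completion) (rule measurable_compose[OF rat_path_measurable pos_values_measurable], simp)
  show "AE \<omega> in completion M. pos_values (rat_path 1 \<omega>) = R \<omega>"
    using AE_completion[OF AE_R[of 1]] by auto
qed simp

text \<open>The scaled range comes from \<open>c\<close> times \<open>rat_path 1\<close> and the
  range itself from \<open>rat_path c\<close>, by one measurable map; the two arguments have the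
  same law.\<close>

lemma scale_invariant_R: "scale_invariant M R"
  unfolding scale_invariant_def
proof (intro allI impI)
  fix c :: real assume c: "0 < c"
  let ?Y = "\<lambda>\<omega>. \<lambda>q\<in>posrat. c * rat_path 1 \<omega> q"
  have Y: "?Y \<in> M \<rightarrow>\<^sub>M path_space" by measurable
  have Y_eq: "(*) c ` pos_values (rat_path 1 \<omega>) = pos_values (?Y \<omega>)" for \<omega>
    unfolding pos_values_def mult_image_Int_pos[OF c] by (auto simp: image_image)
  have AE: "AE \<omega> in completion M. pos_values (?Y \<omega>) = (*) c ` R \<omega>"
    using AE_completion[OF AE_R[of 1]] by (auto simp: Y_eq[symmetric])
  have pvY: "(\<lambda>\<omega>. pos_values (?Y \<omega>)) \<in> M \<rightarrow>\<^sub>M point_configs"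
    by (rule measurable_compose[OF Y pos_values_measurable])
  have pvc: "(\<lambda>\<omega>. pos_values (rat_path c \<omega>)) \<in> M \<rightarrow>\<^sub>M point_configs"
    by (rule measurable_compose[OF rat_path_measurable[OF c] pos_values_measurable])
  have cR: "(\<lambda>\<omega>. (*) c ` R \<omega>) \<in> completion M \<rightarrow>\<^sub>M point_configs"
    by (rule completion.measurable_AE_cong[OF measurable_completion[OF pvY] AE]) simp
  have "distr (completion M) point_configs (\<lambda>\<omega>. (*) c ` R \<omega>) = distr (completion M) point_configs (\<lambda>\<omega>. pos_values (?Y \<omega>))"
    by (rule distr_cong_AE[OF refl refl _ cR measurable_completion[OF pvY]]) (use AE in auto)
  also have "\<dots> = distr M point_configs (\<lambda>\<omega>. pos_values (?Y \<omega>))" by (rule distr_completion[OF pvY])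
  also have "\<dots> = distr (distr M path_space ?Y) point_configs pos_values"
    by (simp add: distr_distr[OF pos_values_measurable Y] comp_def)
  also have "\<dots> = distr (distr M path_space (rat_path c)) point_configs pos_values"
    by (simp only: distr_rat_path[OF c])
  also have "\<dots> = distr M point_configs (\<lambda>\<omega>. pos_values (rat_path c \<omega>))"
    by (simp add: distr_distr[OF pos_values_measurable rat_path_measurable[OF c]] comp_def)
  also have "\<dots> = distr (completion M) point_configs (\<lambda>\<omega>. pos_values (rat_path c \<omega>))" by (rule distr_completion[OF pvc, symmetric])
  also have "\<dots> = distr (completion M) point_configs R"
    by (rule distr_cong_AE[OF refl refl _ measurable_completion[OF pvc] R_measurable])
      (use AE_completion[OF AE_R[OF c]] in auto)
  finally show "distr (completion M) point_configs (\<lambda>\<omega>. (*) c ` R \<omega>) = distr (completion M) point_configs R" .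
qed

section \<open>Positivity and unboundedness of the path, local finiteness of the range\<close>

lemma AE_trivial:
  assumes "\<theta> = 0"
  shows "AE \<omega> in M. R \<omega> = {}"
proof -
  have "AE \<omega> in completion M. J \<omega> \<inter> {1 / real (n + 2)<..real (n + 2)} = {}" for n
  proof -
    have ab: "0 < 1 / real (n + 2)" "1 / real (n + 2) < real (n + 2)" by (auto intro: less_le_trans[of _ 1])
    have "AE \<omega> in completion M. npoints (J \<omega>) {1 / real (n + 2)<..real (n + 2)} = 0"
      using nn_integral_jump_count[OF ab] assms interval_void_process.npoints_Ioc_measurable[OF interval_void_jump_times ab]
      by (subst nn_integral_0_iff_AE[symmetric]) auto
    then show ?thesis by (simp add: npoints_empty_iff)
  qed
  then have "AE \<omega> in M. \<forall>n. J \<omega> \<inter> window (Suc n) = {}"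
    by (simp add: AE_all_countable window_def AE_completion_iff add.commute)
  then show ?thesis using AE_jump_path
  proof eventually_elim
    case (elim \<omega>)
    interpret jump_path "path \<omega>" by fact
    have "J \<omega> = {}"
    proof (rule ccontr)
      assume "J \<omega> \<noteq> {}"
      then obtain s where "s \<in> J \<omega>" by auto
      then have "s \<in> (\<Union>n. window n)" unfolding UN_window by (simp add: jump_times_def)
      then obtain n where "s \<in> window n" by blast
      then have "s \<in> window (Suc n)" using incseq_window by (auto simp: incseq_Suc_iff)
      then show False using elim(1) \<open>s \<in> J \<omega>\<close> by auto
    qed
    then have "T s \<omega> = 0" if "0 < s" for s
      using jumps[OF that] by (auto intro: has_sum_unique[OF _ has_sum_empty])
    then show ?case by (auto simp: path_range_def)
  qed
qed

text \<open>If \<open>T s\<close> is 0, the path has no increment on \<open>{a<..s}\<close> for any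
  \<open>a\<close> below \<open>s\<close>. That has probability \<open>a / s\<close> to the power
  \<open>\<theta>\<close>, which vanishes as \<open>a\<close> tends to 0.\<close>

lemma AE_T_pos:
  assumes th: "0 < \<theta>" and s: "0 < s"
  shows "AE \<omega> in M. 0 < T s \<omega>"
proof -
  have [measurable]: "T s \<in> borel_measurable M" using s by simp
  have "prob {\<omega> \<in> space M. T s \<omega> = 0} \<le> exp (- (\<theta> * ln (real (n + 2))))" for n
  proof -
    define a where "a = s / real (n + 2)"
    have a: "0 < a" "a < s" using s by (auto simp: a_def divide_less_eq)
    have [measurable]: "T a \<in> borel_measurable M" using a by simp
    have "prob {\<omega> \<in> space M. T s \<omega> = 0} \<le> prob {\<omega> \<in> space M. T s \<omega> = T a \<omega>}"
    proof (rule finite_measure_mono_AE)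
      show "AE \<omega> in M. \<omega> \<in> {\<omega> \<in> space M. T s \<omega> = 0} \<longrightarrow> \<omega> \<in> {\<omega> \<in> space M. T s \<omega> = T a \<omega>}"
        using AE_nonneg[OF a(1)] AE_mono[OF a(1) less_imp_le[OF a(2)]] by eventually_elim auto
    qed measurable
    also have "\<dots> = exp (- (\<theta> * ln (s / a)))"
      using prob_no_increment[OF a] measure_scale_intensity_Ioc[of a s] a by simp
    also have "s / a = real (n + 2)" using s by (simp add: a_def)
    finally show ?thesis .
  qed
  moreover have "(\<lambda>n. exp (- (\<theta> * ln (real (n + 2))))) \<longlonglongrightarrow> 0"
  proof -
    have "filterlim (\<lambda>n. real (n + 2)) at_top sequentially"
      by (rule filterlim_compose[OF filterlim_real_sequentially filterlim_add_const_nat_at_top])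
    then have "filterlim (\<lambda>n. - \<theta> * ln (real (n + 2))) at_bot sequentially"
      using th by (intro filterlim_tendsto_neg_mult_at_bot[OF tendsto_const] filterlim_compose[OF ln_at_top]) auto
    from filterlim_compose[OF exp_at_bot this] show ?thesis by simp
  qed
  ultimately have "prob {\<omega> \<in> space M. T s \<omega> = 0} \<le> 0"
    by (intro LIMSEQ_le_const) auto
  then have "prob {\<omega> \<in> space M. T s \<omega> = 0} = 0" by (simp add: measure_le_0_iff)
  then have "AE \<omega> in M. T s \<omega> \<noteq> 0" by (subst (asm) prob_Collect_eq_0) auto
  then show ?thesis using AE_nonneg[OF s] by eventually_elim simp
qed

text \<open>Exponential Chebyshev bound: staying below \<open>K\<close> has probability at most
  \<open>exp K\<close> times the mean of \<open>exp (- T n)\<close>. By self-similarity this mean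
  equals that of \<open>exp (- n * T 1)\<close>, which tends to 0 as \<open>T 1\<close> is
  positive.\<close>

lemma AE_unbounded:
  assumes th: "0 < \<theta>"
  shows "AE \<omega> in M. \<forall>K::nat. \<exists>n. real K < T (real (Suc n)) \<omega>"
  unfolding AE_all_countable
proof
  fix K :: nat
  have [measurable]: "T (real (Suc n)) \<in> borel_measurable M" for n by (intro T_measurable) simp
  have [measurable]: "T 1 \<in> borel_measurable M" by simp
  define U where "U = {\<omega> \<in> space M. \<forall>n. T (real (Suc n)) \<omega> \<le> real K}"
  have U: "U \<in> events" unfolding U_def by measurable
  have e: "expectation (\<lambda>\<omega>. exp (- 1 * T (real (Suc n)) \<omega>)) = expectation (\<lambda>\<omega>. exp (- real (Suc n) * T 1 \<omega>))" for n
    using laplace_T[of 1 "real (Suc n)"] laplace_1[of "real (Suc n)"] by simp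
  have lim: "(\<lambda>n. expectation (\<lambda>\<omega>. exp (- real (Suc n) * T 1 \<omega>))) \<longlonglongrightarrow> expectation (\<lambda>\<omega>. 0)"
  proof (rule integral_dominated_convergence[where w = "\<lambda>_. 1"])
    show "AE \<omega> in M. (\<lambda>n. exp (- real (Suc n) * T 1 \<omega>)) \<longlonglongrightarrow> 0"
      using AE_T_pos[OF th zero_less_one]
    proof eventually_elim
      case (elim \<omega>)
      have "filterlim (\<lambda>n. - T 1 \<omega> * real (Suc n)) at_bot sequentially"
        using elim
        by (intro filterlim_tendsto_neg_mult_at_bot[OF tendsto_const] filterlim_compose[OF filterlim_real_sequentially filterlim_Suc]) auto
      from filterlim_compose[OF exp_at_bot this]
      have "(\<lambda>n. exp (- T 1 \<omega> * real (Suc n))) \<longlonglongrightarrow> 0" .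
      moreover have "(\<lambda>n. - T 1 \<omega> * real (Suc n)) = (\<lambda>n. - real (Suc n) * T 1 \<omega>)"
        by (auto simp: fun_eq_iff algebra_simps)
      ultimately show ?case by (simp only: fun_eq_iff)
    qed
    show "AE \<omega> in M. norm (exp (- real (Suc n) * T 1 \<omega>)) \<le> 1" for n
      using AE_nonneg[OF zero_less_one] by eventually_elim (simp add: mult_nonpos_nonneg)
  qed simp_all
  have bound: "prob U \<le> exp (real K) * expectation (\<lambda>\<omega>. exp (- 1 * T (real (Suc n)) \<omega>))" for n
  proof -
    have int: "integrable M (\<lambda>\<omega>. exp (- 1 * T (real (Suc n)) \<omega>))"
      by (intro integrable_exp_neg AE_nonneg) auto
    have "prob U = expectation (indicator U)" using U by simp
    also have "\<dots> \<le> expectation (\<lambda>\<omega>. exp (real K) * exp (- 1 * T (real (Suc n)) \<omega>))"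
    proof (rule integral_mono)
      show "integrable M (indicator U :: 'w \<Rightarrow> real)" using U by (intro integrable_real_indicator) (simp_all add: less_top[symmetric])
      show "integrable M (\<lambda>\<omega>. exp (real K) * exp (- 1 * T (real (Suc n)) \<omega>))"
        using int by (rule integrable_mult_right)
      show "indicator U \<omega> \<le> exp (real K) * exp (- 1 * T (real (Suc n)) \<omega>)" for \<omega>
        by (cases "\<omega> \<in> U") (auto simp: U_def mult_exp_exp simp del: of_nat_Suc)
    qed
    finally show ?thesis by simp
  qed
  have "(\<lambda>n. exp (real K) * expectation (\<lambda>\<omega>. exp (- 1 * T (real (Suc n)) \<omega>))) \<longlonglongrightarrow> exp (real K) * 0"
    unfolding e using lim by (intro tendsto_mult_left) simp
  then have "prob U \<le> exp (real K) * 0" by (rule LIMSEQ_le_const) (use bound in blast)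
  then have "prob U = 0" by (simp add: measure_le_0_iff)
  then have "AE \<omega> in M. \<not> (\<forall>n. T (real (Suc n)) \<omega> \<le> real K)"
    unfolding U_def by (subst (asm) prob_Collect_eq_0) auto
  then show "AE \<omega> in M. \<exists>n. real K < T (real (Suc n)) \<omega>" by (simp add: not_le)
qed

text \<open>Any bounded set away from 0 is trapped between two values of the path, which tends to 0
  at time 0 and is unbounded; between two values there are finitely many range points.\<close>

lemma AE_R_locally_finite:
  assumes th: "0 < \<theta>"
  shows "AE \<omega> in M. \<forall>l h. 0 < l \<longrightarrow> finite (R \<omega> \<inter> {l..h})"
  using AE_step_path AE_unbounded[OF th]
proof eventually_elim
  case (elim \<omega>)
  interpret step_path "path \<omega>" by fact
  show ?case
  proof (intro allI impI)
    fix l h :: real assume l: "0 < l"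
    have "\<forall>\<^sub>F s in at_right 0. T s \<omega> < l" using order_tendstoD(2)[OF zero l] .
    then obtain a0 where a0: "0 < a0" "\<And>s. 0 < s \<Longrightarrow> s < a0 \<Longrightarrow> T s \<omega> < l"
      unfolding eventually_at_right_field by auto
    \<comment> \<open>The bound 1/2 keeps \<open>a\<close> below the time
      \<open>real (Suc n)\<close> found later, which is at least 1.\<close>
    define a where "a = min (a0 / 2) (1 / 2)"
    have a: "0 < a" "a < 1" "T a \<omega> < l" using a0 by (auto simp: a_def)
    obtain K :: nat where "h < real K" using reals_Archimedean2 by blast
    obtain n where n: "real K < T (real (Suc n)) \<omega>" using elim(2) by blast
    have "finite (R \<omega> \<inter> {T a \<omega><..T (real (Suc n)) \<omega>})"
      using a by (intro finite_range_Ioc) auto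
    then show "finite (R \<omega> \<inter> {l..h})"
      by (rule finite_subset[rotated]) (use a(3) n \<open>h < real K\<close> in auto)
  qed
qed

lemma simple_R: "simple_point_process M R"
  unfolding simple_point_process_def
proof
  have "AE \<omega> in M. \<forall>l h. 0 < l \<longrightarrow> finite (R \<omega> \<inter> {l..h})"
  proof (cases "\<theta> = 0")
    case True
    from AE_trivial[OF True] show ?thesis by eventually_elim simp
  next
    case False
    then show ?thesis using theta_nonneg by (intro AE_R_locally_finite) simp
  qed
  then show "AE \<omega> in M. R \<omega> \<subseteq> {0<..} \<and> (\<forall>a b. 0 < a \<longrightarrow> finite (R \<omega> \<inter> {a..b}))"
    by eventually_elim (auto simp: path_range_def)
qed (rule R_measurable)

lemma npoints_R_measurable: "B \<in> sets borel \<Longrightarrow> (\<lambda>\<omega>. npoints (R \<omega>) B) \<in> borel_measurable (completion M)"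
proof -
  assume B: "B \<in> sets borel"
  have "R \<omega> \<inter> B = R \<omega> \<inter> (B \<inter> {0<..})" for \<omega>
    unfolding path_range_def by blast
  then have "npoints (R \<omega>) B = npoints (R \<omega>) (B \<inter> {0<..})" for \<omega> by (simp only: npoints_def)
  then show ?thesis using R_measurable B unfolding measurable_point_configs_iff by simp
qed

text \<open>The signed number of range points between time 1, read as a level, and
  \<open>T 1\<close>. The maximum with 0 keeps both intervals inside the positive half-line for
  every \<open>y\<close>, as measurability of the counts requires.\<close>

definition overshoot :: "(real \<Rightarrow> real) \<Rightarrow> real" where
  "overshoot y = crossing (pos_values y) 1 (max 0 (y 1))"

lemma overshoot_measurable [measurable]: "overshoot \<in> borel_measurable path_space"
proof -
  have one[measurable]: "(\<lambda>y. y 1) \<in> path_space \<rightarrow>\<^sub>M borel"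
    by (rule measurable_component_singleton[OF posrat(3)])
  have "(\<lambda>y. npoints (pos_values y) {1<..max 0 (y 1)}) \<in> borel_measurable path_space"
  proof (rule npoints_pos_values_measurable)
    show "{1<..max 0 (y 1)} \<subseteq> {0<..}" for y :: "real \<Rightarrow> real" by auto
    fix q assume "q \<in> posrat"
    then have q: "(\<lambda>y. y q) \<in> path_space \<rightarrow>\<^sub>M borel" by (rule measurable_component_singleton)
    show "Measurable.pred path_space (\<lambda>y. y q \<in> {1<..max 0 (y 1)})"
      unfolding greaterThanAtMost_iff
      by (intro pred_intros_logic borel_measurable_pred_less borel_measurable_le[folded Measurable.pred_def] borel_measurable_max
          borel_measurable_const q one)
  qed
  moreover have "(\<lambda>y. npoints (pos_values y) {max 0 (y 1)<..1}) \<in> borel_measurable path_space"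
  proof (rule npoints_pos_values_measurable)
    show "{max 0 (y 1)<..1} \<subseteq> {0<..}" for y :: "real \<Rightarrow> real" by auto
    fix q assume "q \<in> posrat"
    then have q: "(\<lambda>y. y q) \<in> path_space \<rightarrow>\<^sub>M borel" by (rule measurable_component_singleton)
    show "Measurable.pred path_space (\<lambda>y. y q \<in> {max 0 (y 1)<..1})"
      unfolding greaterThanAtMost_iff
      by (intro pred_intros_logic borel_measurable_pred_less borel_measurable_le[folded Measurable.pred_def] borel_measurable_max
          borel_measurable_const q one)
  qed
  ultimately show ?thesis
    unfolding overshoot_def crossing_def by measurable
qed

text \<open>The path with time and space both divided by \<open>s\<close>, so that the levels
  \<open>s\<close> and \<open>T s\<close> become 1 and \<open>T s / s\<close>. By self-similarity
  the rescaled path has the law of the original one.\<close>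

definition scaled_overshoot :: "real \<Rightarrow> 'w \<Rightarrow> real" where
  "scaled_overshoot s \<omega> = overshoot (\<lambda>q\<in>posrat. (1 / s) * rat_path s \<omega> q)"

lemma scaled_overshoot_measurable: "0 < s \<Longrightarrow> scaled_overshoot s \<in> borel_measurable M"
  unfolding scaled_overshoot_def by measurable

lemma distr_scaled_overshoot:
  assumes s: "0 < s"
  shows "distr M borel (scaled_overshoot s) = distr M borel (\<lambda>\<omega>. overshoot (rat_path 1 \<omega>))"
proof -
  let ?g = "\<lambda>y. overshoot (\<lambda>q\<in>posrat. (1 / s) * y q)"
  have g: "?g \<in> borel_measurable path_space" by measurable
  have m: "(\<lambda>\<omega>. \<lambda>q\<in>posrat. s * rat_path 1 \<omega> q) \<in> M \<rightarrow>\<^sub>M path_space" by measurable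
  have "distr M borel (scaled_overshoot s) = distr (distr M path_space (rat_path s)) borel ?g"
    unfolding distr_distr[OF g rat_path_measurable[OF s]] comp_def scaled_overshoot_def[abs_def] ..
  also have "\<dots> = distr (distr M path_space (\<lambda>\<omega>. \<lambda>q\<in>posrat. s * rat_path 1 \<omega> q)) borel ?g"
    by (simp only: distr_rat_path[OF s])
  also have "\<dots> = distr M borel (\<lambda>\<omega>. ?g (\<lambda>q\<in>posrat. s * rat_path 1 \<omega> q))"
    unfolding distr_distr[OF g m] comp_def ..
  also have "(\<lambda>\<omega>. ?g (\<lambda>q\<in>posrat. s * rat_path 1 \<omega> q)) = (\<lambda>\<omega>. overshoot (rat_path 1 \<omega>))"
  proof
    fix \<omega>
    have "(\<lambda>q\<in>posrat. (1 / s) * (\<lambda>q\<in>posrat. s * rat_path 1 \<omega> q) q) = rat_path 1 \<omega>"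
      using s by (auto simp: rat_path_def fun_eq_iff)
    then show "?g (\<lambda>q\<in>posrat. s * rat_path 1 \<omega> q) = overshoot (rat_path 1 \<omega>)" by simp
  qed
  finally show ?thesis .
qed

lemma npoints_scale:
  fixes c :: real
  assumes "0 < c"
  shows "npoints ((*) c ` A) {p<..q} = npoints A {p / c<..q / c}"
proof -
  have inj: "inj_on ((*) c) X" for X using assms by (auto simp: inj_on_def)
  have "(*) c ` A \<inter> {p<..q} = (*) c ` (A \<inter> {p / c<..q / c})"
    using assms by (auto simp: field_simps)
  then show ?thesis
    unfolding npoints_def
    by (cases "finite (A \<inter> {p / c<..q / c})") (simp_all add: card_image[OF inj] finite_image_iff[OF inj])
qed

lemma AE_scaled_overshoot:
  assumes s: "0 < s"
  shows "AE \<omega> in M. scaled_overshoot s \<omega> = crossing (R \<omega>) s (T s \<omega>)"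
  using AE_R[OF s] AE_nonneg[OF s]
proof eventually_elim
  case (elim \<omega>)
  have "pos_values (\<lambda>q\<in>posrat. (1 / s) * rat_path s \<omega> q) = (*) (1 / s) ` pos_values (rat_path s \<omega>)"
    unfolding pos_values_def using s mult_image_Int_pos[of "1 / s" "rat_path s \<omega> ` posrat"] by (auto simp: image_image)
  then have pv: "pos_values (\<lambda>q\<in>posrat. (1 / s) * rat_path s \<omega> q) = (*) (1 / s) ` R \<omega>" using elim(1) by simp
  have one: "(\<lambda>q\<in>posrat. (1 / s) * rat_path s \<omega> q) 1 = T s \<omega> / s"
    using posrat(3) by (simp add: rat_path_def)
  have "max 0 (T s \<omega> / s) = T s \<omega> / s" using elim(2) s by simp
  moreover have "0 < 1 / s" using s by simp
  ultimately show ?case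
    unfolding scaled_overshoot_def overshoot_def pv one crossing_def using s
    by (simp only: npoints_scale) simp
qed

text \<open>
  Both the range points in \<open>(T a, T b]\<close> and the jump times in \<open>(a, b]\<close> count the same jumps, so the
  numbers of range points and of jump times in \<open>(a, b]\<close> differ by a difference of two overshoots,
  which have the same law by self-similarity.
\<close>

lemma nn_integral_npoints_R:
  assumes th: "0 < \<theta>" and ab: "0 < a" "a < b"
  shows "(\<integral>\<^sup>+\<omega>. npoints (R \<omega>) {a<..b} \<partial>completion M) = ennreal (\<theta> * ln (b / a))"
proof -
  interpret C: prob_space "completion M" by (rule prob_space_completion)
  have b: "0 < b" using ab by simp
  define U where "U \<omega> = enn2real (npoints (R \<omega>) {a<..b})" for \<omega>
  define V where "V \<omega> = enn2real (npoints (J \<omega>) {a<..b})" for \<omega>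
  note J_meas[measurable] = interval_void_process.npoints_Ioc_measurable[OF interval_void_jump_times ab]
  note R_meas[measurable] = npoints_R_measurable[of "{a<..b}", simplified]
  have U: "U \<in> borel_measurable (completion M)" unfolding U_def by measurable
  have V: "V \<in> borel_measurable (completion M)" unfolding V_def by measurable
  have finJ: "AE \<omega> in completion M. ennreal (V \<omega>) = npoints (J \<omega>) {a<..b}"
    using AE_completion[OF AE_step_path]
    by eventually_elim (auto simp: V_def npoints_finite_iff step_path.finite_Ioc ab(1) intro!: ennreal_enn2real)
  have finR: "AE \<omega> in completion M. ennreal (U \<omega>) = npoints (R \<omega>) {a<..b}"
    using AE_completion[OF AE_R_locally_finite[OF th]]
  proof eventually_elim
    case (elim \<omega>)
    then have "finite (R \<omega> \<inter> {a<..b})" by (intro finite_subset[OF _ elim[rule_format, OF ab(1), of b]]) auto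
    then show ?case unfolding U_def by (intro ennreal_enn2real) (simp add: npoints_finite_iff)
  qed
  have nnV: "(\<integral>\<^sup>+\<omega>. ennreal (V \<omega>) \<partial>completion M) = ennreal (\<theta> * ln (b / a))"
    using finJ nn_integral_jump_count[OF ab] by (simp cong: nn_integral_cong_AE)
  have "(\<integral>\<^sup>+\<omega>. ennreal (U \<omega>) \<partial>completion M) = (\<integral>\<^sup>+\<omega>. ennreal (V \<omega>) \<partial>completion M)"
  proof (rule C.mean_eq_of_same_law[where X = "scaled_overshoot b" and Y = "scaled_overshoot a"])
    show "scaled_overshoot b \<in> borel_measurable (completion M)" "scaled_overshoot a \<in> borel_measurable (completion M)"
      using scaled_overshoot_measurable ab b by (auto intro: measurable_completion)
    show "distr (completion M) borel (scaled_overshoot b) = distr (completion M) borel (scaled_overshoot a)"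
      using scaled_overshoot_measurable ab b by (simp add: distr_completion distr_scaled_overshoot)
    show "integrable (completion M) V"
      using V nnV by (intro integrableI_bounded) (auto simp: V_def)
    have "AE \<omega> in M. U \<omega> + scaled_overshoot b \<omega> = scaled_overshoot a \<omega> + V \<omega>"
      using AE_step_path AE_R_locally_finite[OF th] AE_scaled_overshoot[OF ab(1)] AE_scaled_overshoot[OF b]
        AE_T_pos[OF th ab(1)] AE_T_pos[OF th b]
    proof eventually_elim
      case (elim \<omega>)
      interpret step_path "path \<omega>" by fact
      have coc: "crossing (R \<omega>) p q + crossing (R \<omega>) q r = crossing (R \<omega>) p r" if "0 < p" "0 < q" "0 < r" for p q r
        using elim(2) that by (intro crossing_cocycle) auto
      have "U \<omega> = crossing (R \<omega>) a b"
        using ab by (simp add: U_def crossing_def npoints_def)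
      moreover have "V \<omega> = crossing (R \<omega>) (T a \<omega>) (T b \<omega>)"
        using range_counts_jumps[OF ab] mono'[OF ab(1), of b] ab by (simp add: V_def crossing_def) (simp add: npoints_def)
      \<comment> \<open>The two routes from \<open>a\<close> to \<open>T b\<close>, through
        \<open>b\<close> and through \<open>T a\<close>, carry the same signed count.\<close>
      moreover have "crossing (R \<omega>) a b + crossing (R \<omega>) b (T b \<omega>) = crossing (R \<omega>) a (T a \<omega>) + crossing (R \<omega>) (T a \<omega>) (T b \<omega>)"
        using coc[of a b "T b \<omega>"] coc[of a "T a \<omega>" "T b \<omega>"] ab b elim by simp
      ultimately show ?case using elim by simp
    qed
    then show "AE \<omega> in completion M. U \<omega> + scaled_overshoot b \<omega> = scaled_overshoot a \<omega> + V \<omega>"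
      by (rule AE_completion)
  qed (use U V in \<open>auto simp: U_def V_def\<close>)
  with finR nnV show ?thesis by (simp cong: nn_integral_cong_AE)
qed

lemma has_intensity_R: "has_intensity M R (scale_intensity \<theta>)"
  unfolding has_intensity_def
proof (intro ballI impI)
  fix B :: "real set" assume B: "B \<in> sets borel" "B \<subseteq> {0<..}"
  show "(\<integral>\<^sup>+\<omega>. npoints (R \<omega>) B \<partial>completion M) = emeasure (scale_intensity \<theta>) B"
  proof (cases "\<theta> = 0")
    case True
    have "AE \<omega> in completion M. npoints (R \<omega>) B = 0"
      using AE_completion[OF AE_trivial[OF True]] by eventually_elim (simp add: npoints_def)
    then have "(\<integral>\<^sup>+\<omega>. npoints (R \<omega>) B \<partial>completion M) = (\<integral>\<^sup>+\<omega>. 0 \<partial>completion M)" by (rule nn_integral_cong_AE)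
    then show ?thesis using B True by (simp add: emeasure_scale_intensity)
  next
    case False
    then have th: "0 < \<theta>" using theta_nonneg by simp
    \<comment> \<open>The range as a random counting measure: its mean is a measure, so the formula
      for intervals extends to Borel sets by uniqueness.\<close>
    define K where "K \<omega> = distr (count_space (R \<omega>)) borel (\<lambda>x. x)" for \<omega>
    have K: "sets (K \<omega>) = sets borel" for \<omega> by (simp add: K_def)
    have KA: "emeasure (K \<omega>) A = npoints (R \<omega>) A" if "A \<in> sets borel" for \<omega> A
    proof -
      have "emeasure (K \<omega>) A = emeasure (count_space (R \<omega>)) (A \<inter> R \<omega>)"
        unfolding K_def using that by (subst emeasure_distr) auto
      then show ?thesis by (simp add: npoints_def emeasure_count_space Int_commute)
    qed
    have mean: "emeasure (mean_measure (completion M) borel K) A = (\<integral>\<^sup>+\<omega>. npoints (R \<omega>) A \<partial>completion M)"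
      if "A \<in> sets borel" for A
      using emeasure_mean_measure[of K borel "completion M" A] K KA npoints_R_measurable that by simp
    have "emeasure (mean_measure (completion M) borel K) B = emeasure (scale_intensity \<theta>) B"
    proof (rule scale_intensity_unique)
      fix a b :: real assume ab: "0 < a" "a < b"
      show "emeasure (mean_measure (completion M) borel K) {a<..b} = emeasure (scale_intensity \<theta>) {a<..b}"
        using ab theta_nonneg by (simp add: mean nn_integral_npoints_R[OF th ab] scale_intensity_Ioc)
    qed (use B theta_nonneg in auto)
    then show ?thesis by (simp add: mean[OF B(1)])
  qed
qed

lemma range_scale_invariant: "scale_invariant_point_process M R \<theta>"
  unfolding scale_invariant_point_process_def
  by (intro conjI simple_R scale_invariant_R has_intensity_R)

end

theorem theorem1p2:
  fixes M :: "'w measure"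
    and T :: "real \<Rightarrow> 'w \<Rightarrow> real"
    and k :: "real \<Rightarrow> real"
    and \<theta> :: real
  assumes "prob_space M"
    and "SSA_process M T"
    and "nondecreasing_process M T"
    and "no_drift M T"
    and "key_function M T k"
    and "(k \<longlongrightarrow> \<theta>) (at_right 0)"
  shows "scale_invariant_point_process M (\<lambda>\<omega>. path_range (\<lambda>s. T s \<omega>)) \<theta> \<and>
         scale_invariant_poisson_process M (\<lambda>\<omega>. jump_times (\<lambda>s. T s \<omega>)) \<theta> \<and>
         scale_invariant_poisson_process M (\<lambda>\<omega>. jump_sizes (\<lambda>s. T s \<omega>)) \<theta>"
proof -
  interpret prob_space M by fact
  interpret ssa_process M k \<theta> T
    by unfold_locales (use assms in \<open>auto simp: key_function_def\<close>)
  show ?thesis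
    using range_scale_invariant jump_times_poisson jump_sizes_poisson by blast
qed

end
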